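(* Let $1\le k\le n$ and let $d$ be a homogeneous distance on the Heisenberg group $\mathbb{H}^n$ whose closed unit ball $\mathbb{B}(0,1)$ is convex. Let $\mathbb{H}^n=\mathbb{W}\rtimes\mathbb{V}$ be a semidirect factorization with $\mathbb{W}$ vertical and $\mathbb{V}$ horizontal of dimension $k$, and let $\Sigma$ be a parametrized $\mathbb{H}$-regular surface with respect to $(\mathbb{W},\mathbb{V})$, with parametrization $\phi:U\to\mathbb{V}$, graph map $\Phi(n)=n\phi(n)$ and defining function $f\in C^1_h(\Omega,\mathbb{R}^k)$. Let $(v_1,\dots,v_k)$ and $(w_{k+1},\dots,w_{2n},e_{2n+1})$ be orthonormal bases of $\mathbb{V}$ and $\mathbb{W}$, $V=v_1\wedge\cdots\wedge v_k$, $N=w_{k+1}\wedge\cdots\wedge w_{2n}\wedge e_{2n+1}$, and for Borel sets $B$ let $$\mu(B)=\|V\wedge N\|_g\int_{\Phi^{-1}(B)}\frac{J_Hf(\Phi(n))}{J_{\mathbb{V}}f(\Phi(n))}\,d\mathcal{H}^{2n+1-k}_E(n).$$ Then $\Theta^{*\,2n+2-k}(\mu,x)=\theta^{2n+2-k}(\mu,x)$ for every $x\in\Sigma$, and in particular $$\mathcal{C}^{2n+2-k}\llcorner\Sigma=\mathcal{S}^{2n+2-k}\llcorner\Sigma.$$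
   Context: Heisenberg group: $\mathbb{H}^n=H_1\oplus H_2$ is a real vector space, $\dim H_1=2n$, $\dim H_2=1$, with a symplectic form $\omega$ on $H_1$ and a fixed $0\ne e_{2n+1}\in H_2$; $\pi_{H_1}$ is the projection on $H_1$, $[p,q]=\omega(\pi_{H_1}p,\pi_{H_1}q)e_{2n+1}$ and $pq=p+q+\frac12[p,q]$ (identity $0$). Dilations: $\delta_t$ is linear with $\delta_t w=t^iw$ for $w\in H_i$, $t>0$. Fix a basis $(e_1,\dots,e_{2n})$ of $H_1$ with $\omega(e_i,e_{n+j})=\delta_{ij}$, $\omega(e_i,e_j)=\omega(e_{n+i},e_{n+j})=0$ for $1\le i,j\le n$, and the scalar product $\langle\cdot,\cdot\rangle$ making $(e_1,\dots,e_{2n+1})$ orthonormal; this identifies $\mathbb{H}^n$ with $\mathbb{R}^{2n+1}$ (convexity is in this vector space). $\|\cdot\|_g$ on multivectors is the norm induced by $\langle\cdot,\cdot\rangle$. $\mathcal{H}^p_E$ is the $p$-dimensional Hausdorff measure for the Euclidean distance (normalized to agree with Lebesgue measure on $p$-dimensional subspaces). A homogeneous distance $d$ is a distance with $d(zx,zy)=d(x,y)$ and $d(\delta_tx,\delta_ty)=t\,d(x,y)$; $\|x\|=d(x,0)$; $\mathbb{B}(x,r)=\{y:d(x,y)\le r\}$. Homogeneous subgroups are Lie subgroups closed under all $\delta_t$; vertical ones contain $H_2$, horizontal ones are contained in $H_1$. $\mathbb{H}^n=\mathbb{W}\rtimes\mathbb{V}$ means $\mathbb{W}$ vertical, $\mathbb{V}$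 horizontal, $\mathbb{H}^n=\mathbb{W}\mathbb{V}$, $\mathbb{W}\cap\mathbb{V}=\{0\}$; then $x=\pi_{\mathbb{W}}(x)\pi_{\mathbb{V}}(x)$ uniquely. An h-homomorphism is a homogeneous (commuting with dilations) group homomorphism; on $\mathbb{R}^k$ dilations are $y\mapsto ty$. For $\Omega\subset\mathbb{H}^n$ open, $f\in C^1_h(\Omega,\mathbb{R}^k)$ means that at each $x\in\Omega$ there is an h-homomorphism $Df(x):\mathbb{H}^n\to\mathbb{R}^k$ with $|f(xw)-f(x)-Df(x)(w)|=o(\|w\|)$ as $w\to0$, and $x\mapsto Df(x)$ is continuous. For scalar $f_i$, $\nabla_Hf_i(x)\in H_1$ is given by $Df_i(x)(z)=\langle\nabla_Hf_i(x),z\rangle$ for all $z$, and $\nabla_{\mathbb{V}}f_i(x)\in\mathbb{V}$ by the same identity for $z\in\mathbb{V}$. $J_Hf(x)=\|\nabla_Hf_1(x)\wedge\cdots\wedge\nabla_Hf_k(x)\|_g$, $J_{\mathbb{V}}f(x)=\|\nabla_{\mathbb{V}}f_1(x)\wedge\cdots\wedge\nabla_{\mathbb{V}}f_k(x)\|_g$. $\Sigma$ is a ($k$-codimensional) $\mathbb{H}$-regular surface if each $x\in\Sigma$ has an open neighbourhood $\Omega_x$ and $h\in C^1_h(\Omega_x,\mathbb{R}^k)$ with $\Sigma\cap\Omega_x=\{h=0\}$ and $\nabla_Hh_1\wedge\cdots\wedge\nabla_Hh_k\neq0$ on $\Omega_x$. For $\phi:U\to\mathbb{V}$, $U\subset\mathbb{W}$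 open, $x\in\mathbb{H}^n$: $\sigma_x(w)=xw\,\pi_{\mathbb{V}}(x)^{-1}$ on $\mathbb{W}$, and $\phi_x(w)=\pi_{\mathbb{V}}(x)\phi(\sigma_{x^{-1}}(w))$ for $w\in\sigma_x(U)$. With $\Phi(w)=w\phi(w)$, $\phi$ is uniformly intrinsic differentiable on $U$ if for each $\bar w\in U$ there is an h-homomorphism $d\phi_{\bar w}:\mathbb{W}\to\mathbb{V}$ with $\lim_{\delta\to0}\sup_{\|\bar w^{-1}w'\|<\delta}\sup_{0<\|w\|<\delta}d(d\phi_{\bar w}(w),\phi_{\Phi(w')^{-1}}(w))/\|w\|=0$. An $\mathbb{H}$-regular surface $\Sigma$ is a parametrized $\mathbb{H}$-regular surface with respect to $(\mathbb{W},\mathbb{V})$, with parametrization $\phi$, if $\mathbb{H}^n=\mathbb{W}\rtimes\mathbb{V}$ and $\Sigma=\{u\phi(u):u\in U\}$ with $U\subset\mathbb{W}$ open and $\phi:U\to\mathbb{V}$ uniformly intrinsic differentiable. A function $f\in C^1_h(\Omega,\mathbb{R}^k)$, $\Omega$ open, $\Sigma\subset\Omega$, is a defining function of $\Sigma$ if $f^{-1}(f(x_0))\cap U\mathbb{V}=\Sigma$ for some $x_0\in\Sigma$ and $Df(x)$ is surjective for all $x\in\Sigma$. Densities: $\Theta^{*\alpha}(\mu,x)=\limsup_{r\to0}\mu(\mathbb{B}(x,r))/r^\alpha$; $\theta^\alpha(\mu,x)=\inf_{\epsilon>0}\sup\{2^\alpha\mu(\mathbb{B}(y,r))/\mathrm{diam}(\mathbb{B}(y,r))^\alpha: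 x\in\mathbb{B}(y,r),\ 0<r<\epsilon\}$, with $\mathrm{diam}\,\mathbb{B}(y,r)=2r$. Spherical measure: $\mathcal{S}^\alpha(A)=\sup_{\delta>0}\inf\{\sum_j2^{-\alpha}\mathrm{diam}(B_j)^\alpha: A\subset\bigcup_jB_j,\ B_j\text{ closed }d\text{-balls},\ \mathrm{diam}(B_j)\le\delta\}$. Centered Hausdorff measure: $\mathcal{C}^\alpha(A)=\sup_{E\subset A}\mathcal{D}^\alpha(E)$, $\mathcal{D}^\alpha(E)=\lim_{\delta\to0^+}\mathcal{C}^\alpha_\delta(E)$, $\mathcal{C}^\alpha_\delta(\emptyset)=0$ and for $E\ne\emptyset$, $\mathcal{C}^\alpha_\delta(E)=\inf\{\sum_ir_i^\alpha: E\subset\bigcup_i\mathbb{B}(x_i,r_i),\ x_i\in E,\ \mathrm{diam}(\mathbb{B}(x_i,r_i))\le\delta\}$. $\nu\llcorner\Sigma$ is the restriction $B\mapsto\nu(B\cap\Sigma)$, $B$ Borel. *)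

theory Defs
  imports "HOL-Analysis.Analysis"
begin

section \<open>The Heisenberg group\<close>

text \<open>
  The space is written in the coordinates of the fixed symplectic orthonormal basis:
  \<open>((a, b), t)\<close> stands for the sum of the \<open>a\<^sub>i e\<^sub>i\<close>, the \<open>b\<^sub>i e\<^sub>n\<^sub>+\<^sub>i\<close> and \<open>t e\<^sub>2\<^sub>n\<^sub>+\<^sub>1\<close>,
  where \<open>n = CARD('n)\<close>. The vector space structure, the scalar product, the Euclidean topology and
  the Borel sets are those of the product type. Every homogeneous distance induces this topology.
\<close>

type_synonym 'n heis = "((real ^ 'n) \<times> (real ^ 'n)) \<times> real"

definition symp :: "(real ^ 'n) \<times> (real ^ 'n) \<Rightarrow> (real ^ 'n) \<times> (real ^ 'n) \<Rightarrow> real" where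
  "symp z z' = fst z \<bullet> snd z' - snd z \<bullet> fst z'"

definition e_last :: "'n::finite heis" where
  "e_last = (0, 1)"

definition H1 :: "'n::finite heis set" where
  "H1 = {p. snd p = 0}"

definition H2 :: "'n::finite heis set" where
  "H2 = {p. fst p = 0}"

definition hbracket :: "'n::finite heis \<Rightarrow> 'n heis \<Rightarrow> 'n heis" where
  "hbracket p q = symp (fst p) (fst q) *\<^sub>R e_last"

definition hmul :: "'n::finite heis \<Rightarrow> 'n heis \<Rightarrow> 'n heis" (infixl "\<odot>" 70) where
  "p \<odot> q = p + q + (1/2) *\<^sub>R hbracket p q"

definition hinv :: "'n::finite heis \<Rightarrow> 'n heis" where
  "hinv p = - p"

lemma hmul_hinv: "p \<odot> hinv p = 0" "hinv p \<odot> p = 0" "p \<odot> 0 = p" "0 \<odot> p = p"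
  by (simp_all add: hmul_def hinv_def hbracket_def symp_def inner_commute)

definition dil :: "real \<Rightarrow> 'n::finite heis \<Rightarrow> 'n heis" where
  "dil t p = (t *\<^sub>R fst p, t\<^sup>2 * snd p)"

section \<open>Homogeneous distances\<close>

definition homogeneous_distance :: "('n::finite heis \<Rightarrow> 'n heis \<Rightarrow> real) \<Rightarrow> bool" where
  "homogeneous_distance d \<longleftrightarrow> Metric_space UNIV d
     \<and> (\<forall>x y z. d (z \<odot> x) (z \<odot> y) = d x y)
     \<and> (\<forall>x y. \<forall>t>0. d (dil t x) (dil t y) = t * d x y)"

definition hnorm :: "('n::finite heis \<Rightarrow> 'n heis \<Rightarrow> real) \<Rightarrow> 'n heis \<Rightarrow> real" where
  "hnorm d x = d x 0"

definition hball :: "('n::finite heis \<Rightarrow> 'n heis \<Rightarrow> real) \<Rightarrow> 'n heis \<Rightarrow> real \<Rightarrow> 'n heis set" where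
  "hball d x r = {y. d x y \<le> r}"

text \<open>Diameter with respect to \<open>d\<close>; it is only applied to closed balls of positive radius.\<close>

definition hdiam :: "('n::finite heis \<Rightarrow> 'n heis \<Rightarrow> real) \<Rightarrow> 'n heis set \<Rightarrow> real" where
  "hdiam d A = Sup {d x y | x y. x \<in> A \<and> y \<in> A}"

section \<open>Homogeneous subgroups and semidirect factorizations\<close>

text \<open>Lie subgroups are rendered as topologically closed subgroups (Cartan's theorem).\<close>

definition homogeneous_subgroup :: "'n::finite heis set \<Rightarrow> bool" where
  "homogeneous_subgroup G \<longleftrightarrow> closed G \<and> 0 \<in> G
     \<and> (\<forall>x\<in>G. \<forall>y\<in>G. x \<odot> y \<in> G) \<and> (\<forall>x\<in>G. hinv x \<in> G)
     \<and> (\<forall>t>0. \<forall>x\<in>G. dil t x \<in> G)"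

definition vertical_subgroup :: "'n::finite heis set \<Rightarrow> bool" where
  "vertical_subgroup G \<longleftrightarrow> homogeneous_subgroup G \<and> H2 \<subseteq> G"

definition horizontal_subgroup :: "'n::finite heis set \<Rightarrow> bool" where
  "horizontal_subgroup G \<longleftrightarrow> homogeneous_subgroup G \<and> G \<subseteq> H1"

definition hsetmul :: "'n::finite heis set \<Rightarrow> 'n heis set \<Rightarrow> 'n heis set" where
  "hsetmul A B = {a \<odot> b | a b. a \<in> A \<and> b \<in> B}"

definition semidirect :: "'n::finite heis set \<Rightarrow> 'n heis set \<Rightarrow> bool" where
  "semidirect W V \<longleftrightarrow> vertical_subgroup W \<and> horizontal_subgroup V
     \<and> hsetmul W V = UNIV \<and> W \<inter> V = {0}"

definition projV :: "'n::finite heis set \<Rightarrow> 'n heis set \<Rightarrow> 'n heis \<Rightarrow> 'n heis" where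
  "projV W V x = (THE v. v \<in> V \<and> (\<exists>w\<in>W. x = w \<odot> v))"

section \<open>Horizontal differentiability\<close>

definition h_hom_vec :: "('n::finite heis \<Rightarrow> 'b::real_normed_vector) \<Rightarrow> bool" where
  "h_hom_vec L \<longleftrightarrow> (\<forall>x y. L (x \<odot> y) = L x + L y) \<and> (\<forall>t>0. \<forall>x. L (dil t x) = t *\<^sub>R L x)"

definition h_hom_sub :: "'n::finite heis set \<Rightarrow> 'n heis set \<Rightarrow> ('n heis \<Rightarrow> 'n heis) \<Rightarrow> bool" where
  "h_hom_sub W V L \<longleftrightarrow> L ` W \<subseteq> V \<and> (\<forall>x\<in>W. \<forall>y\<in>W. L (x \<odot> y) = L x \<odot> L y)
     \<and> (\<forall>t>0. \<forall>x\<in>W. L (dil t x) = dil t (L x))"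

definition has_hderiv ::
  "('n::finite heis \<Rightarrow> 'n heis \<Rightarrow> real) \<Rightarrow> ('n heis \<Rightarrow> 'b::real_normed_vector) \<Rightarrow> 'n heis
     \<Rightarrow> ('n heis \<Rightarrow> 'b) \<Rightarrow> bool" where
  "has_hderiv d f x L \<longleftrightarrow> h_hom_vec L
     \<and> ((\<lambda>w. norm (f (x \<odot> w) - f x - L w) / hnorm d w) \<longlongrightarrow> 0) (at 0)"

definition hderiv ::
  "('n::finite heis \<Rightarrow> 'n heis \<Rightarrow> real) \<Rightarrow> ('n heis \<Rightarrow> 'b::real_normed_vector) \<Rightarrow> 'n heis
     \<Rightarrow> ('n heis \<Rightarrow> 'b)" where
  "hderiv d f x = (THE L. has_hderiv d f x L)"

text \<open>
  Continuity of the differential is stated for the topology of the function type, that is for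
  pointwise convergence. On h-homomorphisms, which form a finite-dimensional space of linear maps,
  this is the usual (operator norm) topology.
\<close>

definition C1h ::
  "('n::finite heis \<Rightarrow> 'n heis \<Rightarrow> real) \<Rightarrow> 'n heis set \<Rightarrow> ('n heis \<Rightarrow> 'b::real_normed_vector)
     \<Rightarrow> bool" where
  "C1h d \<Omega> f \<longleftrightarrow> open \<Omega> \<and> (\<forall>x\<in>\<Omega>. \<exists>L. has_hderiv d f x L) \<and> continuous_on \<Omega> (hderiv d f)"

definition hgrad ::
  "('n::finite heis \<Rightarrow> 'n heis \<Rightarrow> real) \<Rightarrow> ('n heis \<Rightarrow> real) \<Rightarrow> 'n heis \<Rightarrow> 'n heis" where
  "hgrad d g x = (THE u. u \<in> H1 \<and> (\<forall>z. hderiv d g x z = u \<bullet> z))"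

definition vgrad ::
  "('n::finite heis \<Rightarrow> 'n heis \<Rightarrow> real) \<Rightarrow> 'n heis set \<Rightarrow> ('n heis \<Rightarrow> real) \<Rightarrow> 'n heis
     \<Rightarrow> 'n heis" where
  "vgrad d V g x = (THE u. u \<in> V \<and> (\<forall>z\<in>V. hderiv d g x z = u \<bullet> z))"

text \<open>
  The scalar product on multivectors is given on simple ones by
  \<open>\<langle>v\<^sub>1 \<and> \<dots> \<and> v\<^sub>k, w\<^sub>1 \<and> \<dots> \<and> w\<^sub>k\<rangle> = det (\<langle>v\<^sub>i, w\<^sub>j\<rangle>)\<close>. Only norms of simple multivectors occur here,
  so the order of the factors is immaterial and they may be indexed by any finite type.
\<close>

definition wedge_inner :: "('i::finite \<Rightarrow> 'a::real_inner) \<Rightarrow> ('i \<Rightarrow> 'a) \<Rightarrow> real" where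
  "wedge_inner v w = det (\<chi> i j. v i \<bullet> w j)"

definition wedge_norm :: "('i::finite \<Rightarrow> 'a::real_inner) \<Rightarrow> real" where
  "wedge_norm v = sqrt (wedge_inner v v)"

definition JH ::
  "('n::finite heis \<Rightarrow> 'n heis \<Rightarrow> real) \<Rightarrow> ('n heis \<Rightarrow> real ^ 'k::finite) \<Rightarrow> 'n heis \<Rightarrow> real" where
  "JH d f x = wedge_norm (\<lambda>i. hgrad d (\<lambda>y. f y $ i) x)"

definition JV ::
  "('n::finite heis \<Rightarrow> 'n heis \<Rightarrow> real) \<Rightarrow> 'n heis set \<Rightarrow> ('n heis \<Rightarrow> real ^ 'k::finite)
     \<Rightarrow> 'n heis \<Rightarrow> real" where
  "JV d V f x = wedge_norm (\<lambda>i. vgrad d V (\<lambda>y. f y $ i) x)"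

section \<open>Regular surfaces\<close>

text \<open>
  The type argument \<open>'k\<close> carries the codimension \<open>CARD('k)\<close>. The condition
  \<open>JH d h y \<noteq> 0\<close> says that the wedge product of the horizontal gradients does not vanish.
\<close>

definition H_regular_surface ::
  "'k::finite itself \<Rightarrow> ('n::finite heis \<Rightarrow> 'n heis \<Rightarrow> real) \<Rightarrow> 'n heis set \<Rightarrow> bool" where
  "H_regular_surface k d S \<longleftrightarrow>
     (\<forall>x\<in>S. \<exists>\<Omega>. \<exists>h :: 'n heis \<Rightarrow> real ^ 'k. open \<Omega> \<and> x \<in> \<Omega> \<and> C1h d \<Omega> h
        \<and> S \<inter> \<Omega> = {y\<in>\<Omega>. h y = 0} \<and> (\<forall>y\<in>\<Omega>. JH d h y \<noteq> 0))"

definition sigma_tr ::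
  "'n::finite heis set \<Rightarrow> 'n heis set \<Rightarrow> 'n heis \<Rightarrow> 'n heis \<Rightarrow> 'n heis" where
  "sigma_tr W V x w = x \<odot> w \<odot> hinv (projV W V x)"

definition phi_tr ::
  "'n::finite heis set \<Rightarrow> 'n heis set \<Rightarrow> ('n heis \<Rightarrow> 'n heis) \<Rightarrow> 'n heis \<Rightarrow> 'n heis \<Rightarrow> 'n heis"
  where "phi_tr W V \<phi> x w = projV W V x \<odot> \<phi> (sigma_tr W V (hinv x) w)"

definition graph_map :: "('n::finite heis \<Rightarrow> 'n heis) \<Rightarrow> 'n heis \<Rightarrow> 'n heis" where
  "graph_map \<phi> w = w \<odot> \<phi> w"

text \<open>
  The suprema range over those \<open>w' \<in> U\<close> and those \<open>w\<close> in the domain \<open>\<sigma>\<^sub>x(U)\<close> of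
  \<open>\<phi>\<^sub>x\<close>, \<open>x = \<Phi>(w')\<^sup>-\<^sup>1\<close>, that satisfy the stated bounds.
\<close>

definition unif_intrinsic_differentiable ::
  "('n::finite heis \<Rightarrow> 'n heis \<Rightarrow> real) \<Rightarrow> 'n heis set \<Rightarrow> 'n heis set \<Rightarrow> 'n heis set
     \<Rightarrow> ('n heis \<Rightarrow> 'n heis) \<Rightarrow> bool" where
  "unif_intrinsic_differentiable d W V U \<phi> \<longleftrightarrow>
     (\<forall>wb\<in>U. \<exists>L. h_hom_sub W V L \<and>
        ((\<lambda>\<delta>. SUP w' \<in> {w'\<in>U. hnorm d (hinv wb \<odot> w') < \<delta>}.
               SUP w \<in> {w \<in> sigma_tr W V (hinv (graph_map \<phi> w')) ` U. 0 < hnorm d w \<and> hnorm d w < \<delta>}.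
                 ennreal (d (L w) (phi_tr W V \<phi> (hinv (graph_map \<phi> w')) w) / hnorm d w))
          \<longlongrightarrow> 0) (at_right 0))"

definition parametrized_H_regular_surface ::
  "'k::finite itself \<Rightarrow> ('n::finite heis \<Rightarrow> 'n heis \<Rightarrow> real) \<Rightarrow> 'n heis set \<Rightarrow> 'n heis set
     \<Rightarrow> 'n heis set \<Rightarrow> ('n heis \<Rightarrow> 'n heis) \<Rightarrow> 'n heis set \<Rightarrow> bool" where
  "parametrized_H_regular_surface k d W V U \<phi> S \<longleftrightarrow>
     H_regular_surface k d S \<and> semidirect W V
     \<and> openin (top_of_set W) U \<and> \<phi> ` U \<subseteq> V \<and> S = graph_map \<phi> ` U
     \<and> unif_intrinsic_differentiable d W V U \<phi>"

definition defining_function ::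
  "('n::finite heis \<Rightarrow> 'n heis \<Rightarrow> real) \<Rightarrow> 'n heis set \<Rightarrow> 'n heis set \<Rightarrow> 'n heis set
     \<Rightarrow> 'n heis set \<Rightarrow> ('n heis \<Rightarrow> real ^ 'k::finite) \<Rightarrow> bool" where
  "defining_function d V U S \<Omega> f \<longleftrightarrow> open \<Omega> \<and> S \<subseteq> \<Omega> \<and> C1h d \<Omega> f
     \<and> (\<exists>x0\<in>S. {y\<in>\<Omega>. f y = f x0} \<inter> hsetmul U V = S)
     \<and> (\<forall>x\<in>S. surj (hderiv d f x))"

section \<open>Measures and densities\<close>

text \<open>
  The factor \<open>unit_ball_vol p * (diam / 2)\<^sup>p\<close> is the normalization for which the \<open>p\<close>-dimensional
  measure agrees with Lebesgue measure on \<open>p\<close>-dimensional subspaces.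
  Coverings here and below are countable families, indexed by some \<open>J \<subseteq> \<nat>\<close>.
\<close>

definition hausdorff_outer :: "nat \<Rightarrow> 'a::euclidean_space set \<Rightarrow> ennreal" where
  "hausdorff_outer p A = (SUP \<delta>\<in>{0<..}. Inf
     {(\<Sum>\<^sub>\<infinity>j\<in>J. ennreal (unit_ball_vol (real p) * (diameter (E j) / 2) ^ p)) | (J::nat set) E.
        A \<subseteq> (\<Union>j\<in>J. E j) \<and> (\<forall>j\<in>J. E j \<noteq> {} \<and> bounded (E j) \<and> diameter (E j) \<le> \<delta>)})"

definition hausdorff_measure :: "nat \<Rightarrow> 'a::euclidean_space measure" where
  "hausdorff_measure p = measure_of UNIV (sets borel) (hausdorff_outer p)"

definition spherical_measure ::
  "('n::finite heis \<Rightarrow> 'n heis \<Rightarrow> real) \<Rightarrow> real \<Rightarrow> 'n heis set \<Rightarrow> ennreal" where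
  "spherical_measure d \<alpha> A = (SUP \<delta>\<in>{0<..}. Inf
     {(\<Sum>\<^sub>\<infinity>j\<in>J. ennreal (2 powr (- \<alpha>) * hdiam d (hball d (c j) (r j)) powr \<alpha>)) | (J::nat set) c r.
        A \<subseteq> (\<Union>j\<in>J. hball d (c j) (r j)) \<and> (\<forall>j\<in>J. 0 < r j \<and> hdiam d (hball d (c j) (r j)) \<le> \<delta>)})"

definition centered_delta ::
  "('n::finite heis \<Rightarrow> 'n heis \<Rightarrow> real) \<Rightarrow> real \<Rightarrow> real \<Rightarrow> 'n heis set \<Rightarrow> ennreal" where
  "centered_delta d \<alpha> \<delta> E = (if E = {} then 0 else Inf
     {(\<Sum>\<^sub>\<infinity>i\<in>J. ennreal (r i powr \<alpha>)) | (J::nat set) x r.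
        E \<subseteq> (\<Union>i\<in>J. hball d (x i) (r i))
        \<and> (\<forall>i\<in>J. x i \<in> E \<and> 0 < r i \<and> hdiam d (hball d (x i) (r i)) \<le> \<delta>)})"

definition centered_pre ::
  "('n::finite heis \<Rightarrow> 'n heis \<Rightarrow> real) \<Rightarrow> real \<Rightarrow> 'n heis set \<Rightarrow> ennreal" where
  "centered_pre d \<alpha> E = Lim (at_right 0) (\<lambda>\<delta>. centered_delta d \<alpha> \<delta> E)"

definition centered_measure ::
  "('n::finite heis \<Rightarrow> 'n heis \<Rightarrow> real) \<Rightarrow> real \<Rightarrow> 'n heis set \<Rightarrow> ennreal" where
  "centered_measure d \<alpha> A = (SUP E\<in>Pow A. centered_pre d \<alpha> E)"

definition upper_density ::
  "('n::finite heis \<Rightarrow> 'n heis \<Rightarrow> real) \<Rightarrow> real \<Rightarrow> ('n heis set \<Rightarrow> ennreal) \<Rightarrow> 'n heis \<Rightarrow> ennreal"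
  where
  "upper_density d \<alpha> \<mu> x = Limsup (at_right 0) (\<lambda>r. \<mu> (hball d x r) / ennreal (r powr \<alpha>))"

definition federer_density ::
  "('n::finite heis \<Rightarrow> 'n heis \<Rightarrow> real) \<Rightarrow> real \<Rightarrow> ('n heis set \<Rightarrow> ennreal) \<Rightarrow> 'n heis \<Rightarrow> ennreal"
  where
  "federer_density d \<alpha> \<mu> x = (INF \<epsilon>\<in>{0<..}. Sup
     {ennreal (2 powr \<alpha>) * \<mu> (hball d y r) / ennreal (hdiam d (hball d y r) powr \<alpha>) | y r.
        x \<in> hball d y r \<and> 0 < r \<and> r < \<epsilon>})"

definition orthonormal_basis :: "('i \<Rightarrow> 'a::real_inner) \<Rightarrow> 'a set \<Rightarrow> bool" where
  "orthonormal_basis b G \<longleftrightarrow> (\<forall>i j. b i \<bullet> b j = (if i = j then 1 else 0)) \<and> span (range b) = G"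

text \<open>
  The measure \<open>\<mu>\<close> of the theorem; \<open>v\<close> and \<open>w\<close> are the bases of \<open>V\<close> and \<open>W\<close>, and
  \<open>case_sum v w\<close> lists the factors of the multivector \<open>V \<and> N\<close>.
\<close>

definition surface_measure ::
  "('n::finite heis \<Rightarrow> 'n heis \<Rightarrow> real) \<Rightarrow> 'n heis set \<Rightarrow> 'n heis set \<Rightarrow> ('n heis \<Rightarrow> 'n heis)
     \<Rightarrow> ('n heis \<Rightarrow> real ^ 'k::finite) \<Rightarrow> ('k \<Rightarrow> 'n heis) \<Rightarrow> ('m::finite \<Rightarrow> 'n heis)
     \<Rightarrow> 'n heis set \<Rightarrow> ennreal" where
  "surface_measure d V U \<phi> f v w B = ennreal (wedge_norm (case_sum v w)) *
     (\<integral>\<^sup>+u\<in>{u\<in>U. graph_map \<phi> u \<in> B}. ennreal (JH d f (graph_map \<phi> u) / JV d V f (graph_map \<phi> u))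
        \<partial>hausdorff_measure (2 * CARD('n) + 1 - CARD('k)))"

end

theory Submission
  imports Defs
begin

text \<open>
  Let \<open>x\<close> be the point of the surface over \<open>u\<close>. Substituting \<open>\<sigma>\<^sub>x(\<delta>\<^sub>r w)\<close> in the integral defining
  \<open>\<mu>(B(y, r))\<close> produces the factor \<open>r\<^sup>\<alpha>\<close> and, by uniform intrinsic differentiability, replaces the
  surface by its tangent group \<open>T = {w \<odot> d\<phi>\<^sub>u(w)}\<close> up to an arbitrarily small relative error. Hence
  \<open>\<mu>(B(x, r)) / r\<^sup>\<alpha>\<close> tends to a multiple of the area of \<open>T \<inter> B(0, 1)\<close>, while for balls that only
  contain \<open>x\<close> the area of \<open>T \<inter> B(z, 1)\<close> enters. By a left translation and a shear the latter is a
  section of the convex symmetric set \<open>B(0, 1)\<close> by a translate of \<open>T\<close>, and the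
  Brunn--Minkowski inequality shows that the central section is the largest. So the two densities
  agree.

  The area of \<open>T \<inter> B(0, 1)\<close> depends continuously on \<open>u\<close>. Dividing by it gives a measure on the
  surface both of whose densities are 1; a Vitali covering argument bounds the centered measure
  by it, and it is in turn bounded by the spherical measure.
\<close>

section \<open>Brunn--Minkowski for half sums\<close>

text \<open>Convexity enters only through the inequality between a section and the central section.
  For this Brunn--Minkowski is wanted just for a set and its reflection, where the multiplicative
  half-sum form already cancels to the desired bound; that form has no dimension-dependent exponents
  and follows from the line by Prekopa--Leindler, one coordinate at a time. The left-translated
  section is comparable with a Euclidean one because, apart from a Euclidean translation, the group
  law changes only the vertical coordinate, by an amount depending on the horizontal ones; such a
  shear preserves Lebesgue measure. The obstacle in the second half is that the centered premeasure
  is not monotone, since centres must lie in the set, so it must be estimated on every subset,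
  measurable or not. The comparison therefore uses outer measures and open supersets of nearly the
  same measure; the latter exist because the upper density bound makes the weighted measure finite
  near each point of the surface.\<close>

lemma lborel_inner_compact:
  fixes X :: "'a::euclidean_space set"
  assumes X: "X \<in> sets borel" and c: "c < emeasure lborel X"
  obtains K where "compact K" "K \<subseteq> X" "c < emeasure lborel K"
proof -
  have "(SUP n. emeasure lborel (X \<inter> cball 0 (real n))) = emeasure lborel (\<Union>n. X \<inter> cball 0 (real n))"
    using X by (intro SUP_emeasure_incseq) (auto simp: incseq_def)
  also have "(\<Union>n. X \<inter> cball 0 (real n)) = X"
    using real_arch_simple by auto
  finally have "c < (SUP n. emeasure lborel (X \<inter> cball 0 (real n)))" using c by simp
  then obtain n where n: "c < emeasure lborel (X \<inter> cball 0 (real n))"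
    unfolding less_SUP_iff by blast
  \<comment> \<open>Inner regularity is applied to a finite measure, hence the restriction to a
    large ball.\<close>
  define M where "M = density lborel (indicator (cball (0::'a) (real n)))"
  have M: "emeasure M A = emeasure lborel (A \<inter> cball 0 (real n))" if "A \<in> sets borel" for A
    using that by (simp add: M_def emeasure_restricted Int_commute)
  have "emeasure M X = (SUP K \<in> {K. K \<subseteq> X \<and> compact K}. emeasure M K)"
  proof (rule inner_regular)
    show "emeasure M (space M) \<noteq> \<infinity>"
      using M[of UNIV] emeasure_lborel_cball_finite[of "0::'a" "real n"]
      by (simp add: M_def less_top)
  qed (use X in \<open>auto simp: M_def\<close>)
  with n X have "c < (SUP K \<in> {K. K \<subseteq> X \<and> compact K}. emeasure M K)"
    by (simp add: M)
  then obtain K where K: "K \<subseteq> X" "compact K" "c < emeasure M K"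
    by (auto simp: less_SUP_iff)
  have "emeasure M K \<le> emeasure lborel K"
    using K by (subst M) (auto intro!: emeasure_mono borel_compact)
  with K show ?thesis using that by force
qed

lemma emeasure_lborel_translate:
  fixes a :: "'a::euclidean_space"
  assumes "X \<in> sets borel"
  shows "emeasure lborel ((\<lambda>x. x + a) ` X) = emeasure lborel X"
proof -
  have "emeasure lborel X = emeasure (distr lborel borel (\<lambda>x. (- a) + x)) X"
    using lborel_distr_plus[of "-a"] by metis
  also have "\<dots> = emeasure lborel ((\<lambda>x. (- a) + x) -` X)"
    using assms by (subst emeasure_distr) auto
  also have "(\<lambda>x. (- a) + x) -` X = (\<lambda>x. x + a) ` X"
    by (auto simp: image_iff) (metis diff_add_cancel)
  finally show ?thesis ..
qed

lemma emeasure_lborel_uminus: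
  fixes X :: "'a::euclidean_space set"
  assumes "X \<in> sets borel"
  shows "emeasure lborel (uminus ` X) = emeasure lborel X"
proof -
  have "lborel = distr lborel borel (uminus :: 'a \<Rightarrow> 'a)"
    using lborel_affine[of "-1" "0::'a"] by (simp add: density_1)
  then have "emeasure lborel X = emeasure (distr lborel borel uminus) X" by metis
  also have "\<dots> = emeasure lborel (uminus -` X)"
    using assms by (subst emeasure_distr) auto
  also have "uminus -` X = uminus ` X"
    by (auto simp: image_iff) (metis minus_minus)
  finally show ?thesis ..
qed

text \<open>With a = max A and b = min B, the translates A + b and B + a meet only in the point a +
  b, and both lie in the sum set A + B, which is contained in 2 Z.\<close>

lemma emeasure_half_sum_compact:
  fixes A B Z :: "real set"
  assumes "compact A" "compact B" "A \<noteq> {}" "B \<noteq> {}" "Z \<in> sets borel"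
    and Z: "\<And>x y. x \<in> A \<Longrightarrow> y \<in> B \<Longrightarrow> (x + y) / 2 \<in> Z"
  shows "emeasure lborel A + emeasure lborel B \<le> 2 * emeasure lborel Z"
proof -
  obtain a where a: "a \<in> A" "\<And>x. x \<in> A \<Longrightarrow> x \<le> a"
    using compact_attains_sup[of A] assms by blast
  obtain b where b: "b \<in> B" "\<And>x. x \<in> B \<Longrightarrow> b \<le> x"
    using compact_attains_inf[of B] assms by blast
  let ?Z = "(\<lambda>x. 2 * x) ` Z"
  let ?A = "(\<lambda>x. x + b) ` A" and ?B = "(\<lambda>x. x + a) ` B"
  have AB: "?A \<in> sets borel" "?B \<in> sets borel"
    using assms by (auto intro!: borel_compact compact_continuous_image continuous_intros)
  have Z': "?Z = (\<lambda>x. x / 2) -` Z" by (force simp: image_iff)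
  have Zb: "?Z \<in> sets borel" unfolding Z' using assms by (intro measurable_sets_borel) auto
  have "emeasure lborel A + emeasure lborel B = emeasure lborel ?A + emeasure lborel ?B"
    using assms by (simp add: emeasure_lborel_translate borel_compact)
  also have "emeasure lborel ?A = emeasure lborel (?A - {a + b})"
    using AB by (intro emeasure_Diff_null_set[symmetric]) auto
  also have "emeasure lborel (?A - {a + b}) + emeasure lborel ?B = emeasure lborel ((?A - {a + b}) \<union> ?B)"
    using a b AB by (intro plus_emeasure) (fastforce simp: )+
  also have "\<dots> \<le> emeasure lborel ?Z"
  proof (rule emeasure_mono)
    show "?A - {a + b} \<union> ?B \<subseteq> ?Z"
      unfolding Z' using Z a b by (auto simp: add.commute[of _ a])
  qed (use Zb in auto)
  also have "emeasure lborel ?Z = (\<integral>\<^sup>+ x. indicator ?Z x \<partial>lborel)" using Zb by simp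
  also have "\<dots> = 2 * (\<integral>\<^sup>+ x. indicator ?Z (0 + 2 * x) \<partial>lborel)"
    using nn_integral_real_affine[of "indicator ?Z" 2 0] Zb by (simp del: nn_integral_indicator)
  also have "(\<lambda>x. indicator ?Z (0 + 2 * x)) = (indicator Z :: _ \<Rightarrow> ennreal)"
    by (auto simp: indicator_def fun_eq_iff)
  finally show ?thesis using assms by simp
qed

text \<open>Exhausts both sets by nonempty compact ones. A sum of Borel sets need not be Borel, so
  \<open>Z\<close> is any Borel set that contains the half sums; nonemptiness matters because an
  empty summand would leave \<open>Z\<close> unconstrained.\<close>

lemma emeasure_half_sum:
  fixes X Y Z :: "real set"
  assumes "X \<in> sets borel" "Y \<in> sets borel" "X \<noteq> {}" "Y \<noteq> {}" "Z \<in> sets borel"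
    and Z: "\<And>x y. x \<in> X \<Longrightarrow> y \<in> Y \<Longrightarrow> (x + y) / 2 \<in> Z"
  shows "emeasure lborel X + emeasure lborel Y \<le> 2 * emeasure lborel Z"
proof -
  have inner: "emeasure lborel X = (SUP K\<in>{K. K \<subseteq> X \<and> compact K \<and> K \<noteq> {}}. emeasure lborel K)"
    if X: "X \<in> sets borel" "X \<noteq> {}" for X :: "real set"
  proof (rule antisym)
    show "emeasure lborel X \<le> (SUP K\<in>{K. K \<subseteq> X \<and> compact K \<and> K \<noteq> {}}. emeasure lborel K)"
    proof (rule dense_le)
      fix c assume "c < emeasure lborel X"
      then obtain K where "compact K" "K \<subseteq> X" "c < emeasure lborel K"
        using lborel_inner_compact X by blast
      moreover from this have "K \<noteq> {}" by auto
      ultimately show "c \<le> (SUP K\<in>{K. K \<subseteq> X \<and> compact K \<and> K \<noteq> {}}. emeasure lborel K)"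
        by (intro SUP_upper2[of K]) auto
    qed
    show "(SUP K\<in>{K. K \<subseteq> X \<and> compact K \<and> K \<noteq> {}}. emeasure lborel K) \<le> emeasure lborel X"
      using X by (intro SUP_least emeasure_mono) auto
  qed
  have ne: "{K. K \<subseteq> X \<and> compact K \<and> K \<noteq> {}} \<noteq> {}" if X: "X \<noteq> {}" for X :: "real set"
    using X compact_sing by blast
  have *: "emeasure lborel K + emeasure lborel Y \<le> 2 * emeasure lborel Z"
    if K: "K \<subseteq> X" "compact K" "K \<noteq> {}" for K
    unfolding inner[OF assms(2,4)] ennreal_SUP_add_right[OF ne[OF assms(4)]]
    using K Z assms(5) by (intro SUP_least emeasure_half_sum_compact) auto
  show ?thesis
    unfolding inner[OF assms(1,3)] ennreal_SUP_add_left[OF ne[OF assms(3)], symmetric]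
    using * by (intro SUP_least) auto
qed

section \<open>Prekopa--Leindler inequality\<close>

lemma ennreal_mult_strict_mono:
  fixes a b c e :: ennreal
  assumes "a < c" "b < e"
  shows "a * b < c * e"
proof (cases "e = top")
  case True
  have "a < top" "b < top" "c > 0" using assms by (auto simp: less_top[symmetric] zero_less_iff_neq_zero)
  then show ?thesis using True by (simp add: ennreal_mult_less_top ennreal_mult_top)
next
  case False
  have "a * b \<le> a * e" using assms by (intro mult_left_mono) auto
  also have "\<dots> < c * e"
    using assms False by (intro ennreal_mult_strict_right_mono) (auto simp: less_top zero_less_iff_neq_zero)
  finally show ?thesis .
qed

lemma ennreal_am_gm: "4 * (x * y) \<le> (x + y)\<^sup>2" for x y :: ennreal
proof (cases "x = top \<or> y = top")
  case True
  then show ?thesis by (auto simp: power2_eq_square ennreal_top_mult ennreal_mult_top)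
next
  case False
  then obtain a b where "x = ennreal a" "y = ennreal b" "a \<ge> 0" "b \<ge> 0"
    by (metis ennreal_cases)
  moreover have "4 * (a * b) \<le> (a + b)\<^sup>2"
    using zero_le_power2[of "a - b"] by (simp add: power2_eq_square algebra_simps)
  ultimately show ?thesis
    by (simp add: ennreal_mult[symmetric] ennreal_power ennreal_plus[symmetric] 
        ennreal_numeral[symmetric] del: ennreal_plus ennreal_numeral)
qed

text \<open>For 0 < t < 1 the sets where f and g exceed t are nonempty, and their half sums lie
  where h exceeds t, because f x * g y > t * t. Integrating the inequality for half sums over t
  gives the claim (layer cake).\<close>

lemma prekopa_leindler_normalized:
  fixes f g h :: "real \<Rightarrow> ennreal"
  assumes [measurable]: "f \<in> borel_measurable borel" "g \<in> borel_measurable borel"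
    "h \<in> borel_measurable borel"
    and sup: "(SUP x. f x) = 1" "(SUP x. g x) = 1"
    and le: "\<And>x y. f x * g y \<le> (h ((x + y) / 2))\<^sup>2"
  shows "(\<integral>\<^sup>+ x. f x \<partial>lborel) + (\<integral>\<^sup>+ x. g x \<partial>lborel) \<le> 2 * (\<integral>\<^sup>+ x. h x \<partial>lborel)"
proof -
  have psf: "pair_sigma_finite (lborel :: real measure) (lborel :: real measure)"
    by (simp add: pair_sigma_finite_def lborel.sigma_finite_measure_axioms)
  let ?L = "\<lambda>u. \<integral>\<^sup>+ t. emeasure lborel {x. ennreal t < u x} * indicator {0<..<1::real} t \<partial>lborel"
  have layer: "?L u = (\<integral>\<^sup>+ x. emeasure lborel {t. 0 < t \<and> t < 1 \<and> ennreal t < u x} \<partial>lborel)"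
    if [measurable]: "u \<in> borel_measurable borel" for u :: "real \<Rightarrow> ennreal"
  proof -
    have "?L u = (\<integral>\<^sup>+ t. \<integral>\<^sup>+ x. indicator {x. ennreal t < u x} x * indicator {0<..<1} t \<partial>lborel \<partial>lborel)"
      by (intro nn_integral_cong) (simp add: nn_integral_multc)
    also have "\<dots> = (\<integral>\<^sup>+ x. \<integral>\<^sup>+ t. indicator {x. ennreal t < u x} x * indicator {0<..<1} t \<partial>lborel \<partial>lborel)"
      by (rule pair_sigma_finite.Fubini'[OF psf]) (simp add: indicator_def case_prod_beta')
    also have "\<dots> = (\<integral>\<^sup>+ x. emeasure lborel {t. 0 < t \<and> t < 1 \<and> ennreal t < u x} \<partial>lborel)"
      by (intro nn_integral_cong)
        (auto simp: nn_integral_indicator[symmetric] indicator_def simp del: nn_integral_indicator 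
          intro!: nn_integral_cong)
    finally show ?thesis .
  qed
  \<comment> \<open>Levels t in (0, 1) recover the whole integral of f and g, which are bounded by
    1, and at most the integral of h.\<close>
  have m: "emeasure lborel {t. 0 < t \<and> t < 1 \<and> ennreal t < v} = min v 1" for v
  proof (cases "v \<ge> 1")
    case True
    then have "{t. 0 < t \<and> t < 1 \<and> ennreal t < v} = {0<..<1}"
      using order_less_le_trans[of "ennreal _" 1 v] by auto
    then show ?thesis using True by (simp add: min_def)
  next
    case False
    then obtain r where r: "v = ennreal r" "r \<ge> 0" by (cases v) auto
    with False have "{t. 0 < t \<and> t < 1 \<and> ennreal t < v} = {0<..<r}"
      by (auto simp: ennreal_less_iff)
    then show ?thesis using False r by (simp add: min_def)
  qed
  have le1: "f x \<le> 1" "g x \<le> 1" for x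
    using SUP_upper[of x UNIV f] SUP_upper[of x UNIV g] sup by auto
  have "(\<integral>\<^sup>+ x. f x \<partial>lborel) + (\<integral>\<^sup>+ x. g x \<partial>lborel) = ?L f + ?L g"
    using le1 by (simp add: layer m min_absorb1)
  also have "\<dots> = (\<integral>\<^sup>+ t. (emeasure lborel {x. ennreal t < f x} + emeasure lborel {x. ennreal t < g x})
      * indicator {0<..<1::real} t \<partial>lborel)"
    by (subst nn_integral_add[symmetric]) (auto simp: distrib_right)
  also have "\<dots> \<le> (\<integral>\<^sup>+ t. 2 * (emeasure lborel {x. ennreal t < h x} * indicator {0<..<1::real} t) \<partial>lborel)"
  proof (rule nn_integral_mono)
    fix t :: real
    show "(emeasure lborel {x. ennreal t < f x} + emeasure lborel {x. ennreal t < g x})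
        * indicator {0<..<1::real} t \<le> 2 * (emeasure lborel {x. ennreal t < h x} * indicator {0<..<1::real} t)"
    proof (cases "t \<in> {0<..<1}")
      case True
      then have "ennreal t < 1" by simp
      then have "{x. ennreal t < f x} \<noteq> {}" "{x. ennreal t < g x} \<noteq> {}"
        using sup less_SUP_iff[of "ennreal t" f UNIV] less_SUP_iff[of "ennreal t" g UNIV] by auto
      moreover have "ennreal t < h ((x + y) / 2)" if "ennreal t < f x" "ennreal t < g y" for x y
      proof (rule ccontr)
        assume "\<not> ennreal t < h ((x + y) / 2)"
        then have "(h ((x + y) / 2))\<^sup>2 \<le> (ennreal t)\<^sup>2" by (intro power_mono) auto
        also have "\<dots> < f x * g y"
          unfolding power2_eq_square using that by (intro ennreal_mult_strict_mono)
        finally show False using le[of x y] by simp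
      qed
      ultimately have "emeasure lborel {x. ennreal t < f x} + emeasure lborel {x. ennreal t < g x}
         \<le> 2 * emeasure lborel {x. ennreal t < h x}"
        by (intro emeasure_half_sum) auto
      then show ?thesis using True by simp
    qed simp
  qed
  also have "\<dots> = 2 * ?L h" by (rule nn_integral_cmult) simp
  also have "\<dots> \<le> 2 * (\<integral>\<^sup>+ x. h x \<partial>lborel)"
    by (intro mult_left_mono) (auto simp: layer m intro!: nn_integral_mono)
  finally show ?thesis .
qed

text \<open>Dividing f and g by their suprema a, b and h by the geometric mean of a and b keeps the
  hypothesis, so the normalized case applies, and the inequality of arithmetic and geometric means
  turns its sum into a product. Functions with infinite supremum are truncated at height n
  first.\<close>

lemma prekopa_leindler_real:
  fixes f g h :: "real \<Rightarrow> ennreal"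
  assumes [measurable]: "f \<in> borel_measurable borel" "g \<in> borel_measurable borel"
    "h \<in> borel_measurable borel"
    and le: "\<And>x y. f x * g y \<le> (h ((x + y) / 2))\<^sup>2"
  shows "(\<integral>\<^sup>+ x. f x \<partial>lborel) * (\<integral>\<^sup>+ x. g x \<partial>lborel) \<le> (\<integral>\<^sup>+ x. h x \<partial>lborel)\<^sup>2"
proof -
  have bounded: "(\<integral>\<^sup>+ x. f x \<partial>lborel) * (\<integral>\<^sup>+ x. g x \<partial>lborel) \<le> (\<integral>\<^sup>+ x. h x \<partial>lborel)\<^sup>2"
    if [measurable]: "f \<in> borel_measurable borel" "g \<in> borel_measurable borel"
      and fin: "(SUP x. f x) \<noteq> top" "(SUP x. g x) \<noteq> top"
      and le: "\<And>x y. f x * g y \<le> (h ((x + y) / 2))\<^sup>2" for f g :: "real \<Rightarrow> ennreal"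
  proof (cases "(SUP x. f x) = 0 \<or> (SUP x. g x) = 0")
    case True
    then have "(\<forall>x. f x = 0) \<or> (\<forall>x. g x = 0)"
      by (auto simp: SUP_eq_iff bot_ennreal[symmetric] SUP_bot_conv)
    then show ?thesis by auto
  next
    case False
    then obtain a b where ab: "(SUP x. f x) = ennreal a" "(SUP x. g x) = ennreal b" "a > 0" "b > 0"
      using fin by (metis ennreal_cases ennreal_0 less_eq_real_def)
    define c where "c = sqrt (a * b)"
    have c: "c > 0" "c\<^sup>2 = a * b" using ab by (auto simp: c_def)
    have "(\<integral>\<^sup>+ x. ennreal (1 / a) * f x \<partial>lborel) + (\<integral>\<^sup>+ x. ennreal (1 / b) * g x \<partial>lborel)
      \<le> 2 * (\<integral>\<^sup>+ x. ennreal (1 / c) * h x \<partial>lborel)"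
    proof (rule prekopa_leindler_normalized)
      show "(SUP x. ennreal (1 / a) * f x) = 1" "(SUP x. ennreal (1 / b) * g x) = 1"
        using ab by (simp_all add: SUP_mult_left_ennreal[symmetric] ennreal_mult[symmetric])
      fix x y
      have "ennreal (1 / a) * f x * (ennreal (1 / b) * g y) = ennreal (1 / c)^2 * (f x * g y)"
        using ab c by (simp add: ennreal_power ennreal_mult'[symmetric] power_divide mult_ac flip: ennreal_mult)
      also have "\<dots> \<le> ennreal (1 / c)^2 * (h ((x + y) / 2))\<^sup>2"
        by (intro mult_left_mono le) auto
      finally show "ennreal (1 / a) * f x * (ennreal (1 / b) * g y) \<le> (ennreal (1 / c) * h ((x + y) / 2))\<^sup>2"
        by (simp add: power_mult_distrib)
    qed auto
    then have le: "ennreal (1 / a) * (\<integral>\<^sup>+ x. f x \<partial>lborel) + ennreal (1 / b) * (\<integral>\<^sup>+ x. g x \<partial>lborel)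
      \<le> 2 * (ennreal (1 / c) * (\<integral>\<^sup>+ x. h x \<partial>lborel))" (is "?A + ?B \<le> 2 * ?H")
      by (simp add: nn_integral_cmult)
    have "4 * (?A * ?B) \<le> (2 * ?H)\<^sup>2"
      using ennreal_am_gm[of ?A ?B] power_mono[OF le, of 2] by simp
    then have "?A * ?B \<le> ?H\<^sup>2"
      by (simp add: power_mult_distrib ennreal_mult_le_mult_iff)
    then have "(ennreal c)\<^sup>2 * (?A * ?B) \<le> (ennreal c)\<^sup>2 * ?H\<^sup>2"
      by (intro mult_left_mono) auto
    also have "(ennreal c)\<^sup>2 * ?H\<^sup>2 = (\<integral>\<^sup>+ x. h x \<partial>lborel)\<^sup>2"
      using c by (simp add: power_mult_distrib[symmetric] mult.assoc[symmetric] ennreal_mult[symmetric])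
    also have "(ennreal c)\<^sup>2 * (?A * ?B) = (\<integral>\<^sup>+ x. f x \<partial>lborel) * (\<integral>\<^sup>+ x. g x \<partial>lborel)"
    proof -
      have "ennreal (a * b) * ennreal (1 / a) * ennreal (1 / b) = 1"
        using ab by (simp add: ennreal_mult[symmetric])
      moreover have "(ennreal c)\<^sup>2 = ennreal (a * b)" using c by (simp add: ennreal_power)
      ultimately show ?thesis by (metis (no_types, lifting) mult.assoc mult.left_commute mult_1)
    qed
    finally show ?thesis .
  qed
  let ?f = "\<lambda>n::nat. \<lambda>x. min (f x) (of_nat n)" and ?g = "\<lambda>n::nat. \<lambda>x. min (g x) (of_nat n)"
  have trunc: "(\<integral>\<^sup>+ x. ?f n x \<partial>lborel) * (\<integral>\<^sup>+ x. ?g m x \<partial>lborel) \<le> (\<integral>\<^sup>+ x. h x \<partial>lborel)\<^sup>2" for n m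
  proof (rule bounded)
    show "(SUP x. ?f n x) \<noteq> top" "(SUP x. ?g m x) \<noteq> top"
      by (rule neq_top_trans[of "of_nat n"] neq_top_trans[of "of_nat m"]; auto intro: SUP_least)+
    show "?f n x * ?g m y \<le> (h ((x + y) / 2))\<^sup>2" for x y
      by (rule order_trans[OF mult_mono le]) auto
  qed auto
  have sup: "(\<integral>\<^sup>+ x. u x \<partial>lborel) = (SUP n. \<integral>\<^sup>+ x. min (u x) (of_nat n) \<partial>lborel)"
    if [measurable]: "u \<in> borel_measurable borel" for u :: "real \<Rightarrow> ennreal"
  proof -
    have "(SUP n. min (u x) (of_nat n)) = u x" for x
    proof (rule antisym)
      show "u x \<le> (SUP n. min (u x) (of_nat n))"
      proof (rule dense_le)
        fix y assume y: "y < u x"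
        then obtain r where "y = ennreal r" "r \<ge> 0" by (cases y) auto
        moreover obtain n :: nat where "r \<le> real n" using real_arch_simple by blast
        ultimately have "y \<le> of_nat n" by (simp add: ennreal_of_nat_eq_real_of_nat)
        then show "y \<le> (SUP n. min (u x) (of_nat n))"
          using y by (intro SUP_upper2[of n]) auto
      qed
    qed (auto intro: SUP_least)
    then have "(\<integral>\<^sup>+ x. u x \<partial>lborel) = (\<integral>\<^sup>+ x. (SUP n. min (u x) (of_nat n)) \<partial>lborel)" by simp
    also have "\<dots> = (SUP n. \<integral>\<^sup>+ x. min (u x) (of_nat n) \<partial>lborel)"
      by (intro nn_integral_monotone_convergence_SUP)
        (auto simp: incseq_def le_fun_def min_le_iff_disj of_nat_mono)
    finally show ?thesis .
  qed
  show ?thesis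
    unfolding sup[OF assms(1)] sup[OF assms(2)] SUP_mult_left_ennreal SUP_mult_right_ennreal
    by (intro SUP_least trunc)
qed

text \<open>Tensorization: integrating out coordinate i and applying the inequality on the line to
  the fibres over x and y reproduces the hypothesis in the remaining coordinates. Only extensional
  functions are quantified, as these are the points of the product space.\<close>

lemma prekopa_leindler_PiM:
  fixes f g h :: "('i \<Rightarrow> real) \<Rightarrow> ennreal" and I :: "'i set"
  assumes "finite I"
    and "f \<in> borel_measurable (\<Pi>\<^sub>M i\<in>I. lborel)" "g \<in> borel_measurable (\<Pi>\<^sub>M i\<in>I. lborel)"
      "h \<in> borel_measurable (\<Pi>\<^sub>M i\<in>I. lborel)"
    and "\<And>x y. x \<in> extensional I \<Longrightarrow> y \<in> extensional I \<Longrightarrow> f x * g y \<le> (h (\<lambda>i\<in>I. (x i + y i) / 2))\<^sup>2"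
  shows "(\<integral>\<^sup>+ x. f x \<partial>(\<Pi>\<^sub>M i\<in>I. lborel)) * (\<integral>\<^sup>+ x. g x \<partial>(\<Pi>\<^sub>M i\<in>I. lborel))
    \<le> (\<integral>\<^sup>+ x. h x \<partial>(\<Pi>\<^sub>M i\<in>I. lborel))\<^sup>2"
  using assms
proof (induction I arbitrary: f g h rule: finite_induct)
  case empty
  interpret product_sigma_finite "\<lambda>_::'i. lborel :: real measure" ..
  show ?case
    using empty(4)[of "\<lambda>_. undefined" "\<lambda>_. undefined"]
    by (simp add: nn_integral_empty restrict_def)
next
  case (insert i I)
  interpret product_sigma_finite "\<lambda>_::'i. lborel :: real measure" ..
  note [measurable] = insert.prems(1-3)
  have meas[measurable]: "(\<lambda>x. \<integral>\<^sup>+ s. u (x(i := s)) \<partial>lborel) \<in> borel_measurable (\<Pi>\<^sub>M i\<in>I. lborel)"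
    if [measurable]: "u \<in> borel_measurable (\<Pi>\<^sub>M i\<in>insert i I. lborel)" for u :: "('i \<Rightarrow> real) \<Rightarrow> ennreal"
    by measurable
  have up: "(\<lambda>s. u (x(i := s))) \<in> borel_measurable borel"
    if [measurable]: "u \<in> borel_measurable (\<Pi>\<^sub>M i\<in>insert i I. lborel)" and x: "x \<in> extensional I"
    for u :: "('i \<Rightarrow> real) \<Rightarrow> ennreal" and x
  proof -
    have "x \<in> space (\<Pi>\<^sub>M i\<in>I. lborel)" using x by (auto simp: space_PiM PiE_def)
    then show ?thesis
      using measurable_comp[OF measurable_component_update that(1)] insert.hyps(2)
      by (simp add: comp_def)
  qed
  have "(\<integral>\<^sup>+ x. \<integral>\<^sup>+ s. f (x(i := s)) \<partial>lborel \<partial>(\<Pi>\<^sub>M i\<in>I. lborel)) *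
        (\<integral>\<^sup>+ x. \<integral>\<^sup>+ s. g (x(i := s)) \<partial>lborel \<partial>(\<Pi>\<^sub>M i\<in>I. lborel))
     \<le> (\<integral>\<^sup>+ x. \<integral>\<^sup>+ s. h (x(i := s)) \<partial>lborel \<partial>(\<Pi>\<^sub>M i\<in>I. lborel))\<^sup>2"
  proof (rule insert.IH)
    fix x y :: "'i \<Rightarrow> real" assume xy: "x \<in> extensional I" "y \<in> extensional I"
    define z where "z = (\<lambda>i\<in>I. (x i + y i) / 2)"
    have z: "z \<in> extensional I" by (simp add: z_def)
    show "(\<integral>\<^sup>+ s. f (x(i := s)) \<partial>lborel) * (\<integral>\<^sup>+ s. g (y(i := s)) \<partial>lborel)
       \<le> (\<integral>\<^sup>+ s. h (z(i := s)) \<partial>lborel)\<^sup>2"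
    proof (rule prekopa_leindler_real)
      fix s t
      have "x(i := s) \<in> extensional (insert i I)" "y(i := t) \<in> extensional (insert i I)"
        using xy by (auto simp: extensional_def)
      note insert.prems(4)[OF this]
      also have "(\<lambda>j\<in>insert i I. ((x(i := s)) j + (y(i := t)) j) / 2) = z(i := (s + t) / 2)"
        using insert.hyps by (auto simp: z_def fun_eq_iff)
      finally show "f (x(i := s)) * g (y(i := t)) \<le> (h (z(i := (s + t) / 2)))\<^sup>2" .
    qed (use up xy z insert.prems in auto)
  qed (rule meas, rule insert.prems)+
  then show ?case
    using insert by (simp add: product_nn_integral_insert)
qed

text \<open>Prekopa--Leindler for three indicator functions, in orthonormal coordinates.\<close>

theorem brunn_minkowski_midpoint:
  fixes X Y Z :: "'a::euclidean_space set"
  assumes [measurable]: "X \<in> sets borel" "Y \<in> sets borel" "Z \<in> sets borel"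
    and Z: "\<And>x y. x \<in> X \<Longrightarrow> y \<in> Y \<Longrightarrow> (1/2) *\<^sub>R (x + y) \<in> Z"
  shows "emeasure lborel X * emeasure lborel Y \<le> (emeasure lborel Z)\<^sup>2"
proof -
  let ?P = "\<Pi>\<^sub>M b\<in>Basis. lborel :: real measure" and ?T = "\<lambda>f. \<Sum>b\<in>Basis. f b *\<^sub>R b :: 'a"
  have T[measurable]: "?T \<in> ?P \<rightarrow>\<^sub>M borel" by measurable
  have e: "emeasure lborel A = (\<integral>\<^sup>+ f. indicator A (?T f) \<partial>?P)" if [measurable]: "A \<in> sets borel" for A
  proof -
    have "emeasure lborel A = (\<integral>\<^sup>+ x. indicator A x \<partial>distr ?P borel ?T)"
      using that lborel_eq[where 'a='a] by simp
    also have "\<dots> = (\<integral>\<^sup>+ f. indicator A (?T f) \<partial>?P)"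
      by (intro nn_integral_distr) auto
    finally show ?thesis .
  qed
  show ?thesis
    unfolding e[OF assms(1)] e[OF assms(2)] e[OF assms(3)]
  proof (rule prekopa_leindler_PiM)
    fix x y :: "'a \<Rightarrow> real"
    have "?T (\<lambda>i\<in>Basis. (x i + y i) / 2) = (1/2) *\<^sub>R (?T x + ?T y)"
      by (simp add: scaleR_sum_right sum.distrib[symmetric] scaleR_add_left[symmetric] scaleR_add_right[symmetric] cong: sum.cong)
    then show "indicator X (?T x) * indicator Y (?T y)
       \<le> (indicator Z (?T (\<lambda>i\<in>Basis. (x i + y i) / 2)) :: ennreal)\<^sup>2"
      using Z[of "?T x" "?T y"] by (auto simp: indicator_def)
  qed auto
qed

text \<open>Brunn--Minkowski for X and -X, which have equal measure, so that both sides become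
  squares. Later X is a section of a symmetric convex body and Z the central parallel
  section.\<close>

lemma emeasure_symmetrized_ge:
  fixes X Z :: "'a::euclidean_space set"
  assumes "X \<in> sets borel" "Z \<in> sets borel"
    and Z: "\<And>x y. x \<in> X \<Longrightarrow> y \<in> X \<Longrightarrow> (1/2) *\<^sub>R (x - y) \<in> Z"
  shows "emeasure lborel X \<le> emeasure lborel Z"
proof -
  have u: "uminus ` X = uminus -` X" by (auto simp: image_iff) (metis minus_minus)
  have "uminus ` X \<in> sets borel"
    unfolding u using assms by (intro measurable_sets_borel) auto
  then have "emeasure lborel X * emeasure lborel (uminus ` X) \<le> (emeasure lborel Z)\<^sup>2"
    using assms Z by (intro brunn_minkowski_midpoint) auto
  then have "(emeasure lborel X)\<^sup>2 \<le> (emeasure lborel Z)\<^sup>2"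
    using assms by (simp add: emeasure_lborel_uminus power2_eq_square)
  then show ?thesis
    by (metis linorder_not_less ennreal_mult_strict_mono power2_eq_square)
qed

section \<open>Hausdorff measure on a subspace\<close>

definition hausdorff_covers :: "nat \<Rightarrow> real \<Rightarrow> 'a::euclidean_space set \<Rightarrow> ennreal set" where
  "hausdorff_covers p \<delta> A =
     {(\<Sum>\<^sub>\<infinity>j\<in>J. ennreal (unit_ball_vol (real p) * (diameter (E j) / 2) ^ p)) | (J::nat set) E.
        A \<subseteq> (\<Union>j\<in>J. E j) \<and> (\<forall>j\<in>J. E j \<noteq> {} \<and> bounded (E j) \<and> diameter (E j) \<le> \<delta>)}"

lemma hausdorff_outer_eq: "hausdorff_outer p A = (SUP \<delta>\<in>{0<..}. Inf (hausdorff_covers p \<delta> A))"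
  by (simp add: hausdorff_outer_def hausdorff_covers_def)

lemma hausdorff_outer_translate_le:
  fixes A :: "'a::euclidean_space set"
  shows "hausdorff_outer p ((+) a ` A) \<le> hausdorff_outer p A"
  unfolding hausdorff_outer_eq
proof (intro SUP_mono bexI Inf_superset_mono subsetI)
  have dm: "diameter ((+) a ` E) = diameter E" for E :: "'a set"
  proof -
    have "(+) a ` E \<times> (+) a ` E = (\<lambda>(x, y). (a + x, a + y)) ` (E \<times> E)" by auto
    then have "(\<lambda>(x, y). dist x y) ` ((+) a ` E \<times> (+) a ` E) = (\<lambda>(x, y). dist x y) ` (E \<times> E)"
      by (simp add: image_image case_prod_beta)
    then show ?thesis by (simp add: diameter_def)
  qed
  fix \<delta> s assume "s \<in> hausdorff_covers p \<delta> A"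
  then obtain J :: "nat set" and E :: "nat \<Rightarrow> 'a set" where
    s: "s = (\<Sum>\<^sub>\<infinity>j\<in>J. ennreal (unit_ball_vol (real p) * (diameter (E j) / 2) ^ p))"
      and A: "A \<subseteq> (\<Union>j\<in>J. E j)" and E: "\<forall>j\<in>J. E j \<noteq> {} \<and> bounded (E j) \<and> diameter (E j) \<le> \<delta>"
    unfolding hausdorff_covers_def by blast
  show "s \<in> hausdorff_covers p \<delta> ((+) a ` A)"
    unfolding hausdorff_covers_def
    using A E by (intro CollectI exI[of _ J] exI[of _ "\<lambda>j. (+) a ` E j"])
      (fastforce simp: s dm bounded_translation)
qed auto

lemma hausdorff_outer_translate:
  fixes A :: "'a::euclidean_space set"
  shows "hausdorff_outer p ((+) a ` A) = hausdorff_outer p A"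
proof (rule antisym[OF hausdorff_outer_translate_le])
  have "hausdorff_outer p ((+) (- a) ` (+) a ` A) \<le> hausdorff_outer p ((+) a ` A)"
    by (rule hausdorff_outer_translate_le)
  then show "hausdorff_outer p A \<le> hausdorff_outer p ((+) a ` A)"
    by (simp add: image_image)
qed

text \<open>Only finiteness is wanted, so a grid suffices: n^p closed cubes of side 1/n, whose
  diameter the l1 norm bounds by p/n. The powers of n cancel in the covering sum, which leaves the
  constant \<open>K\<close> for every n.\<close>

lemma hausdorff_outer_isometric_cube:
  fixes \<iota> :: "'e::euclidean_space \<Rightarrow> 'a::euclidean_space"
  assumes lin: "linear \<iota>" and iso: "\<And>y. norm (\<iota> y) = norm y"
  shows "hausdorff_outer DIM('e) (\<iota> ` box 0 One) < top"
proof -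
  let ?p = "DIM('e)"
  have p: "?p > 0" by simp
  define K where "K = unit_ball_vol (real ?p) * (real ?p / 2) ^ ?p"
  have "hausdorff_outer ?p (\<iota> ` box 0 One) \<le> ennreal K"
    unfolding hausdorff_outer_eq
  proof (rule SUP_least)
    fix \<delta> :: real assume "\<delta> \<in> {0<..}"
    then have \<delta>: "\<delta> > 0" by simp
    obtain n :: nat where n: "real ?p / \<delta> < real n" using reals_Archimedean2 by blast
    then have n0: "n > 0" using p \<delta> by (auto intro!: Nat.gr0I simp: field_simps)
    define I :: "('e \<Rightarrow> nat) set" where "I = Basis \<rightarrow>\<^sub>E {..<n}"
    have I: "finite I" "card I = n ^ ?p" 
      by (auto simp: I_def card_PiE intro!: finite_PiE)
    obtain k where k: "bij_betw k {0..<card I} I"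
      using ex_bij_betw_nat_finite[OF I(1)] by blast
    define Q :: "('e \<Rightarrow> nat) \<Rightarrow> 'e set" where
      "Q f = cbox (\<Sum>b\<in>Basis. (real (f b) / real n) *\<^sub>R b) (\<Sum>b\<in>Basis. ((real (f b) + 1) / real n) *\<^sub>R b)" for f
    have memQ: "y \<in> Q f \<longleftrightarrow> (\<forall>b\<in>Basis. real (f b) / real n \<le> y \<bullet> b \<and> y \<bullet> b \<le> (real (f b) + 1) / real n)" for f y
      by (simp add: Q_def mem_box inner_sum_left_Basis)
    have Qne: "Q f \<noteq> {}" for f
      by (auto simp: Q_def box_ne_empty inner_sum_left_Basis divide_right_mono)
    have dQ: "dist (\<iota> x) (\<iota> y) \<le> real ?p / real n" if "x \<in> Q f" "y \<in> Q f" for x y f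
    proof -
      have "dist (\<iota> x) (\<iota> y) = norm (x - y)"
        using iso[of "x - y"] lin by (simp add: dist_norm linear_diff)
      also have "\<dots> \<le> (\<Sum>b\<in>Basis. \<bar>(x - y) \<bullet> b\<bar>)" by (rule norm_le_l1)
      also have "\<dots> \<le> (\<Sum>b\<in>(Basis::'e set). 1 / real n)"
        using that by (intro sum_mono) (force simp: memQ inner_diff_left abs_le_iff add_divide_distrib)
      finally show ?thesis by simp
    qed
    have diam: "diameter (\<iota> ` Q f) \<le> real ?p / real n" "0 \<le> diameter (\<iota> ` Q f)" and bd: "bounded (\<iota> ` Q f)" for f
    proof -
      show "diameter (\<iota> ` Q f) \<le> real ?p / real n"
        using dQ Qne by (intro diameter_le) (auto simp: dist_norm)
      show bd: "bounded (\<iota> ` Q f)"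
        unfolding Q_def using lin by (intro bounded_linear_image) (auto simp: linear_conv_bounded_linear)
      then show "0 \<le> diameter (\<iota> ` Q f)" by (rule diameter_ge_0)
    qed
    have cov: "\<exists>f\<in>I. y \<in> Q f" if y: "y \<in> box 0 One" for y
    proof
      let ?f = "\<lambda>b\<in>Basis. nat \<lfloor>real n * (y \<bullet> b)\<rfloor>"
      have b: "0 < y \<bullet> b" "y \<bullet> b < 1" if "b \<in> Basis" for b
        using y that by (auto simp: mem_box)
      show "y \<in> Q ?f"
        unfolding memQ
      proof (intro ballI conjI)
        fix b :: 'e assume bB: "b \<in> Basis"
        have "real_of_int \<lfloor>real n * (y \<bullet> b)\<rfloor> \<le> real n * (y \<bullet> b)"
          "real n * (y \<bullet> b) < real_of_int \<lfloor>real n * (y \<bullet> b)\<rfloor> + 1" by linarith+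
        moreover have "real (?f b) = real_of_int \<lfloor>real n * (y \<bullet> b)\<rfloor>"
          using bB b[OF bB] by simp
        ultimately show "real (?f b) / real n \<le> y \<bullet> b" "y \<bullet> b \<le> (real (?f b) + 1) / real n"
          using n0 by (simp_all add: field_simps)
      qed
      show "?f \<in> I"
        unfolding I_def
      proof (rule restrict_PiE_iff[THEN iffD2], intro ballI)
        fix b :: 'e assume bB: "b \<in> Basis"
        have "real n * (y \<bullet> b) < real n * 1" using b[OF bB] n0 by (intro mult_strict_left_mono) auto
        then have "\<lfloor>real n * (y \<bullet> b)\<rfloor> < int n" by (simp add: floor_less_iff)
        then show "nat \<lfloor>real n * (y \<bullet> b)\<rfloor> \<in> {..<n}" using n0 by auto
      qed
    qed
    let ?J = "{0..<card I}" and ?E = "\<lambda>j. \<iota> ` Q (k j)"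
    have "Inf (hausdorff_covers ?p \<delta> (\<iota> ` box 0 One))
      \<le> (\<Sum>\<^sub>\<infinity>j\<in>?J. ennreal (unit_ball_vol (real ?p) * (diameter (?E j) / 2) ^ ?p))"
      unfolding hausdorff_covers_def
    proof (rule Inf_lower, intro CollectI exI[of _ ?J] exI[of _ ?E] conjI refl ballI)
      show "\<iota> ` box 0 One \<subseteq> (\<Union>j\<in>?J. ?E j)"
      proof
        fix z assume "z \<in> \<iota> ` box 0 One"
        then obtain y f where "z = \<iota> y" "f \<in> I" "y \<in> Q f" using cov by blast
        moreover from \<open>f \<in> I\<close> have "f \<in> k ` ?J" using k by (simp add: bij_betw_imp_surj_on)
        then obtain j where "j \<in> ?J" "k j = f" by (elim imageE) simp
        ultimately show "z \<in> (\<Union>j\<in>?J. ?E j)" by blast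
      qed
      have "real ?p / real n \<le> \<delta>" using n n0 \<delta> by (simp add: field_simps)
      then show "diameter (?E j) \<le> \<delta>" for j using diam(1) order_trans by blast
    qed (use Qne bd in auto)
    also have "\<dots> = (\<Sum>j\<in>?J. ennreal (unit_ball_vol (real ?p) * (diameter (?E j) / 2) ^ ?p))"
      by (rule infsum_finite) simp
    also have "\<dots> \<le> (\<Sum>j\<in>?J. ennreal (unit_ball_vol (real ?p) * (real ?p / real n / 2) ^ ?p))"
      using diam by (intro sum_mono ennreal_leI mult_left_mono power_mono divide_right_mono) auto
    also have "\<dots> = ennreal K"
      using n0 by (simp add: I K_def ennreal_of_nat_eq_real_of_nat ennreal_mult[symmetric] power_divide power_mult_distrib)
    finally show "Inf (hausdorff_covers ?p \<delta> (\<iota> ` box 0 One)) \<le> ennreal K" .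
  qed
  also have "\<dots> < top" by simp
  finally show ?thesis .
qed

text \<open>Uniqueness of Haar measure: with C the unit cube, the function 1_A(x) 1_C(x + y) is
  integrated against M and Lebesgue measure in both orders, and the invariance of each measure
  separates the variables.\<close>

lemma translation_invariant_eq_lborel:
  fixes M :: "'e::euclidean_space measure"
  assumes sets[measurable_cong]: "sets M = sets borel"
    and inv: "\<And>A a. A \<in> sets borel \<Longrightarrow> emeasure M ((\<lambda>x. x + a) -` A) = emeasure M A"
    and fin: "emeasure M (box 0 One) < top"
    and A: "A \<in> sets borel"
  shows "emeasure M A = emeasure M (box 0 One) * emeasure lborel A"
proof -
  have space: "space M = UNIV" using sets sets_eq_imp_space_eq[OF sets] by simp
  \<comment> \<open>Needed for Fubini. Translates of the unit cube by a countable dense set cover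
    the space, and each has the same finite measure.\<close>
  have "sigma_finite_measure M"
  proof
    obtain D :: "'e set" where D: "countable D" "\<And>X. open X \<Longrightarrow> X \<noteq> {} \<Longrightarrow> \<exists>q\<in>D. q \<in> X"
      by (rule countable_dense_setE) blast
    have one: "(1/2) *\<^sub>R One \<in> box 0 (One :: 'e)" by (simp add: mem_box)
    let ?B = "\<lambda>q. (\<lambda>x. x + q) -` box 0 (One :: 'e)"
    have "\<Union> (?B ` D) = UNIV"
    proof (intro equalityI subset_UNIV subsetI)
      fix x :: 'e
      have "open ((\<lambda>q. x + q) -` box 0 One)"
        by (intro open_vimage continuous_intros) auto
      moreover have "(1/2) *\<^sub>R One - x \<in> (\<lambda>q. x + q) -` box 0 One" using one by simp
      ultimately obtain q where "q \<in> D" "x + q \<in> box 0 One" using D(2) by (metis empty_iff vimageE)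
      then show "x \<in> \<Union> (?B ` D)" by auto
    qed
    moreover have "?B q \<in> sets M" for q
      unfolding sets by (intro borel_open open_vimage continuous_intros) auto
    ultimately show "\<exists>A. countable A \<and> A \<subseteq> sets M \<and> \<Union> A = space M \<and> (\<forall>a\<in>A. emeasure M a \<noteq> \<infinity>)"
      using D(1) fin inv[of "box 0 One"] space
      by (intro exI[of _ "?B ` D"]) (auto simp: less_top)
  qed
  then have psf: "pair_sigma_finite lborel M"
    by (simp add: pair_sigma_finite_def lborel.sigma_finite_measure_axioms)
  let ?C = "box 0 (One :: 'e)"
  note [measurable] = A
  have C[measurable]: "?C \<in> sets borel" by simp
  have inv': "(\<integral>\<^sup>+ x. F (x + a) \<partial>M) = (\<integral>\<^sup>+ x. F x \<partial>M)" if [measurable]: "F \<in> borel_measurable borel" for F :: "'e \<Rightarrow> ennreal" and a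
  proof -
    have "distr M borel (\<lambda>x. x + a) = M"
      by (rule measure_eqI) (auto simp: sets emeasure_distr space inv)
    then have "(\<integral>\<^sup>+ x. F x \<partial>M) = (\<integral>\<^sup>+ x. F x \<partial>distr M borel (\<lambda>x. x + a))" by simp
    also have "\<dots> = (\<integral>\<^sup>+ x. F (x + a) \<partial>M)" by (rule nn_integral_distr) auto
    finally show ?thesis ..
  qed
  have lt: "(\<integral>\<^sup>+ y. F (a + y) \<partial>lborel) = (\<integral>\<^sup>+ y. F y \<partial>lborel)" if [measurable]: "F \<in> borel_measurable borel" for F :: "'e \<Rightarrow> ennreal" and a
  proof -
    have "(\<integral>\<^sup>+ y. F y \<partial>lborel) = (\<integral>\<^sup>+ y. F y \<partial>distr lborel borel ((+) a))"
      using lborel_distr_plus[of a] by simp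
    also have "\<dots> = (\<integral>\<^sup>+ y. F (a + y) \<partial>lborel)" by (rule nn_integral_distr) auto
    finally show ?thesis ..
  qed
  have lm: "(\<integral>\<^sup>+ y. F (- y) \<partial>lborel) = (\<integral>\<^sup>+ y. F y \<partial>lborel)" if [measurable]: "F \<in> borel_measurable borel" for F :: "'e \<Rightarrow> ennreal"
  proof -
    have "lborel = distr lborel borel (uminus :: 'e \<Rightarrow> 'e)"
      using lborel_affine[of "-1" "0::'e"] by (simp add: density_1)
    then have "(\<integral>\<^sup>+ y. F y \<partial>lborel) = (\<integral>\<^sup>+ y. F y \<partial>distr lborel borel uminus)" by simp
    also have "\<dots> = (\<integral>\<^sup>+ y. F (- y) \<partial>lborel)" by (rule nn_integral_distr) auto
    finally show ?thesis ..
  qed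
  have C1: "emeasure lborel ?C = 1" by simp
  have "emeasure M A = (\<integral>\<^sup>+ x. indicator A x * emeasure lborel ?C \<partial>M)"
    using C1 by (simp add: sets)
  also have "\<dots> = (\<integral>\<^sup>+ x. \<integral>\<^sup>+ y. indicator A x * indicator ?C (x + y) \<partial>lborel \<partial>M)"
    by (intro nn_integral_cong) (simp add: nn_integral_cmult lt)
  also have "\<dots> = (\<integral>\<^sup>+ y. \<integral>\<^sup>+ x. indicator A x * indicator ?C (x + y) \<partial>M \<partial>lborel)"
    by (rule pair_sigma_finite.Fubini'[OF psf]) measurable
  also have "\<dots> = (\<integral>\<^sup>+ y. \<integral>\<^sup>+ x. indicator A (x - y) * indicator ?C x \<partial>M \<partial>lborel)"
  proof (rule nn_integral_cong)
    fix y :: 'e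
    have "(\<integral>\<^sup>+ x. indicator A (x - y) * indicator ?C x \<partial>M) =
      (\<integral>\<^sup>+ x. indicator A ((x + y) - y) * indicator ?C (x + y) \<partial>M)"
      by (rule inv'[symmetric]) measurable
    then show "(\<integral>\<^sup>+ x. indicator A x * indicator ?C (x + y) \<partial>M) = (\<integral>\<^sup>+ x. indicator A (x - y) * indicator ?C x \<partial>M)"
      by simp
  qed
  also have "\<dots> = (\<integral>\<^sup>+ x. \<integral>\<^sup>+ y. indicator A (x - y) * indicator ?C x \<partial>lborel \<partial>M)"
    by (rule pair_sigma_finite.Fubini'[OF psf, symmetric]) measurable
  also have "\<dots> = (\<integral>\<^sup>+ x. emeasure lborel A * indicator ?C x \<partial>M)"
  proof (intro nn_integral_cong)
    fix x
    have "(\<integral>\<^sup>+ y. indicator A (x - y) \<partial>lborel) = (\<integral>\<^sup>+ y. indicator A (x + y) \<partial>lborel)"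
      using lm[of "\<lambda>y. indicator A (x + y)"] by simp
    also have "\<dots> = emeasure lborel A" by (subst lt) auto
    finally show "(\<integral>\<^sup>+ y. indicator A (x - y) * indicator ?C x \<partial>lborel) = emeasure lborel A * indicator ?C x"
      by (simp add: nn_integral_multc)
  qed
  also have "\<dots> = emeasure M ?C * emeasure lborel A"
    by (simp add: nn_integral_cmult sets mult.commute)
  finally show ?thesis .
qed

text \<open>Pulled back along the isometry, the Hausdorff measure is translation invariant and
  finite on the unit cube, hence a multiple of Lebesgue measure.\<close>

lemma nn_integral_hausdorff_subspace:
  fixes \<iota> :: "'e::euclidean_space \<Rightarrow> 'a::euclidean_space"
  assumes lin: "linear \<iota>" and iso: "\<And>y. norm (\<iota> y) = norm y"
  obtains c :: real where "c \<ge> 0"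
    "\<And>F. F \<in> borel_measurable borel \<Longrightarrow> (\<And>x. x \<notin> range \<iota> \<Longrightarrow> F x = 0) \<Longrightarrow>
      (\<integral>\<^sup>+ x. F x \<partial>hausdorff_measure DIM('e)) = ennreal c * (\<integral>\<^sup>+ y. F (\<iota> y) \<partial>lborel)"
proof -
  let ?H = "hausdorff_measure DIM('e) :: 'a measure"
  \<comment> \<open>The adjoint of an isometric embedding is a left inverse of it; being linear, it
    is continuous.\<close>
  define \<kappa> where "\<kappa> = adjoint \<iota>"
  have inner: "\<iota> x \<bullet> \<iota> y = x \<bullet> y" for x y
    using iso[of "x + y"] iso[of x] iso[of y] lin by (simp add: linear_add dot_norm)
  have \<kappa>: "\<kappa> (\<iota> y) = y" for y
  proof -
    have "x \<bullet> \<kappa> (\<iota> y) = x \<bullet> y" for x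
      unfolding \<kappa>_def adjoint_works[OF lin] by (rule inner)
    then show ?thesis by (metis vector_eq_rdot inner_commute)
  qed
  have lk: "linear \<kappa>" unfolding \<kappa>_def by (rule adjoint_linear[OF lin])
  have sH[measurable_cong]: "sets ?H = sets borel"
    by (simp add: hausdorff_measure_def sets_measure_of_conv sigma_algebra.sigma_sets_eq[OF sets.sigma_algebra_axioms[of borel], simplified])
  have spH: "space ?H = UNIV" by (simp add: hausdorff_measure_def space_measure_of_conv)
  have ss: "sigma_sets UNIV (sets borel) = (sets borel :: 'a set set)"
    using sets.sigma_sets_eq[of "borel :: 'a measure"] by simp
  \<comment> \<open>A measure built by \<open>measure_of\<close> is zero unless its set function is
    a measure on the given sets. Both alternatives are translation invariant and finite on the cube,
    so the distinction need not be decided; this is why c is only claimed to be nonnegative.\<close>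
  have eH: "emeasure ?H A = (if measure_space UNIV (sets borel) (hausdorff_outer DIM('e) :: 'a set \<Rightarrow> ennreal) then hausdorff_outer DIM('e) A else 0)"
    if "A \<in> sets borel" for A
    using that by (simp add: hausdorff_measure_def emeasure_measure_of_conv ss)
  have bi: "\<iota> \<in> borel_measurable borel" and bk: "\<kappa> \<in> borel_measurable borel"
    using lin lk by (auto intro!: borel_measurable_continuous_onI linear_continuous_on simp: linear_conv_bounded_linear)
  note [measurable] = bi bk
  have W: "range \<iota> \<in> sets borel"
    by (intro borel_closed closed_subspace linear_subspace_image lin) (rule subspace_UNIV)
  note [measurable] = W
  define M where "M = distr (restrict_space ?H (range \<iota>)) borel \<kappa>"
  have kr: "\<kappa> \<in> restrict_space ?H (range \<iota>) \<rightarrow>\<^sub>M borel"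
    by (rule measurable_restrict_space1) (use bk sH in measurable)
  have sM: "sets M = sets borel" by (simp add: M_def)
  have vi: "\<kappa> -` A \<inter> range \<iota> = \<iota> ` A" for A using \<kappa> by force
  have iA: "\<iota> ` A \<in> sets borel" if "A \<in> sets borel" for A
  proof -
    have "\<kappa> -` A \<in> sets borel" using that by (intro measurable_sets_borel[OF bk])
    then show ?thesis using W by (metis vi sets.Int)
  qed
  have eM: "emeasure M A = emeasure ?H (\<iota> ` A)" if A: "A \<in> sets borel" for A
  proof -
    have "emeasure M A = emeasure (restrict_space ?H (range \<iota>)) (\<kappa> -` A \<inter> range \<iota>)"
      unfolding M_def using A kr by (subst emeasure_distr) (auto simp: space_restrict_space spH)
    also have "\<dots> = emeasure ?H (\<iota> ` A)"
      unfolding vi by (rule emeasure_restrict_space) (use sH spH W in auto)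
    finally show ?thesis .
  qed
  have inv: "emeasure M ((\<lambda>x. x + a) -` A) = emeasure M A" if A: "A \<in> sets borel" for A a
  proof -
    have A': "(\<lambda>x. x + a) -` A \<in> sets borel" using A by (intro measurable_sets_borel) auto
    have "\<iota> ` A = (+) (\<iota> a) ` \<iota> ` ((\<lambda>x. x + a) -` A)"
    proof -
      have "A = (\<lambda>x. x + a) ` ((\<lambda>x. x + a) -` A)" by (auto simp: image_iff)
      then have "\<iota> ` A = \<iota> ` (\<lambda>x. x + a) ` ((\<lambda>x. x + a) -` A)" by simp
      also have "\<dots> = (+) (\<iota> a) ` \<iota> ` ((\<lambda>x. x + a) -` A)"
        unfolding image_image using lin by (simp add: linear_add add.commute)
      finally show ?thesis .
    qed
    then have "hausdorff_outer DIM('e) (\<iota> ` A) = hausdorff_outer DIM('e) (\<iota> ` ((\<lambda>x. x + a) -` A))"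
      by (metis hausdorff_outer_translate)
    then show ?thesis using A A' iA by (simp add: eM eH)
  qed
  have fin: "emeasure M (box 0 One) < top"
    using hausdorff_outer_isometric_cube[OF lin iso] by (simp add: eM eH iA)
  define c where "c = enn2real (emeasure M (box 0 One))"
  have c: "emeasure M (box 0 One) = ennreal c" "c \<ge> 0"
    using fin by (auto simp: c_def)
  have M: "M = density lborel (\<lambda>_. ennreal c)"
  proof (rule measure_eqI)
    fix A assume "A \<in> sets M"
    then have A: "A \<in> sets borel" by (simp add: sM)
    show "emeasure M A = emeasure (density lborel (\<lambda>_. ennreal c)) A"
      using translation_invariant_eq_lborel[OF sM inv fin A] A c by (simp add: emeasure_density_const)
  qed (simp add: sM)
  show ?thesis
  proof (rule that[OF c(2)])
    fix F :: "'a \<Rightarrow> ennreal" assume F[measurable]: "F \<in> borel_measurable borel" and F0: "\<And>x. x \<notin> range \<iota> \<Longrightarrow> F x = 0"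
    have "(\<integral>\<^sup>+ x. F x \<partial>?H) = (\<integral>\<^sup>+ x. F x * indicator (range \<iota>) x \<partial>?H)"
      using F0 by (intro nn_integral_cong) (auto simp: indicator_def)
    also have "\<dots> = (\<integral>\<^sup>+ x. F x \<partial>restrict_space ?H (range \<iota>))"
      by (rule nn_integral_restrict_space[symmetric]) (simp add: spH sH W)
    also have "\<dots> = (\<integral>\<^sup>+ x. F (\<iota> (\<kappa> x)) \<partial>restrict_space ?H (range \<iota>))"
      by (intro nn_integral_cong) (auto simp: space_restrict_space \<kappa>)
    also have "\<dots> = (\<integral>\<^sup>+ y. F (\<iota> y) \<partial>M)"
      unfolding M_def by (rule nn_integral_distr[symmetric, OF kr]) measurable
    also have "\<dots> = ennreal c * (\<integral>\<^sup>+ y. F (\<iota> y) \<partial>lborel)"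
      unfolding M by (subst nn_integral_density) (auto simp: nn_integral_cmult)
    finally show "(\<integral>\<^sup>+ x. F x \<partial>?H) = ennreal c * (\<integral>\<^sup>+ y. F (\<iota> y) \<partial>lborel)" .
  qed
qed

section \<open>Topology of a homogeneous distance\<close>

text \<open>Points of the group are pairs; quantifiers over them should not be split into
  coordinates.\<close>

declare split_paired_All [simp del] split_paired_Ex [simp del]

lemma sqrt_2_neq_2: "sqrt 2 \<noteq> (2::real)"
proof
  assume "sqrt 2 = (2::real)"
  then have "(sqrt 2)\<^sup>2 = (2::real)\<^sup>2" by (rule arg_cong)
  then show False by simp
qed

section \<open>Group law, inverses and dilations in coordinates\<close>

lemma fst_hmul [simp]: "fst (p \<odot> q) = fst p + fst q"
  by (simp add: hmul_def hbracket_def e_last_def)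

lemma snd_hmul [simp]: "snd (p \<odot> q) = snd p + snd q + symp (fst p) (fst q) / 2"
  by (simp add: hmul_def hbracket_def e_last_def)

lemma fst_hinv [simp]: "fst (hinv p) = - fst p" and snd_hinv [simp]: "snd (hinv p) = - snd p"
  by (simp_all add: hinv_def)

lemma fst_dil [simp]: "fst (dil t p) = t *\<^sub>R fst p" and snd_dil [simp]: "snd (dil t p) = t\<^sup>2 * snd p"
  by (simp_all add: dil_def)

lemma symp_simps [simp]:
  "symp (a + b) c = symp a c + symp b c" "symp c (a + b) = symp c a + symp c b"
  "symp (- a) c = - symp a c" "symp c (- a) = - symp c a"
  "symp (a - b) c = symp a c - symp b c" "symp c (a - b) = symp c a - symp c b"
  "symp (r *\<^sub>R a) c = r * symp a c" "symp c (r *\<^sub>R a) = r * symp c a"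
  "symp a a = 0" "symp 0 a = 0" "symp a 0 = 0"
  by (simp_all add: symp_def inner_add_left inner_add_right inner_diff_left inner_diff_right
      inner_commute algebra_simps)

lemma symp_commute: "symp a b = - symp b a"
  by (simp add: symp_def inner_commute)

lemma continuous_on_symp [continuous_intros]:
  fixes f g :: "'a::topological_space \<Rightarrow> (real ^ 'n) \<times> (real ^ 'n)"
  assumes "continuous_on A f" "continuous_on A g"
  shows "continuous_on A (\<lambda>x. symp (f x) (g x))"
  unfolding symp_def by (intro continuous_intros assms)

lemma hmul_assoc: "(p \<odot> q) \<odot> r = p \<odot> (q \<odot> r)"
  by (rule prod_eqI) (simp_all add: algebra_simps add_divide_distrib)

lemma hinv_hinv [simp]: "hinv (hinv p) = p"
  by (simp add: hinv_def)

lemma hinv_0 [simp]: "hinv 0 = 0"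
  by (simp add: hinv_def)

lemma hinv_hmul: "hinv (p \<odot> q) = hinv q \<odot> hinv p"
  by (rule prod_eqI) (simp_all add: symp_commute[of "fst q" "fst p"])

lemma hmul_simps [simp]:
  "p \<odot> 0 = p" "0 \<odot> p = p" "hinv p \<odot> p = 0" "p \<odot> hinv p = 0"
  "hinv p \<odot> (p \<odot> q) = q" "p \<odot> (hinv p \<odot> q) = q" 
  by (simp_all add: hmul_hinv flip: hmul_assoc)

lemma dil_hmul: "dil t (p \<odot> q) = dil t p \<odot> dil t q"
  by (rule prod_eqI) (simp_all add: algebra_simps power2_eq_square)

lemma dil_dil [simp]: "dil s (dil t p) = dil (s * t) p"
  by (rule prod_eqI) (simp_all add: algebra_simps power2_eq_square)

lemma dil_1 [simp]: "dil 1 p = p"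
  by (rule prod_eqI) simp_all

lemma dil_0 [simp]: "dil t 0 = 0"
  by (rule prod_eqI) simp_all

lemma continuous_on_hmul [continuous_intros]:
  fixes f g :: "'a::topological_space \<Rightarrow> 'n::finite heis"
  assumes "continuous_on A f" "continuous_on A g"
  shows "continuous_on A (\<lambda>x. f x \<odot> g x)"
  unfolding hmul_def hbracket_def by (intro continuous_intros assms)

lemma continuous_on_hinv [continuous_intros]:
  fixes f :: "'a::topological_space \<Rightarrow> 'n::finite heis"
  assumes "continuous_on A f"
  shows "continuous_on A (\<lambda>x. hinv (f x))"
  unfolding hinv_def by (intro continuous_intros assms)

lemma continuous_on_dil [continuous_intros]:
  fixes f :: "'a::topological_space \<Rightarrow> 'n::finite heis"
  assumes "continuous_on A g" "continuous_on A f"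
  shows "continuous_on A (\<lambda>x. dil (g x) (f x))"
  unfolding dil_def by (intro continuous_intros assms)

locale hdist =
  fixes d :: "'n::finite heis \<Rightarrow> 'n heis \<Rightarrow> real"
  assumes homog: "homogeneous_distance d"
begin

lemma d_nonneg [simp]: "0 \<le> d x y"
  and d_commute: "d x y = d y x"
  and d_eq_0 [simp]: "d x y = 0 \<longleftrightarrow> x = y"
  and d_triangle: "d x z \<le> d x y + d y z"
proof -
  interpret Metric_space UNIV d using homog by (simp add: homogeneous_distance_def)
  show "0 \<le> d x y" "d x y = d y x" "d x y = 0 \<longleftrightarrow> x = y" "d x z \<le> d x y + d y z"
    using commute triangle by auto
qed

lemma d_left [simp]: "d (z \<odot> x) (z \<odot> y) = d x y"
  using homog by (simp add: homogeneous_distance_def)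

lemma d_dil [simp]: "t > 0 \<Longrightarrow> d (dil t x) (dil t y) = t * d x y"
  using homog by (simp add: homogeneous_distance_def)

abbreviation N :: "'n heis \<Rightarrow> real" where "N \<equiv> hnorm d"

lemma N_nonneg [simp]: "0 \<le> N x" and N_eq_0 [simp]: "N x = 0 \<longleftrightarrow> x = 0"
  by (simp_all add: hnorm_def)

lemma N_pos_iff [simp]: "0 < N x \<longleftrightarrow> x \<noteq> 0"
  using N_nonneg[of x] N_eq_0[of x] by linarith

lemma d_self [simp]: "d x x = 0"
  by simp

lemma N_0 [simp]: "N 0 = 0"
  by simp

lemma d_eq_N: "d x y = N (hinv x \<odot> y)"
  using d_left[of "hinv x" x y] by (simp add: hnorm_def d_commute)

lemma N_hinv [simp]: "N (hinv p) = N p"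
  using d_left[of p "hinv p" 0] by (simp add: hnorm_def d_commute)

lemma N_hmul: "N (p \<odot> q) \<le> N p + N q"
  using d_triangle[of "p \<odot> q" 0 p] d_left[of p q 0] by (simp add: hnorm_def)

lemma N_dil [simp]: "t > 0 \<Longrightarrow> N (dil t p) = t * N p"
  using d_dil[of t p 0] by (simp add: hnorm_def)

lemma N_scale_horizontal:
  assumes "snd p = 0"
  shows "N (t *\<^sub>R p) = \<bar>t\<bar> * N p"
proof -
  have *: "N (t *\<^sub>R p) = t * N p" if "t > 0" for t
    using N_dil[OF that, of p] assms by (simp add: dil_def scaleR_prod_def)
  consider "t > 0" | "t = 0" | "t < 0" by linarith
  then show ?thesis
  proof cases
    case 3
    then have "N ((-t) *\<^sub>R p) = (-t) * N p" by (intro *) auto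
    moreover have "N ((-t) *\<^sub>R p) = N (t *\<^sub>R p)"
      using N_hinv[of "t *\<^sub>R p"] by (simp add: hinv_def)
    ultimately show ?thesis using 3 by simp
  qed (use * in auto)
qed

lemma N_vertical: "N (0, t) = sqrt \<bar>t\<bar> * N (0, 1)"
proof -
  have *: "N (0, t) = sqrt t * N (0, 1)" if "t > 0" for t
    using N_dil[of "sqrt t" "(0, 1)"] that by (simp add: dil_def)
  consider "t > 0" | "t = 0" | "t < 0" by linarith
  then show ?thesis
  proof cases
    case 1
    then show ?thesis using *[OF 1] by simp
  next
    case 2
    then show ?thesis using N_0 unfolding zero_prod_def by simp
  next
    case 3
    then have "N (0, -t) = sqrt (-t) * N (0, 1)" by (intro *) auto
    moreover have "N (0, -t) = N (0, t)"
      using N_hinv[of "(0, t)"] by (simp add: hinv_def)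
    ultimately show ?thesis using 3 by simp
  qed
qed

text \<open>On horizontal vectors that are pairwise symplectically orthogonal the group product is
  the vector sum, so the triangle inequality of the distance applies to the sum.\<close>

lemma N_isotropic_sum:
  assumes "finite I" "\<And>i. i \<in> I \<Longrightarrow> snd (g i) = 0"
    and "\<And>i j. i \<in> I \<Longrightarrow> j \<in> I \<Longrightarrow> symp (fst (g i)) (fst (g j)) = 0"
  shows "N (\<Sum>i\<in>I. c i *\<^sub>R g i) \<le> (\<Sum>i\<in>I. \<bar>c i\<bar> * N (g i))"
  using assms
proof (induction I rule: finite_induct)
  case (insert i I)
  have s: "snd (\<Sum>i\<in>I. c i *\<^sub>R g i) = 0"
    using insert by (simp add: snd_sum)
  have "symp (fst (g i)) (fst (\<Sum>i\<in>I. c i *\<^sub>R g i)) = (\<Sum>j\<in>I. c j * symp (fst (g i)) (fst (g j)))"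
    by (induction I rule: infinite_finite_induct) (simp_all)
  also have "\<dots> = 0"
    using insert by simp
  finally have "(\<Sum>i\<in>insert i I. c i *\<^sub>R g i) = (c i *\<^sub>R g i) \<odot> (\<Sum>i\<in>I. c i *\<^sub>R g i)"
    using insert s by (intro prod_eqI) (simp_all)
  then have "N (\<Sum>i\<in>insert i I. c i *\<^sub>R g i) \<le> N (c i *\<^sub>R g i) + N (\<Sum>i\<in>I. c i *\<^sub>R g i)"
    by (simp add: N_hmul)
  moreover have "N (c i *\<^sub>R g i) = \<bar>c i\<bar> * N (g i)"
    using insert by (intro N_scale_horizontal) auto
  ultimately show ?case using insert by (simp)
qed simp

text \<open>The source of continuity, which is not part of the definition of a homogeneous distance.
  The point ((a, b), t) is the product of (a, 0), (0, b) and a vertical element. The first two lie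
  in isotropic coordinate subspaces; their product has vertical part a.b/2, which the third factor
  corrects.\<close>

lemma N_bound:
  obtains C where "\<And>a b t. N ((a, b), t) \<le>
    C * ((\<Sum>i\<in>UNIV. \<bar>a $ i\<bar>) + (\<Sum>i\<in>UNIV. \<bar>b $ i\<bar>) + sqrt \<bar>t - a \<bullet> b / 2\<bar>)" "C \<ge> 0"
proof -
  let ?e = "\<lambda>i. ((axis i 1, 0), 0) :: 'n heis"
  let ?f = "\<lambda>i. ((0, axis i 1), 0) :: 'n heis"
  define C where "C = (\<Sum>i\<in>UNIV. N (?e i)) + (\<Sum>i\<in>UNIV. N (?f i)) + N (0, 1)"
  have C0: "0 \<le> (\<Sum>i\<in>UNIV. N (?e i))" "0 \<le> (\<Sum>i\<in>UNIV. N (?f i))"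
    by (intro sum_nonneg; simp)+
  have le: "N (?e i) \<le> C" "N (?f i) \<le> C" for i
  proof -
    have "N (?e i) \<le> (\<Sum>i\<in>UNIV. N (?e i))" "N (?f i) \<le> (\<Sum>i\<in>UNIV. N (?f i))"
      by (rule member_le_sum; simp)+
    with C0 N_nonneg[of "(0,1)"] show "N (?e i) \<le> C" "N (?f i) \<le> C"
      unfolding C_def by linarith+
  qed
  have "N ((a, b), t) \<le>
    C * ((\<Sum>i\<in>UNIV. \<bar>a $ i\<bar>) + (\<Sum>i\<in>UNIV. \<bar>b $ i\<bar>) + sqrt \<bar>t - a \<bullet> b / 2\<bar>)" for a b t
  proof -
    have ea: "((a, 0), 0) = (\<Sum>i\<in>UNIV. (a $ i) *\<^sub>R ?e i)"
      by (intro prod_eqI) (simp_all add: fst_sum snd_sum basis_expansion scalar_mult_eq_scaleR[symmetric])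
    have eb: "((0, b), 0) = (\<Sum>i\<in>UNIV. (b $ i) *\<^sub>R ?f i)"
      by (intro prod_eqI) (simp_all add: fst_sum snd_sum basis_expansion scalar_mult_eq_scaleR[symmetric])
    have "N ((a, 0), 0) \<le> (\<Sum>i\<in>UNIV. \<bar>a $ i\<bar> * N (?e i))"
      unfolding ea by (rule N_isotropic_sum) (auto simp: symp_def)
    also have "\<dots> \<le> (\<Sum>i\<in>UNIV. \<bar>a $ i\<bar> * C)"
      by (intro sum_mono mult_left_mono le) auto
    finally have 1: "N ((a, 0), 0) \<le> C * (\<Sum>i\<in>UNIV. \<bar>a $ i\<bar>)"
      by (simp add: sum_distrib_left mult.commute)
    have "N ((0, b), 0) \<le> (\<Sum>i\<in>UNIV. \<bar>b $ i\<bar> * N (?f i))"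
      unfolding eb by (rule N_isotropic_sum) (auto simp: symp_def)
    also have "\<dots> \<le> (\<Sum>i\<in>UNIV. \<bar>b $ i\<bar> * C)"
      by (intro sum_mono mult_left_mono le) auto
    finally have 2: "N ((0, b), 0) \<le> C * (\<Sum>i\<in>UNIV. \<bar>b $ i\<bar>)"
      by (simp add: sum_distrib_left mult.commute)
    have 3: "N (0, t - a \<bullet> b / 2) \<le> C * sqrt \<bar>t - a \<bullet> b / 2\<bar>"
      unfolding N_vertical[of "t - _"] using C0
      by (subst mult.commute, intro mult_right_mono) (auto simp: C_def)
    have "((a, b), t) = (((a, 0), 0) \<odot> ((0, b), 0)) \<odot> (0, t - a \<bullet> b / 2)"
      by (intro prod_eqI) (auto simp: symp_def)
    then have "N ((a, b), t) \<le> N (((a, 0), 0) \<odot> ((0, b), 0)) + N (0, t - a \<bullet> b / 2)"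
      using N_hmul by metis
    also have "\<dots> \<le> N ((a, 0), 0) + N ((0, b), 0) + N (0, t - a \<bullet> b / 2)"
      by (intro add_right_mono N_hmul)
    finally have "N ((a, b), t) \<le> N ((a, 0), 0) + N ((0, b), 0) + N (0, t - a \<bullet> b / 2)" .
    with 1 2 3 show ?thesis by (simp add: algebra_simps)
  qed
  moreover have "C \<ge> 0" using C0 by (simp add: C_def)
  ultimately show ?thesis using that by blast
qed

lemma N_tendsto_0: "(N \<longlongrightarrow> 0) (nhds 0)"
proof -
  obtain C where C: "\<And>a b t. N ((a, b), t) \<le>
    C * ((\<Sum>i\<in>UNIV. \<bar>a $ i\<bar>) + (\<Sum>i\<in>UNIV. \<bar>b $ i\<bar>) + sqrt \<bar>t - a \<bullet> b / 2\<bar>)" and "C \<ge> 0"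
    by (rule N_bound) (rule that)
  let ?g = "\<lambda>p::'n heis. C * ((\<Sum>i\<in>UNIV. \<bar>fst (fst p) $ i\<bar>) + (\<Sum>i\<in>UNIV. \<bar>snd (fst p) $ i\<bar>)
     + sqrt \<bar>snd p - fst (fst p) \<bullet> snd (fst p) / 2\<bar>)"
  have "continuous_on UNIV ?g" by (intro continuous_intros) auto
  then have "isCont ?g 0" by (simp add: continuous_on_eq_continuous_at)
  then have "(?g \<longlongrightarrow> ?g 0) (nhds 0)"
    unfolding isCont_def by (rule tendsto_at_iff_tendsto_nhds[THEN iffD1])
  then have g: "(?g \<longlongrightarrow> 0) (nhds 0)" by simp
  show ?thesis
  proof (rule tendsto_sandwich[OF _ _ tendsto_const g])
    show "\<forall>\<^sub>F p in nhds 0. N p \<le> ?g p"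
      by (intro always_eventually allI) (metis C prod.collapse)
  qed auto
qed

lemma N_tendsto:
  assumes "(f \<longlongrightarrow> a) F"
  shows "((\<lambda>x. N (f x)) \<longlongrightarrow> N a) F"
proof -
  have c: "continuous_on UNIV (\<lambda>y. hinv a \<odot> y)" by (intro continuous_intros)
  have "((\<lambda>x. hinv a \<odot> f x) \<longlongrightarrow> hinv a \<odot> a) F"
    by (rule continuous_on_tendsto_compose[OF c assms]) auto
  then have "filterlim (\<lambda>x. hinv a \<odot> f x) (nhds 0) F" by simp
  from filterlim_compose[OF N_tendsto_0 this]
  have l: "((\<lambda>x. N (hinv a \<odot> f x)) \<longlongrightarrow> 0) F" .
  have "norm (N (f x) - N a) \<le> N (hinv a \<odot> f x)" for x
    using d_triangle[of "f x" 0 a] d_triangle[of a 0 "f x"] d_eq_N[of a "f x"] 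
    by (auto simp: hnorm_def d_commute abs_le_iff)
  then have "((\<lambda>x. N (f x) - N a) \<longlongrightarrow> 0) F"
    by (intro Lim_null_comparison[OF _ l]) auto
  then show ?thesis by (simp add: LIM_zero_iff)
qed

lemma continuous_on_N [continuous_intros]: "continuous_on A f \<Longrightarrow> continuous_on A (\<lambda>x. N (f x))"
  unfolding continuous_on_def using N_tendsto by blast

lemma continuous_on_d [continuous_intros]:
  fixes f g :: "'b::topological_space \<Rightarrow> 'n heis"
  assumes "continuous_on A f" "continuous_on A g"
  shows "continuous_on A (\<lambda>x. d (f x) (g x))"
proof -
  have "continuous_on A (\<lambda>x. N (hinv (f x) \<odot> g x))" by (intro continuous_intros assms)
  then show ?thesis by (subst d_eq_N)
qed

text \<open>A point of Euclidean norm at least 1 can be dilated down to the unit sphere, where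
  \<open>N\<close> has a positive minimum; so \<open>N p < e\<close> forces norm less than 1.
  Dilation by e/2 \<le> 1 shrinks the Euclidean norm at most by the factor (e/2)^2, which gives the
  bound 4/e^2.\<close>

lemma N_lower:
  obtains c where "c > 0" "\<And>p. N p \<le> 1 \<Longrightarrow> norm p \<le> c"
proof -
  have "compact (sphere (0::'n heis) 1)" "sphere (0::'n heis) 1 \<noteq> {}"
    by auto
  moreover have "continuous_on (sphere 0 1) N" by (intro continuous_intros)
  ultimately obtain s where s: "s \<in> sphere 0 1" "\<And>p. p \<in> sphere 0 1 \<Longrightarrow> N s \<le> N p"
    using continuous_attains_inf[of "sphere (0::'n heis) 1" N] by blast
  define e where "e = min (N s) 1"
  have e: "e > 0" "e \<le> 1" "e \<le> N s" using s by (auto simp: e_def)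
  have *: "norm p < 1" if "N p < e" for p
  proof (rule ccontr)
    assume n: "\<not> norm p < 1"
    have "continuous_on {0..1} (\<lambda>t. norm (dil t p))" by (intro continuous_intros)
    then obtain t where t: "0 \<le> t" "t \<le> 1" "norm (dil t p) = 1"
      using IVT'[of "\<lambda>t. norm (dil t p)" 0 1 1] n by (auto simp: dil_def)
    then have "t > 0" by (cases "t = 0") (auto simp: dil_def)
    then have "N s \<le> t * N p" using s(2)[of "dil t p"] t by simp
    also have "\<dots> \<le> 1 * N p" using t by (intro mult_right_mono) auto
    finally show False using that e by simp
  qed
  have "norm p \<le> 4 / e\<^sup>2" if "N p \<le> 1" for p
  proof -
    have "N (dil (e/2) p) \<le> e / 2" using that e by (simp add: N_dil mult_left_le)
    then have "norm (dil (e/2) p) < 1" using e by (intro *) simp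
    then have "(norm (dil (e/2) p))\<^sup>2 \<le> 1\<^sup>2" by (intro power_mono) auto
    then have le: "(e/2)\<^sup>2 * (norm (fst p))\<^sup>2 + (e/2)^4 * (snd p)\<^sup>2 \<le> 1"
      by (simp add: dil_def norm_Pair power_mult_distrib power_divide)
    have e4: "(e/2)^4 \<le> (e/2)\<^sup>2" using e by (intro power_decreasing) auto
    have "(e/2)^4 * ((norm (fst p))\<^sup>2 + (snd p)\<^sup>2) \<le> (e/2)\<^sup>2 * (norm (fst p))\<^sup>2 + (e/2)^4 * (snd p)\<^sup>2"
      using mult_right_mono[OF e4, of "(norm (fst p))\<^sup>2"] by (simp add: algebra_simps)
    then have "(e/2)^4 * (norm p)\<^sup>2 \<le> 1" using le by (cases p) (simp add: norm_Pair)
    then have "((e/2)\<^sup>2 * norm p)\<^sup>2 \<le> 1\<^sup>2" by (simp add: power_mult_distrib)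
    then have "(e/2)\<^sup>2 * norm p \<le> 1" by (rule power2_le_imp_le) simp
    then show ?thesis using e by (simp add: field_simps power2_eq_square)
  qed
  then show ?thesis using that[of "4 / e\<^sup>2"] e by simp
qed

lemma mem_hball: "y \<in> hball d x r \<longleftrightarrow> d x y \<le> r"
  by (simp add: hball_def)

lemma bounded_N: "bounded {p. N p \<le> r}"
proof -
  obtain c where c: "c > 0" "\<And>p. N p \<le> 1 \<Longrightarrow> norm p \<le> c" using N_lower by blast
  define R where "R = max r 1"
  have R: "R > 0" "r \<le> R" by (auto simp: R_def)
  have "{p. N p \<le> r} \<subseteq> dil R ` cball 0 c"
  proof
    fix p assume "p \<in> {p. N p \<le> r}"
    then have "N (dil (1/R) p) \<le> 1" using R by (simp add: N_dil)
    then have "dil (1/R) p \<in> cball 0 c" using c by simp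
    then have "dil R (dil (1/R) p) \<in> dil R ` cball 0 c" by (rule imageI)
    then show "p \<in> dil R ` cball 0 c" using R by simp
  qed
  moreover have "compact (dil R ` cball (0::'n heis) c)"
    by (intro compact_continuous_image continuous_intros) auto
  ultimately show ?thesis using compact_imp_bounded bounded_subset by blast
qed

lemma closed_N: "closed {p. N p \<le> r}"
  by (intro closed_Collect_le continuous_intros)

lemma compact_N: "compact {p. N p \<le> r}"
  using bounded_N closed_N by (simp add: compact_eq_bounded_closed)

lemma closed_hball [simp]: "closed (hball d x r)"
  unfolding hball_def by (intro closed_Collect_le continuous_intros)

text \<open>The distance induces the Euclidean topology at 0: outside a neighbourhood of 0, on the
  compact set \<open>N p \<le> 1\<close>, the continuous function \<open>N\<close> has a positive
  minimum.\<close>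

lemma tendsto_0_iff_N: "(f \<longlongrightarrow> 0) F \<longleftrightarrow> ((\<lambda>x. N (f x)) \<longlongrightarrow> 0) F"
proof
  assume "(f \<longlongrightarrow> 0) F" then show "((\<lambda>x. N (f x)) \<longlongrightarrow> 0) F"
    using N_tendsto by fastforce
next
  assume l: "((\<lambda>x. N (f x)) \<longlongrightarrow> 0) F"
  show "(f \<longlongrightarrow> 0) F"
  proof (rule topological_tendstoI)
    fix S :: "'n heis set" assume S: "open S" "0 \<in> S"
    show "\<forall>\<^sub>F x in F. f x \<in> S"
    proof (cases "{p. N p \<le> 1} - S = {}")
      case True
      have "\<forall>\<^sub>F x in F. N (f x) < 1" using l by (intro order_tendstoD(2)) auto
      then show ?thesis using True by (auto elim!: eventually_mono)
    next
      case False
      have "compact ({p. N p \<le> 1} - S)" using compact_diff[OF compact_N] S by blast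
      then obtain q where q: "q \<in> {p. N p \<le> 1} - S" "\<And>p. p \<in> {p. N p \<le> 1} - S \<Longrightarrow> N q \<le> N p"
        using continuous_attains_inf[of "{p. N p \<le> 1} - S" N] False
          continuous_on_N[OF continuous_on_id] by (metis (no_types, lifting))
      have "q \<noteq> 0" using q S by auto
      then have "0 < min 1 (N q)" by simp
      then have "\<forall>\<^sub>F x in F. N (f x) < min 1 (N q)" using l by (intro order_tendstoD(2))
      then show ?thesis
      proof (rule eventually_mono)
        fix x assume "N (f x) < min 1 (N q)"
        then show "f x \<in> S" using q(2)[of "f x"] by auto
      qed
    qed
  qed
qed

lemma open_contains_N:
  assumes "open S" "a \<in> S"
  obtains e where "e > 0" "\<And>p. d a p < e \<Longrightarrow> p \<in> S"
proof -
  \<comment> \<open>The d-balls about a generate this filter, so convergence to a along it means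
    that S contains one of them.\<close>
  let ?F = "filtercomap (\<lambda>p. d a p) (nhds 0)"
  have "((\<lambda>p. N (hinv a \<odot> p)) \<longlongrightarrow> 0) ?F"
    using filterlim_filtercomap[of "\<lambda>p. d a p" "nhds 0"] by (simp add: d_eq_N[of a])
  then have "((\<lambda>p. hinv a \<odot> p) \<longlongrightarrow> 0) ?F" by (simp add: tendsto_0_iff_N)
  moreover have "continuous_on UNIV (\<lambda>p. a \<odot> p)" by (intro continuous_intros)
  ultimately have "((\<lambda>p. a \<odot> (hinv a \<odot> p)) \<longlongrightarrow> a \<odot> 0) ?F"
    by (intro continuous_on_tendsto_compose[where f="\<lambda>p. a \<odot> p" and s = UNIV]) auto
  then have "\<forall>\<^sub>F p in ?F. p \<in> S" using assms by (auto dest: topological_tendstoD)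
  then obtain e where "e > 0" "\<And>p. dist (d a p) 0 < e \<Longrightarrow> p \<in> S"
    by (auto simp: eventually_filtercomap eventually_nhds_metric)
  then show ?thesis using that by simp
qed

lemma horizontal_unit:
  obtains h where "snd h = 0" "N h = 1"
proof -
  define g :: "'n heis" where "g = (((\<chi> i. 1), 0), 0)"
  have "g \<noteq> 0" by (simp add: g_def prod_eq_iff vec_eq_iff)
  then have "N g > 0" by simp
  then have "N ((1 / N g) *\<^sub>R g) = 1"
    by (subst N_scale_horizontal) (auto simp: g_def)
  then show ?thesis using that[of "(1 / N g) *\<^sub>R g"] by (simp add: g_def)
qed

text \<open>The diameter is attained: for horizontal h of norm r the points x h^(-1) and x h lie in
  the ball, and their quotient h h = 2 h has norm 2 r.\<close>

lemma hdiam_hball [simp]: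
  assumes "r \<ge> 0"
  shows "hdiam d (hball d x r) = 2 * r"
  unfolding hdiam_def
proof (rule cSup_eq_maximum)
  obtain h where h: "snd h = 0" "N h = 1" using horizontal_unit by blast
  have 1: "N (r *\<^sub>R h) = r" "N (2 *\<^sub>R (r *\<^sub>R h)) = 2 * r"
    using N_scale_horizontal[of h r] N_scale_horizontal[of h "2 * r"] h assms by auto
  have "hinv (x \<odot> hinv (r *\<^sub>R h)) \<odot> (x \<odot> (r *\<^sub>R h)) = (r *\<^sub>R h) \<odot> (r *\<^sub>R h)"
    by (simp add: hinv_hmul hmul_assoc)
  also have "\<dots> = 2 *\<^sub>R (r *\<^sub>R h)"
    using h by (intro prod_eqI) (auto simp: algebra_simps simp flip: scaleR_2)
  finally have "d (x \<odot> hinv (r *\<^sub>R h)) (x \<odot> (r *\<^sub>R h)) = 2 * r"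
    using 1 by (simp add: d_eq_N)
  moreover have "x \<odot> hinv (r *\<^sub>R h) \<in> hball d x r" "x \<odot> (r *\<^sub>R h) \<in> hball d x r"
    using 1 by (auto simp: mem_hball d_eq_N)
  ultimately show "2 * r \<in> {d x' y |x' y. x' \<in> hball d x r \<and> y \<in> hball d x r}"
    by (metis (mono_tags, lifting) mem_Collect_eq)
next
  fix s assume "s \<in> {d x' y |x' y. x' \<in> hball d x r \<and> y \<in> hball d x r}"
  then show "s \<le> 2 * r"
    using d_triangle[of _ _ x] d_commute by (auto simp: mem_hball) (smt (verit))
qed

end

section \<open>Comparison of spherical and centered measure\<close>

text \<open>Outer regularity is used for finite measures. So B is cut into disjoint pieces, each
  inside one open set of finite measure, and the j-th piece is approximated within that set at the
  cost \<eta> / 2^(j+1).\<close>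

lemma open_superset_measure_le:
  fixes M :: "'a::{second_countable_topology, complete_space} measure"
  assumes sets[measurable_cong]: "sets M = sets borel"
    and O: "\<And>j::nat. open (D j)" "\<And>j. emeasure M (D j) < top"
    and B: "B \<in> sets borel" "B \<subseteq> (\<Union>j. D j)" and \<eta>: "\<eta> > 0"
  obtains G where "open G" "B \<subseteq> G" "emeasure M G \<le> emeasure M B + ennreal \<eta>"
proof -
  define P where "P j = B \<inter> disjointed D j" for j
  have D[measurable]: "D j \<in> sets borel" for j using O by simp
  have P[measurable]: "P j \<in> sets borel" for j
  proof -
    have "disjointed D j \<in> sets borel" unfolding disjointed_def by (intro sets.Diff sets.finite_UN D) auto
    then show ?thesis using B by (simp add: P_def)
  qed
  have PD: "P j \<subseteq> D j" for j unfolding P_def using disjointed_subset[of D j] by auto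
  have "\<exists>V. open V \<and> P j \<subseteq> V \<and> V \<subseteq> D j \<and> emeasure M V \<le> emeasure M (P j) + ennreal (\<eta> * (1/2)^Suc j)" for j
  proof -
    let ?N = "density M (indicator (D j))"
    have N: "emeasure ?N A = emeasure M (D j \<inter> A)" if "A \<in> sets borel" for A
      using that by (intro emeasure_restricted) (auto simp: sets)
    have "emeasure ?N (P j) = (INF U \<in> {U. P j \<subseteq> U \<and> open U}. emeasure ?N U)"
    proof (rule outer_regular)
      show "emeasure ?N (space ?N) \<noteq> \<infinity>"
        using O(2)[of j] sets_eq_imp_space_eq[OF sets] by (simp add: N less_top)
    qed (auto simp: sets)
    moreover have "emeasure ?N (P j) = emeasure M (P j)"
      using PD[of j] by (simp add: N Int_absorb1)
    moreover have "emeasure M (P j) < emeasure M (P j) + ennreal (\<eta> * (1/2)^Suc j)"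
    proof -
      have "emeasure M (P j) < top"
        using emeasure_mono[OF PD, of j M] O(2)[of j] by (simp add: sets le_less_trans)
      then show ?thesis
        using \<eta> by (cases "emeasure M (P j)") (auto simp: ennreal_less_iff simp flip: ennreal_plus)
    qed
    ultimately obtain U where U: "P j \<subseteq> U" "open U" "emeasure ?N U < emeasure M (P j) + ennreal (\<eta> * (1/2)^Suc j)"
      by (metis (mono_tags, lifting) INF_less_iff mem_Collect_eq)
    then show ?thesis
      using PD O by (intro exI[of _ "D j \<inter> U"]) (auto simp: N)
  qed
  then obtain V where V: "\<And>j. open (V j)" "\<And>j. P j \<subseteq> V j"
    "\<And>j. emeasure M (V j) \<le> emeasure M (P j) + ennreal (\<eta> * (1/2)^Suc j)" by metis
  show ?thesis
  proof
    show "open (\<Union>j. V j)" using V by auto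
    have BP: "B = (\<Union>j. P j)"
      using B(2) UN_disjointed_eq[of D] unfolding P_def by blast
    then show "B \<subseteq> (\<Union>j. V j)" using V by blast
    have "emeasure M (\<Union>j. V j) \<le> (\<Sum>j. emeasure M (V j))"
      using V by (intro emeasure_subadditive_countably) (auto simp: sets)
    also have "\<dots> \<le> (\<Sum>j. emeasure M (P j) + ennreal (\<eta> * (1/2)^Suc j))"
      by (intro suminf_le V summableI)
    also have "\<dots> = (\<Sum>j. emeasure M (P j)) + (\<Sum>j. ennreal (\<eta> * (1/2)^Suc j))"
      by (intro suminf_add[symmetric]) auto
    also have "(\<Sum>j. emeasure M (P j)) = emeasure M (\<Union>j. P j)"
    proof (intro suminf_emeasure)
      show "disjoint_family P"
        using disjoint_family_disjointed[of D] unfolding disjoint_family_on_def P_def by blast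
    qed (auto simp: sets)
    also have "(\<Sum>j. ennreal (\<eta> * (1/2)^Suc j)) = ennreal \<eta>"
      using sums_mult[OF power_half_series, of \<eta>] \<eta> by (intro suminf_ennreal_eq) auto
    finally show "emeasure M (\<Union>j. V j) \<le> emeasure M B + ennreal \<eta>" by (simp add: BP)
  qed
qed

section \<open>Vitali coverings by balls of a homogeneous distance\<close>

context hdist begin

text \<open>Zorn's lemma for disjoint subfamilies G such that every ball meeting G meets a member of
  at least half its radius. If some balls missed a maximal G, one of them with radius above half the
  supremum of their radii could be added.\<close>

lemma vitali_covering:
  fixes F :: "('n heis \<times> real) set"
  assumes F: "\<And>x r. (x, r) \<in> F \<Longrightarrow> 0 < r \<and> r \<le> R"
  obtains G where "G \<subseteq> F" "\<And>x r y s. (x, r) \<in> G \<Longrightarrow> (y, s) \<in> G \<Longrightarrow> (x, r) \<noteq> (y, s) \<Longrightarrow> hball d x r \<inter> hball d y s = {}"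
    "\<And>x r. (x, r) \<in> F \<Longrightarrow> \<exists>y s. (y, s) \<in> G \<and> hball d x r \<inter> hball d y s \<noteq> {} \<and> r \<le> 2 * s"
proof -
  define meets where "meets b g \<longleftrightarrow> hball d (fst b) (snd b) \<inter> hball d (fst g) (snd g) \<noteq> {}" for b g :: "'n heis \<times> real"
  define \<A> where "\<A> = {G. G \<subseteq> F \<and> (\<forall>b\<in>G. \<forall>g\<in>G. b \<noteq> g \<longrightarrow> \<not> meets b g) \<and>
     (\<forall>b\<in>F. (\<exists>g\<in>G. meets b g) \<longrightarrow> (\<exists>g\<in>G. meets b g \<and> snd b \<le> 2 * snd g))}"
  have "\<exists>M\<in>\<A>. \<forall>X\<in>\<A>. M \<subseteq> X \<longrightarrow> X = M"
  proof (rule subset_Zorn')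
    fix C assume C: "subset.chain \<A> C"
    then have CA: "C \<subseteq> \<A>" and lin: "\<And>X Y. X \<in> C \<Longrightarrow> Y \<in> C \<Longrightarrow> X \<subseteq> Y \<or> Y \<subseteq> X"
      by (auto simp: subset_chain_def)
    have "\<not> meets b g" if bg: "b \<in> \<Union>C" "g \<in> \<Union>C" "b \<noteq> g" for b g
    proof -
      obtain X Y where XY: "X \<in> C" "b \<in> X" "Y \<in> C" "g \<in> Y" using bg by blast
      then obtain Z where "Z \<in> C" "b \<in> Z" "g \<in> Z" using lin[of X Y] by blast
      then show ?thesis using CA bg(3) unfolding \<A>_def by blast
    qed
    moreover have "\<exists>g\<in>\<Union>C. meets b g \<and> snd b \<le> 2 * snd g" if "b \<in> F" "\<exists>g\<in>\<Union>C. meets b g" for b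
      using that CA unfolding \<A>_def by blast
    moreover have "\<Union>C \<subseteq> F" using CA unfolding \<A>_def by blast
    ultimately show "\<Union>C \<in> \<A>" unfolding \<A>_def by blast
  qed
  then obtain M where M: "M \<in> \<A>" "\<And>X. X \<in> \<A> \<Longrightarrow> M \<subseteq> X \<Longrightarrow> X = M" by blast
  have self: "meets b b" if "b \<in> F" for b
  proof -
    have "fst b \<in> hball d (fst b) (snd b)" using F[of "fst b" "snd b"] that by (simp add: mem_hball)
    then show ?thesis unfolding meets_def by blast
  qed
  have all: "\<exists>g\<in>M. meets b g" if "b \<in> F" for b
  proof (rule ccontr)
    assume nb: "\<not> (\<exists>g\<in>M. meets b g)"
    define F' where "F' = {b\<in>F. \<not> (\<exists>g\<in>M. meets b g)}"
    have bF: "b \<in> F'" using that nb by (simp add: F'_def)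
    have bdd: "bdd_above (snd ` F')"
      using F by (intro bdd_aboveI2[of _ _ R]) (auto simp: F'_def)
    define \<rho> where "\<rho> = (SUP b\<in>F'. snd b)"
    have up: "snd c \<le> \<rho>" if "c \<in> F'" for c
      unfolding \<rho>_def using that bdd by (intro cSUP_upper)
    have "0 < snd b" using F[of "fst b" "snd b"] that by simp
    then have "\<rho> / 2 < \<rho>" using up[OF bF] by linarith
    then obtain c where c: "c \<in> F'" "\<rho> / 2 < snd c"
      using less_cSUP_iff[of F' snd "\<rho> / 2"] bF bdd unfolding \<rho>_def by blast
    have "insert c M \<in> \<A>"
      unfolding \<A>_def
    proof (intro CollectI conjI ballI impI)
      show "insert c M \<subseteq> F" using c M(1) by (auto simp: F'_def \<A>_def)
    next
      fix x y assume xy: "x \<in> insert c M" "y \<in> insert c M" "x \<noteq> y"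
      have cM: "\<not> meets c g" "\<not> meets g c" if "g \<in> M" for g
        using c(1) that unfolding F'_def meets_def by (auto simp: Int_commute)
      show "\<not> meets x y"
        using xy cM M(1) unfolding \<A>_def by blast
    next
      fix x assume x: "x \<in> F" "\<exists>g\<in>insert c M. meets x g"
      show "\<exists>g\<in>insert c M. meets x g \<and> snd x \<le> 2 * snd g"
      proof (cases "\<exists>g\<in>M. meets x g")
        case True
        then show ?thesis using M(1) x unfolding \<A>_def by blast
      next
        case False
        then have "x \<in> F'" "meets x c" using x by (auto simp: F'_def)
        then show ?thesis using up[of x] c by force
      qed
    qed
    then have "c \<in> M" using M(2)[of "insert c M"] by blast
    then show False using c self unfolding F'_def by blast
  qed
  show ?thesis
  proof
    show "M \<subseteq> F" using M by (simp add: \<A>_def)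
    show "hball d x r \<inter> hball d y s = {}" if "(x, r) \<in> M" "(y, s) \<in> M" "(x, r) \<noteq> (y, s)" for x r y s
    proof -
      have "\<not> meets (x, r) (y, s)" using M(1) that unfolding \<A>_def by blast
      then show ?thesis by (simp add: meets_def)
    qed
    show "\<exists>y s. (y, s) \<in> M \<and> hball d x r \<inter> hball d y s \<noteq> {} \<and> r \<le> 2 * s" if "(x, r) \<in> F" for x r
    proof -
      have "\<exists>g\<in>M. meets (x, r) g \<and> snd (x, r) \<le> 2 * snd g"
        using M(1) all[OF that] that unfolding \<A>_def by blast
      then show ?thesis unfolding meets_def by force
    qed
  qed
qed

text \<open>Disjoint balls of the selected family lie in G, so the density bound limits their sum of
  r^\<alpha> to K/t. Finitely many of them keep their radius; the remaining ones are enlarged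
  threefold, at a cost that is a small tail of a convergent sum.\<close>

lemma centered_delta_le:
  fixes M :: "'n heis measure"
  assumes sets: "sets M = sets borel" and t: "t > 0" and \<alpha>: "\<alpha> > 0" and \<delta>: "\<delta> > 0"
    and G: "open G" "E \<subseteq> G" "emeasure M G \<le> ennreal K" "K \<ge> 0"
    and dens: "\<And>x r0. x \<in> E \<Longrightarrow> r0 > 0 \<Longrightarrow> \<exists>r. 0 < r \<and> r < r0 \<and> ennreal (t * r powr \<alpha>) < emeasure M (hball d x r)"
  shows "centered_delta d \<alpha> \<delta> E \<le> ennreal (K / t)"
proof (cases "E = {}")
  case True
  then show ?thesis by (simp add: centered_delta_def)
next
  case False
  \<comment> \<open>The factor 6 leaves room for enlarging the radius to 3 r, where the diameter is
    6 r.\<close>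
  define F where "F = {(x, r). x \<in> E \<and> 0 < r \<and> 6 * r \<le> \<delta> \<and> hball d x r \<subseteq> G \<and> ennreal (t * r powr \<alpha>) < emeasure M (hball d x r)}"
  have fine: "\<exists>r. (x, r) \<in> F \<and> hball d x r \<subseteq> U" if x: "x \<in> E" "open U" "x \<in> U" for x U
  proof -
    have "open (U \<inter> G)" "x \<in> U \<inter> G" using x G by auto
    then obtain e where e: "e > 0" "\<And>p. d x p < e \<Longrightarrow> p \<in> U \<inter> G" by (rule open_contains_N) (rule that)
    obtain r where r: "0 < r" "r < min e (\<delta> / 6)" "ennreal (t * r powr \<alpha>) < emeasure M (hball d x r)"
      using dens[OF x(1), of "min e (\<delta> / 6)"] e \<delta> by auto
    have "hball d x r \<subseteq> U \<inter> G" using e(2) r by (auto simp: mem_hball)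
    then show ?thesis using r x by (intro exI[of _ r]) (auto simp: F_def)
  qed
  have Fb: "\<And>x r. (x, r) \<in> F \<Longrightarrow> 0 < r \<and> r \<le> \<delta> / 6" by (auto simp: F_def)
  obtain H where H: "H \<subseteq> F"
    "\<And>x r y s. (x, r) \<in> H \<Longrightarrow> (y, s) \<in> H \<Longrightarrow> (x, r) \<noteq> (y, s) \<Longrightarrow> hball d x r \<inter> hball d y s = {}"
    "\<And>x r. (x, r) \<in> F \<Longrightarrow> \<exists>y s. (y, s) \<in> H \<and> hball d x r \<inter> hball d y s \<noteq> {} \<and> r \<le> 2 * s"
    by (rule vitali_covering[of F "\<delta> / 6"]) (erule Fb, rule that)
  have Hpos: "0 < snd b" if "b \<in> H" for b using that H(1) by (auto simp: F_def)
  have disj: "disjoint_family_on (\<lambda>b. hball d (fst b) (snd b)) H"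
    unfolding disjoint_family_on_def using H(2) by (metis prod.collapse)
  have fin_sum: "(\<Sum>b\<in>A. snd b powr \<alpha>) \<le> K / t" if A: "finite A" "A \<subseteq> H" for A
  proof -
    have "ennreal (\<Sum>b\<in>A. t * snd b powr \<alpha>) = (\<Sum>b\<in>A. ennreal (t * snd b powr \<alpha>))"
      using t by (intro sum_ennreal[symmetric]) auto
    also have "\<dots> \<le> (\<Sum>b\<in>A. emeasure M (hball d (fst b) (snd b)))"
      using A H(1) by (intro sum_mono) (auto simp: F_def dest!: subsetD)
    also have "\<dots> = emeasure M (\<Union>b\<in>A. hball d (fst b) (snd b))"
      using A disj by (intro sum_emeasure) (auto simp: sets disjoint_family_on_def subset_iff)
    also have "\<dots> \<le> emeasure M G"
    proof (intro emeasure_mono UN_least)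
      fix b assume "b \<in> A"
      then have "(fst b, snd b) \<in> F" using A H(1) by auto
      then show "hball d (fst b) (snd b) \<subseteq> G" unfolding F_def by blast
    qed (use G in \<open>simp add: sets\<close>)
    also have "\<dots> \<le> ennreal K" by fact
    finally have "(\<Sum>b\<in>A. t * snd b powr \<alpha>) \<le> K" using G by simp
    then show ?thesis using t by (simp add: sum_distrib_left[symmetric] field_simps)
  qed
  \<comment> \<open>The sum over all of H, expressed through finite subsets.\<close>
  define Z where "Z = (SUP A\<in>{A. finite A \<and> A \<subseteq> H}. \<Sum>b\<in>A. snd b powr \<alpha>)"
  have bddZ: "bdd_above ((\<lambda>A. \<Sum>b\<in>A. snd b powr \<alpha>) ` {A. finite A \<and> A \<subseteq> H})"
    using fin_sum by (intro bdd_aboveI2[of _ _ "K / t"]) auto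
  have le_Z: "(\<Sum>b\<in>A. snd b powr \<alpha>) \<le> Z" if "finite A" "A \<subseteq> H" for A
    unfolding Z_def using bddZ that by (intro cSUP_upper) auto
  have Z_le: "Z \<le> K / t" unfolding Z_def using fin_sum by (intro cSUP_least) auto
  \<comment> \<open>Coverings are indexed by sets of natural numbers. The corresponding open balls
    are nonempty and disjoint, and the space is second countable.\<close>
  have cH: "countable H"
  proof (rule countable_image_inj_on)
    let ?b = "\<lambda>b. {y. d (fst b) y < snd b}"
    have ne: "fst b \<in> ?b b" if "b \<in> H" for b using Hpos[OF that] by simp
    have sub: "?b b \<subseteq> hball d (fst b) (snd b)" for b by (auto simp: mem_hball)
    have dj: "?b b \<inter> ?b c = {}" if "b \<in> H" "c \<in> H" "b \<noteq> c" for b c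
      using H(2)[of "fst b" "snd b" "fst c" "snd c"] sub[of b] sub[of c] that by (auto simp: prod_eq_iff)
    show "inj_on ?b H"
      using ne dj by (intro inj_onI) (metis Int_iff empty_iff)
    show "countable (?b ` H)"
    proof (rule countable_disjoint_open_subsets)
      show "open S" if "S \<in> ?b ` H" for S
        using that by (auto intro!: open_Collect_less continuous_intros)
      show "pairwise disjnt (?b ` H)"
        unfolding pairwise_def disjnt_def using dj by blast
    qed
  qed
  have "centered_delta d \<alpha> \<delta> E \<le> ennreal (K / t) + ennreal e" if e: "e > 0" for e
  proof -
    \<comment> \<open>Tripling the radii multiplies the tail by 3^\<alpha>, so it then contributes
      e.\<close>
    define \<epsilon> where "\<epsilon> = e / 3 powr \<alpha>"
    have \<epsilon>: "\<epsilon> > 0" using e by (simp add: \<epsilon>_def)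
    then have "Z - \<epsilon> < Z" by simp
    then obtain H0 where H0: "finite H0" "H0 \<subseteq> H" "Z - \<epsilon> < (\<Sum>b\<in>H0. snd b powr \<alpha>)"
      using less_cSUP_iff[OF _ bddZ, of "Z - \<epsilon>"] unfolding Z_def by blast
    have tail: "(\<Sum>b\<in>A. snd b powr \<alpha>) \<le> \<epsilon>" if "finite A" "A \<subseteq> H - H0" for A
    proof -
      have "(\<Sum>b\<in>H0 \<union> A. snd b powr \<alpha>) = (\<Sum>b\<in>H0. snd b powr \<alpha>) + (\<Sum>b\<in>A. snd b powr \<alpha>)"
        using that H0 by (intro sum.union_disjoint) auto
      moreover have "(\<Sum>b\<in>H0 \<union> A. snd b powr \<alpha>) \<le> Z"
        using that H0 by (intro le_Z) auto
      ultimately show ?thesis using H0 by linarith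
    qed
    \<comment> \<open>A factor 3 instead of the usual 5 is enough, because only the centres x of the
      balls in F have to be covered: d y x \<le> s + r \<le> 3 s.\<close>
    define rad where "rad b = (if b \<in> H0 then snd b else 3 * snd b)" for b :: "'n heis \<times> real"
    let ?J = "to_nat_on H ` H" and ?b = "from_nat_into H"
    have fb: "?b (to_nat_on H b) = b" if "b \<in> H" for b using that cH by simp
    have inj: "inj_on (to_nat_on H) H" using cH by (rule inj_on_to_nat_on)
    have cov: "E \<subseteq> (\<Union>b\<in>H. hball d (fst b) (rad b))"
    proof
      fix x assume x: "x \<in> E"
      let ?C = "\<Union>b\<in>H0. hball d (fst b) (snd b)"
      show "x \<in> (\<Union>b\<in>H. hball d (fst b) (rad b))"
      proof (cases "x \<in> ?C")
        case True
        then obtain b where b: "b \<in> H0" "x \<in> hball d (fst b) (snd b)" by blast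
        then have "b \<in> H" "x \<in> hball d (fst b) (rad b)" using H0 by (auto simp: rad_def)
        then show ?thesis by blast
      next
        case False
        \<comment> \<open>A finite union of closed balls is closed, so some ball of F about x avoids
          it. A selected ball meeting that one is therefore not in H0 and is among the enlarged
          ones.\<close>
        have "closed ?C" using H0 by (intro closed_UN) auto
        then have op: "open (- ?C)" by (rule open_Compl)
        have "x \<in> - ?C" using False by blast
        with fine[OF x op] obtain r where r: "(x, r) \<in> F" "hball d x r \<subseteq> - ?C"
          by blast
        obtain y s where ys: "(y, s) \<in> H" "hball d x r \<inter> hball d y s \<noteq> {}" "r \<le> 2 * s"
          using H(3)[OF r(1)] by blast
        then obtain z where z: "d x z \<le> r" "d y z \<le> s" by (auto simp: mem_hball)
        have "(y, s) \<notin> H0" using r(2) ys(2) by fastforce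
        then have "x \<in> hball d (fst (y, s)) (rad (y, s))"
          using z ys d_triangle[of y x z] d_commute[of x z] by (simp add: mem_hball rad_def)
        then show ?thesis using ys by blast
      qed
    qed
    have "centered_delta d \<alpha> \<delta> E \<le> (\<Sum>\<^sub>\<infinity>i\<in>?J. ennreal (rad (?b i) powr \<alpha>))"
      unfolding centered_delta_def if_not_P[OF False]
    proof (rule Inf_lower, intro CollectI exI[of _ ?J] exI[of _ "\<lambda>i. fst (?b i)"] exI[of _ "\<lambda>i. rad (?b i)"] conjI refl ballI)
      show "E \<subseteq> (\<Union>i\<in>?J. hball d (fst (?b i)) (rad (?b i)))"
        using cov by (simp add: fb)
      fix i assume "i \<in> ?J"
      then have i: "?b i \<in> H" using fb by auto
      then show "fst (?b i) \<in> E" using H(1) by (auto simp: F_def)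
      show pos: "0 < rad (?b i)" using Hpos[OF i] by (simp add: rad_def)
      have "(fst (?b i), snd (?b i)) \<in> F" using i H(1) by auto
      then have "6 * snd (?b i) \<le> \<delta>" unfolding F_def by blast
      then show "hdiam d (hball d (fst (?b i)) (rad (?b i))) \<le> \<delta>"
        using pos Hpos[OF i] by (auto simp: rad_def)
    qed
    also have "\<dots> = (\<Sum>\<^sub>\<infinity>b\<in>H. ennreal (rad b powr \<alpha>))"
      by (subst infsum_reindex[OF inj]) (auto intro!: infsum_cong simp: fb)
    also have "\<dots> \<le> ennreal (K / t) + ennreal e"
    proof (subst nonneg_infsum_complete, simp, rule SUP_least)
      fix A assume "A \<in> {F. finite F \<and> F \<subseteq> H}"
      then have A: "finite A" "A \<subseteq> H" by auto
      have "(\<Sum>b\<in>A. rad b powr \<alpha>) = (\<Sum>b\<in>A \<inter> H0. rad b powr \<alpha>) + (\<Sum>b\<in>A - H0. rad b powr \<alpha>)"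
        using A by (metis sum.Int_Diff)
      also have "(\<Sum>b\<in>A \<inter> H0. rad b powr \<alpha>) = (\<Sum>b\<in>A \<inter> H0. snd b powr \<alpha>)"
        by (intro sum.cong) (auto simp: rad_def)
      also have "\<dots> \<le> K / t" using A by (intro fin_sum) auto
      also have "(\<Sum>b\<in>A - H0. rad b powr \<alpha>) = 3 powr \<alpha> * (\<Sum>b\<in>A - H0. snd b powr \<alpha>)"
        unfolding sum_distrib_left using A Hpos
        by (intro sum.cong) (auto simp: rad_def powr_mult less_imp_le subset_iff)
      also have "\<dots> \<le> 3 powr \<alpha> * \<epsilon>" using A by (intro mult_left_mono tail) auto
      also have "\<dots> = e" by (simp add: \<epsilon>_def)
      finally have "(\<Sum>b\<in>A. rad b powr \<alpha>) \<le> K / t + e" by simp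
      then have "ennreal (\<Sum>b\<in>A. rad b powr \<alpha>) \<le> ennreal (K / t + e)" by (rule ennreal_leI)
      then show "(\<Sum>b\<in>A. ennreal (rad b powr \<alpha>)) \<le> ennreal (K / t) + ennreal e"
        using G t e by (simp add: sum_ennreal ennreal_plus)
    qed
    finally show ?thesis .
  qed
  then show ?thesis by (rule ennreal_le_epsilon)
qed

lemma centered_pre_eq_SUP: "centered_pre d \<alpha> E = (SUP \<delta>\<in>{0<..}. centered_delta d \<alpha> \<delta> E)"
proof -
  have anti: "centered_delta d \<alpha> \<delta> E \<le> centered_delta d \<alpha> \<delta>' E" if "\<delta>' \<le> \<delta>" for \<delta> \<delta>'
  proof (cases "E = {}")
    case False
    show ?thesis
      unfolding centered_delta_def if_not_P[OF False]
    proof (intro Inf_superset_mono subsetI, elim CollectE exE conjE)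
      fix s and J :: "nat set" and x r
      assume "s = (\<Sum>\<^sub>\<infinity>i\<in>J. ennreal (r i powr \<alpha>))" "E \<subseteq> (\<Union>i\<in>J. hball d (x i) (r i))"
        "\<forall>i\<in>J. x i \<in> E \<and> 0 < r i \<and> hdiam d (hball d (x i) (r i)) \<le> \<delta>'"
      then show "s \<in> {(\<Sum>\<^sub>\<infinity>i\<in>J. ennreal (r i powr \<alpha>)) | (J::nat set) x r.
        E \<subseteq> (\<Union>i\<in>J. hball d (x i) (r i))
        \<and> (\<forall>i\<in>J. x i \<in> E \<and> 0 < r i \<and> hdiam d (hball d (x i) (r i)) \<le> \<delta>)}"
        using that by (intro CollectI exI[of _ J] exI[of _ x] exI[of _ r]) auto
    qed
  qed (simp add: centered_delta_def)
  have "((\<lambda>\<delta>. centered_delta d \<alpha> \<delta> E) \<longlongrightarrow> (SUP \<delta>\<in>{0<..}. centered_delta d \<alpha> \<delta> E)) (at_right 0)"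
  proof (rule order_tendstoI)
    fix a assume "a < (SUP \<delta>\<in>{0<..}. centered_delta d \<alpha> \<delta> E)"
    then obtain \<delta> where "\<delta> > 0" "a < centered_delta d \<alpha> \<delta> E"
      unfolding less_SUP_iff by blast
    then show "\<forall>\<^sub>F \<delta> in at_right 0. a < centered_delta d \<alpha> \<delta> E"
      unfolding eventually_at_right_field by (intro exI[of _ \<delta>]) (blast intro: order_less_le_trans anti less_imp_le)
  next
    fix a assume a: "(SUP \<delta>\<in>{0<..}. centered_delta d \<alpha> \<delta> E) < a"
    have "centered_delta d \<alpha> \<delta> E < a" if "\<delta> > 0" for \<delta>
      using a that by (intro le_less_trans[OF SUP_upper a]) auto
    then show "\<forall>\<^sub>F \<delta> in at_right 0. centered_delta d \<alpha> \<delta> E < a"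
      unfolding eventually_at_right_field by (intro exI[of _ 1]) auto
  qed
  then show ?thesis unfolding centered_pre_def by (intro tendsto_Lim) auto
qed

text \<open>Centered coverings are particular coverings by balls, and the summands agree because the
  diameter of a ball is 2 r.\<close>

lemma spherical_le_centered:
  assumes "\<alpha> > 0"
  shows "spherical_measure d \<alpha> A \<le> centered_measure d \<alpha> A"
proof -
  have "spherical_measure d \<alpha> A \<le> centered_pre d \<alpha> A"
    unfolding spherical_measure_def centered_pre_eq_SUP
  proof (intro SUP_mono bexI)
    fix \<delta> :: real assume "\<delta> \<in> {0<..}"
    let ?S = "{(\<Sum>\<^sub>\<infinity>j\<in>J. ennreal (2 powr (- \<alpha>) * hdiam d (hball d (c j) (r j)) powr \<alpha>)) | (J::nat set) c r.
        A \<subseteq> (\<Union>j\<in>J. hball d (c j) (r j)) \<and> (\<forall>j\<in>J. 0 < r j \<and> hdiam d (hball d (c j) (r j)) \<le> \<delta>)}"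
    show "Inf ?S \<le> centered_delta d \<alpha> \<delta> A"
    proof (cases "A = {}")
      case True
      have "Inf ?S \<le> (\<Sum>\<^sub>\<infinity>j\<in>({}::nat set). ennreal (2 powr (- \<alpha>) * hdiam d (hball d 0 0) powr \<alpha>))"
        using True by (intro Inf_lower CollectI exI[of _ "{}"]) auto
      then show ?thesis by simp
    next
      case False
      show ?thesis
        unfolding centered_delta_def if_not_P[OF False]
      proof (intro Inf_superset_mono subsetI, elim CollectE exE conjE)
        fix s and J :: "nat set" and x r
        assume s: "s = (\<Sum>\<^sub>\<infinity>i\<in>J. ennreal (r i powr \<alpha>))" and A: "A \<subseteq> (\<Union>i\<in>J. hball d (x i) (r i))"
          and r: "\<forall>i\<in>J. x i \<in> A \<and> 0 < r i \<and> hdiam d (hball d (x i) (r i)) \<le> \<delta>"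
        have "s = (\<Sum>\<^sub>\<infinity>i\<in>J. ennreal (2 powr (- \<alpha>) * hdiam d (hball d (x i) (r i)) powr \<alpha>))"
          unfolding s using r by (intro infsum_cong) (auto simp: powr_mult powr_minus field_simps)
        then show "s \<in> ?S" using A r by blast
      qed
    qed
  qed
  also have "\<dots> \<le> centered_measure d \<alpha> A"
    unfolding centered_measure_def by (intro SUP_upper) auto
  finally show ?thesis .
qed

text \<open>Both set functions are compared with the outer measure of M. The bound
  \<open>lower\<close>, on centred balls, gives centered \<le> outer by Vitali coverings. The bound
  \<open>upper\<close> concerns every small ball that contains the point, as the balls of a
  spherical covering need not be centred, and gives outer \<le> spherical.\<close>

theorem centered_eq_spherical:
  fixes M :: "'n heis measure"
  assumes sets: "sets M = sets borel" and \<alpha>: "\<alpha> > 0"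
    and lower: "\<And>x t r0. x \<in> S \<Longrightarrow> 0 < t \<Longrightarrow> t < 1 \<Longrightarrow> r0 > 0 \<Longrightarrow>
      \<exists>r. 0 < r \<and> r < r0 \<and> ennreal (t * r powr \<alpha>) < emeasure M (hball d x r)"
    and upper: "\<And>x t. x \<in> S \<Longrightarrow> 1 < t \<Longrightarrow> \<exists>\<epsilon>>0. \<forall>y r. x \<in> hball d y r \<longrightarrow> 0 < r \<longrightarrow> r < \<epsilon> \<longrightarrow>
      emeasure M (hball d y r) \<le> ennreal (t * r powr \<alpha>)"
    and A: "A \<subseteq> S"
  shows "centered_measure d \<alpha> A = spherical_measure d \<alpha> A"
proof (rule antisym[OF _ spherical_le_centered[OF \<alpha>]])
  have space: "space M = UNIV" using sets_eq_imp_space_eq[OF sets] by simp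
  have C_le: "centered_measure d \<alpha> A \<le> outer_measure_of M A"
    unfolding centered_measure_def
  proof (rule SUP_least)
    fix E assume "E \<in> Pow A"
    then have E: "E \<subseteq> A" by simp
    have "centered_pre d \<alpha> E \<le> outer_measure_of M E"
    proof (cases "outer_measure_of M E = top")
      case False
      obtain B where B: "B \<in> sets borel" "E \<subseteq> B" "outer_measure_of M E = emeasure M B"
        using outer_measure_of_attain[of E M] space sets by auto
      \<comment> \<open>Local finiteness of M at points of S, from \<open>upper\<close> with t = 2;
        Lindelof then yields the countable open cover required for open supersets.\<close>
      have "\<exists>D. open D \<and> x \<in> D \<and> emeasure M D < top" if x: "x \<in> S" for x
      proof -
        obtain \<epsilon> where \<epsilon>: "\<epsilon> > 0" "\<And>y r. x \<in> hball d y r \<Longrightarrow> 0 < r \<Longrightarrow> r < \<epsilon> \<Longrightarrow>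
            emeasure M (hball d y r) \<le> ennreal (2 * r powr \<alpha>)"
          using upper[OF x, of 2] by auto
        have op: "open {y. d x y < \<epsilon> / 2}" by (intro open_Collect_less continuous_intros)
        have "emeasure M {y. d x y < \<epsilon> / 2} \<le> emeasure M (hball d x (\<epsilon> / 2))"
          using op by (intro emeasure_mono) (auto simp: mem_hball sets)
        also have "\<dots> \<le> ennreal (2 * (\<epsilon> / 2) powr \<alpha>)"
          using \<epsilon>(1) by (intro \<epsilon>(2)) (auto simp: mem_hball)
        also have "\<dots> < top" by simp
        finally show ?thesis using op \<epsilon>(1) by (intro exI[of _ "{y. d x y < \<epsilon> / 2}"]) auto
      qed
      then obtain D where D: "\<And>x. x \<in> S \<Longrightarrow> open (D x) \<and> x \<in> D x \<and> emeasure M (D x) < top" by metis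
      obtain \<F> where \<F>: "\<F> \<subseteq> D ` S" "countable \<F>" "\<Union>\<F> = \<Union>(D ` S)"
        by (rule Lindelof[of "D ` S"]) (use D in auto)
      \<comment> \<open>The empty set is added so that the family is nonempty and can be
        enumerated.\<close>
      define Q where "Q = from_nat_into (insert {} \<F>)"
      have rQ: "range Q = insert {} \<F>" unfolding Q_def using \<F>(2) by (intro range_from_nat_into) auto
      have Q: "open (Q j)" "emeasure M (Q j) < top" for j
      proof -
        have "Q j \<in> insert {} \<F>" using rQ by blast
        then show "open (Q j)" "emeasure M (Q j) < top" using \<F>(1) D by auto
      qed
      have "S \<subseteq> (\<Union>j. Q j)"
      proof
        fix x assume x: "x \<in> S"
        then have "x \<in> \<Union>\<F>" unfolding \<F>(3) using D by blast
        then show "x \<in> (\<Union>j. Q j)" using rQ by blast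
      qed
      then have EQ: "E \<subseteq> B \<inter> (\<Union>j. Q j)" using E A B by blast
      have BQ: "B \<inter> (\<Union>j. Q j) \<in> sets borel" using B Q by auto
      have le: "emeasure M (B \<inter> (\<Union>j. Q j)) \<le> emeasure M B" using B by (intro emeasure_mono) (auto simp: sets)
      obtain k where k: "emeasure M B = ennreal k" "k \<ge> 0"
        using False B by (metis ennreal_cases)
      have "centered_pre d \<alpha> E \<le> ennreal (k + e)" if e: "e > 0" for e
      proof -
        define \<eta> where "\<eta> = e / 2"
        have \<eta>: "\<eta> > 0" using e by (simp add: \<eta>_def)
        obtain G where G: "open G" "B \<inter> (\<Union>j. Q j) \<subseteq> G" "emeasure M G \<le> emeasure M (B \<inter> (\<Union>j. Q j)) + ennreal \<eta>"
          by (rule open_superset_measure_le[OF sets Q BQ _ \<eta>]) auto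
        have "emeasure M G \<le> ennreal k + ennreal \<eta>" using order_trans[OF G(3) add_right_mono[OF le]] k by simp
        then have GK: "emeasure M G \<le> ennreal (k + \<eta>)" using k \<eta> by (simp add: ennreal_plus)
        \<comment> \<open>Chosen so that the Vitali bound (k + \<eta>)/t becomes k + e; it is below
          1 since \<eta> = e/2, and positive even for k = 0.\<close>
        define t where "t = (k + \<eta>) / (k + e)"
        have t: "0 < t" "t < 1" "(k + \<eta>) / t = k + e"
          using k e by (auto simp: t_def \<eta>_def field_simps)
        have "centered_delta d \<alpha> \<delta> E \<le> ennreal ((k + \<eta>) / t)" if "\<delta> > 0" for \<delta>
        proof (rule centered_delta_le[OF sets t(1) \<alpha> that G(1) _ GK])
          show "E \<subseteq> G" using EQ G by blast
          show "0 \<le> k + \<eta>" using k \<eta> by simp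
          show "\<exists>r>0. r < r0 \<and> ennreal (t * r powr \<alpha>) < emeasure M (hball d x r)" if "x \<in> E" "r0 > 0" for x r0
            using lower[of x t r0] that(2) t(1,2) subsetD[OF A subsetD[OF E that(1)]] by blast
        qed
        then show ?thesis unfolding centered_pre_eq_SUP t(3) by (intro SUP_least) auto
      qed
      then have ke: "centered_pre d \<alpha> E \<le> ennreal k + ennreal e" if "e > 0" for e
        using that k by (simp add: ennreal_plus)
      have "centered_pre d \<alpha> E \<le> ennreal k" by (rule ennreal_le_epsilon) (rule ke)
      then show ?thesis using B k by simp
    qed simp
    also have "\<dots> \<le> outer_measure_of M A" using E by (rule outer_measure_of_mono)
    finally show "centered_pre d \<alpha> E \<le> outer_measure_of M A" .
  qed
  have "outer_measure_of M A \<le> ennreal t * spherical_measure d \<alpha> A" if t: "t > 1" for t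
  proof -
    \<comment> \<open>The points at which the upper bound holds for all radii below 1/(n+1). These
      sets increase to A; they need not be measurable, but outer measures are continuous along
      increasing sequences.\<close>
    define P where "P n = {x\<in>A. \<forall>y r. x \<in> hball d y r \<longrightarrow> 0 < r \<longrightarrow> r < 1 / real (Suc n) \<longrightarrow>
      emeasure M (hball d y r) \<le> ennreal (t * r powr \<alpha>)}" for n
    have incP: "incseq P"
      unfolding incseq_def P_def
    proof (clarify)
      fix m n :: nat and y r x assume mn: "m \<le> n" and r: "r < 1 / real (Suc n)" "0 < r" "x \<in> hball d y r"
        and H: "\<forall>y r. x \<in> hball d y r \<longrightarrow> 0 < r \<longrightarrow> r < 1 / real (Suc m) \<longrightarrow>
          emeasure M (hball d y r) \<le> ennreal (t * r powr \<alpha>)"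
      have "1 / real (Suc n) \<le> 1 / real (Suc m)" using mn by (intro divide_left_mono) auto
      then show "emeasure M (hball d y r) \<le> ennreal (t * r powr \<alpha>)" using H r by auto
    qed
    have UP: "(\<Union>n. P n) = A"
    proof (intro equalityI subsetI)
      fix x assume x: "x \<in> A"
      then obtain \<epsilon> where \<epsilon>: "\<epsilon> > 0" "\<And>y r. x \<in> hball d y r \<Longrightarrow> 0 < r \<Longrightarrow> r < \<epsilon> \<Longrightarrow>
            emeasure M (hball d y r) \<le> ennreal (t * r powr \<alpha>)"
        using upper[of x t] t A by blast
      obtain n where "1 / real (Suc n) < \<epsilon>" using \<epsilon>(1) nat_approx_posE by blast
      then have "x \<in> P n" unfolding P_def using x \<epsilon>(2) by auto
      then show "x \<in> (\<Union>n. P n)" by blast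
    qed (auto simp: P_def)
    have "outer_measure_of M (P n) \<le> ennreal t * spherical_measure d \<alpha> A" for n
    proof -
      define \<delta> where "\<delta> = 1 / real (Suc n)"
      have \<delta>: "\<delta> > 0" by (simp add: \<delta>_def)
      let ?S = "{(\<Sum>\<^sub>\<infinity>j\<in>J. ennreal (2 powr (- \<alpha>) * hdiam d (hball d (c j) (r j)) powr \<alpha>)) | (J::nat set) c r.
        A \<subseteq> (\<Union>j\<in>J. hball d (c j) (r j)) \<and> (\<forall>j\<in>J. 0 < r j \<and> hdiam d (hball d (c j) (r j)) \<le> \<delta>)}"
      have "outer_measure_of M (P n) \<le> ennreal t * s" if s: "s \<in> ?S" for s
      proof -
        obtain J :: "nat set" and c r where s: "s = (\<Sum>\<^sub>\<infinity>j\<in>J. ennreal (2 powr (- \<alpha>) * hdiam d (hball d (c j) (r j)) powr \<alpha>))"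
          and cov: "A \<subseteq> (\<Union>j\<in>J. hball d (c j) (r j))" and r: "\<And>j. j \<in> J \<Longrightarrow> 0 < r j \<and> hdiam d (hball d (c j) (r j)) \<le> \<delta>"
          using s by blast
        \<comment> \<open>Balls that miss \<open>P n\<close> are dropped, since the bound on their
          measure is available only for balls containing one of its points.\<close>
        define J' where "J' = {j\<in>J. hball d (c j) (r j) \<inter> P n \<noteq> {}}"
        have "P n \<subseteq> A" by (auto simp: P_def)
        then have sub: "P n \<subseteq> (\<Union>j\<in>J'. hball d (c j) (r j))" using cov unfolding J'_def by blast
        have est: "emeasure M (hball d (c j) (r j)) \<le> ennreal (t * r j powr \<alpha>)" if jJ: "j \<in> J'" for j
        proof -
          have j: "j \<in> J" "0 < r j" "hdiam d (hball d (c j) (r j)) \<le> \<delta>" using jJ r by (auto simp: J'_def)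
          then have "r j < \<delta>" using \<delta> by simp
          moreover obtain x where "x \<in> P n" "x \<in> hball d (c j) (r j)" using jJ unfolding J'_def by blast
          ultimately show ?thesis using j unfolding P_def \<delta>_def by blast
        qed
        have "outer_measure_of M (P n) \<le> outer_measure_of M (\<Union>j\<in>J'. hball d (c j) (r j))"
          using sub by (rule outer_measure_of_mono)
        also have "\<dots> = emeasure M (\<Union>j\<in>J'. hball d (c j) (r j))"
          by (rule outer_measure_of_eq) (auto simp: sets)
        also have "(\<Union>j\<in>J'. hball d (c j) (r j)) = (\<Union>j. if j \<in> J' then hball d (c j) (r j) else {})"
          by auto
        also have "emeasure M \<dots> \<le> (\<Sum>j. emeasure M (if j \<in> J' then hball d (c j) (r j) else {}))"
          by (rule emeasure_subadditive_countably) (auto simp: sets)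
        also have "\<dots> \<le> (\<Sum>j. if j \<in> J then ennreal (t * r j powr \<alpha>) else 0)"
          using est by (intro suminf_le summableI) (auto simp: J'_def)
        also have "\<dots> = (\<Sum>\<^sub>\<infinity>j. if j \<in> J then ennreal (t * r j powr \<alpha>) else 0)"
          by (rule sums_unique[symmetric], rule has_sum_imp_sums, rule has_sum_infsum,
              rule nonneg_summable_on_complete) simp
        also have "\<dots> = (\<Sum>\<^sub>\<infinity>j\<in>J. ennreal (t * r j powr \<alpha>))"
          by (rule infsum_cong_neutral) auto
        also have "\<dots> = (\<Sum>\<^sub>\<infinity>j\<in>J. ennreal t * ennreal (2 powr (- \<alpha>) * hdiam d (hball d (c j) (r j)) powr \<alpha>))"
        proof (intro infsum_cong)
          fix j assume "j \<in> J"
          then have "r j > 0" using r by blast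
          then show "ennreal (t * r j powr \<alpha>) = ennreal t * ennreal (2 powr (- \<alpha>) * hdiam d (hball d (c j) (r j)) powr \<alpha>)"
            using t by (simp add: powr_mult powr_minus ennreal_mult[symmetric])
        qed
        also have "\<dots> = ennreal t * s"
          unfolding s by (simp add: nonneg_infsum_complete sum_distrib_left[symmetric] SUP_mult_left_ennreal)
        finally show ?thesis .
      qed
      note le_s = this
      have inv: "ennreal (1 / t) * (ennreal t * s) = s" "ennreal t * (ennreal (1 / t) * s) = s" for s
        using t by (simp_all add: mult.assoc[symmetric] ennreal_mult[symmetric])
      have "ennreal (1 / t) * outer_measure_of M (P n) \<le> Inf ?S"
      proof (rule Inf_greatest)
        fix s assume "s \<in> ?S"
        then have "ennreal (1 / t) * outer_measure_of M (P n) \<le> ennreal (1 / t) * (ennreal t * s)"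
          by (intro mult_left_mono le_s) auto
        then show "ennreal (1 / t) * outer_measure_of M (P n) \<le> s" by (simp add: inv)
      qed
      then have "ennreal t * (ennreal (1 / t) * outer_measure_of M (P n)) \<le> ennreal t * Inf ?S"
        by (rule mult_left_mono) simp
      then have "outer_measure_of M (P n) \<le> ennreal t * Inf ?S" by (simp add: inv)
      also have "\<dots> \<le> ennreal t * spherical_measure d \<alpha> A"
        unfolding spherical_measure_def using \<delta> by (intro mult_left_mono SUP_upper) auto
      finally show ?thesis .
    qed
    moreover have "(SUP n. outer_measure_of M (P n)) = outer_measure_of M A"
      using SUP_outer_measure_of_incseq[of P M] incP UP space by simp
    ultimately show ?thesis by (metis SUP_least)
  qed
  note le = this
  have "outer_measure_of M A \<le> spherical_measure d \<alpha> A"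
  proof (cases "spherical_measure d \<alpha> A = top")
    case False
    then obtain k where k: "spherical_measure d \<alpha> A = ennreal k" "k \<ge> 0" by (metis ennreal_cases)
    have "outer_measure_of M A \<le> ennreal k + ennreal e" if e: "e > 0" for e
    proof -
      \<comment> \<open>The excess e k/(k+1) is at most e; the summand 1 avoids dividing by 0 when k
        = 0.\<close>
      have "outer_measure_of M A \<le> ennreal (1 + e / (k + 1)) * ennreal k"
        using le[of "1 + e / (k + 1)"] k e by simp
      also have "\<dots> = ennreal ((1 + e / (k + 1)) * k)" using k e by (simp add: ennreal_mult)
      also have "\<dots> \<le> ennreal (k + e)"
        using k e by (intro ennreal_leI) (simp add: field_simps)
      finally show ?thesis using k e by (simp add: ennreal_plus)
    qed
    then show ?thesis unfolding k by (rule ennreal_le_epsilon)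
  qed simp
  then show "centered_measure d \<alpha> A \<le> spherical_measure d \<alpha> A" using C_le by (rule order_trans[rotated])
qed

end

section \<open>Coordinates on a vertical subgroup\<close>

lemma nn_integral_lborel_affine:
  fixes H :: "'a::euclidean_space \<Rightarrow> ennreal"
  assumes [measurable]: "H \<in> borel_measurable borel" and c: "c > 0"
  shows "(\<integral>\<^sup>+ y. H y \<partial>lborel) = ennreal (c ^ DIM('a)) * (\<integral>\<^sup>+ y. H (a + c *\<^sub>R y) \<partial>lborel)"
proof -
  have "(\<integral>\<^sup>+ y. H y \<partial>lborel) = (\<integral>\<^sup>+ y. H y \<partial>density (distr lborel borel (\<lambda>x. a + c *\<^sub>R x)) (\<lambda>_. ennreal (\<bar>c\<bar> ^ DIM('a))))"
    using lborel_affine[of c a] c by simp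
  also have "\<dots> = ennreal (c ^ DIM('a)) * (\<integral>\<^sup>+ y. H (a + c *\<^sub>R y) \<partial>lborel)"
    using c by (simp add: nn_integral_density nn_integral_distr nn_integral_cmult)
  finally show ?thesis .
qed

lemma nn_integral_lborel_pair:
  fixes F :: "'a::euclidean_space \<times> 'b::euclidean_space \<Rightarrow> ennreal"
  assumes [measurable]: "F \<in> borel_measurable borel"
  shows "(\<integral>\<^sup>+ p. F p \<partial>lborel) = (\<integral>\<^sup>+ y. \<integral>\<^sup>+ t. F (y, t) \<partial>lborel \<partial>lborel)"
proof -
  have "F \<in> borel_measurable (lborel \<Otimes>\<^sub>M lborel)" unfolding lborel_prod by simp
  then show ?thesis by (subst lborel_prod[symmetric]) (simp add: lborel.nn_integral_fst)
qed

text \<open>By Fubini, g only translates the vertical fibres. Each horizontal direction scales by r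
  and the vertical one by r^2, so the exponent is the homogeneous dimension.\<close>

lemma nn_integral_lborel_shear:
  fixes F :: "'a::euclidean_space \<times> real \<Rightarrow> ennreal"
  assumes F[measurable]: "F \<in> borel_measurable borel" and g[measurable]: "g \<in> borel_measurable borel" and r: "r > 0"
  shows "(\<integral>\<^sup>+ p. F p \<partial>lborel) =
    ennreal (r ^ (DIM('a) + 2)) * (\<integral>\<^sup>+ p. F (a + r *\<^sub>R fst p, g (fst p) + r\<^sup>2 * snd p) \<partial>lborel)"
proof -
  have pm: "borel \<Otimes>\<^sub>M borel = (borel :: ('a \<times> real) measure)" by (rule borel_prod)
  have F'[measurable]: "F \<in> borel_measurable (borel \<Otimes>\<^sub>M borel)" unfolding pm by (rule F)
  have G: "(\<lambda>p. F (a + r *\<^sub>R fst p, g (fst p) + r\<^sup>2 * snd p)) \<in> borel_measurable borel"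
    unfolding pm[symmetric] by measurable
  have "(\<integral>\<^sup>+ p. F p \<partial>lborel) = (\<integral>\<^sup>+ y. \<integral>\<^sup>+ t. F (y, t) \<partial>lborel \<partial>lborel)"
    by (rule nn_integral_lborel_pair[OF F])
  also have "\<dots> = ennreal (r ^ DIM('a)) * (\<integral>\<^sup>+ y. \<integral>\<^sup>+ t. F (a + r *\<^sub>R y, t) \<partial>lborel \<partial>lborel)"
    using r by (subst nn_integral_lborel_affine[where c = r and a = a]) simp_all
  also have "(\<integral>\<^sup>+ y. \<integral>\<^sup>+ t. F (a + r *\<^sub>R y, t) \<partial>lborel \<partial>lborel)
    = (\<integral>\<^sup>+ y. ennreal (r\<^sup>2) * (\<integral>\<^sup>+ t. F (a + r *\<^sub>R y, g y + r\<^sup>2 * t) \<partial>lborel) \<partial>lborel)"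
    using r by (intro nn_integral_cong, subst nn_integral_real_affine[where c = "r\<^sup>2" and t = "g _"]) simp_all
  also have "\<dots> = ennreal (r\<^sup>2) * (\<integral>\<^sup>+ y. \<integral>\<^sup>+ t. F (a + r *\<^sub>R y, g y + r\<^sup>2 * t) \<partial>lborel \<partial>lborel)"
    by (rule nn_integral_cmult) simp
  also have "(\<integral>\<^sup>+ y. \<integral>\<^sup>+ t. F (a + r *\<^sub>R y, g y + r\<^sup>2 * t) \<partial>lborel \<partial>lborel) =
    (\<integral>\<^sup>+ p. F (a + r *\<^sub>R fst p, g (fst p) + r\<^sup>2 * snd p) \<partial>lborel)"
    by (subst nn_integral_lborel_pair[OF G]) simp
  finally show ?thesis
    using r by (simp only: power_add ennreal_mult mult.assoc zero_le_power less_imp_le)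
qed

text \<open>The type \<open>'m\<close> indexes the horizontal basis vectors of W, so W has linear
  dimension \<open>CARD('m) + 1\<close> and homogeneous dimension
  \<open>CARD('m) + 2\<close>.\<close>

locale factorization = hdist d for d :: "'n::finite heis \<Rightarrow> 'n heis \<Rightarrow> real" +
  fixes W V :: "'n heis set" and w :: "'m::finite \<Rightarrow> 'n heis"
  assumes semi: "semidirect W V" and W_basis: "orthonormal_basis (case_option e_last w) W"
    and convex_ball: "convex (hball d 0 1)"
begin

lemma W_group: "closed W" "0 \<in> W" "x \<in> W \<Longrightarrow> y \<in> W \<Longrightarrow> x \<odot> y \<in> W" "x \<in> W \<Longrightarrow> hinv x \<in> W"
    "t > 0 \<Longrightarrow> x \<in> W \<Longrightarrow> dil t x \<in> W"
  and V_group: "closed V" "0 \<in> V" "x \<in> V \<Longrightarrow> y \<in> V \<Longrightarrow> x \<odot> y \<in> V" "x \<in> V \<Longrightarrow> hinv x \<in> V"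
    "t > 0 \<Longrightarrow> x \<in> V \<Longrightarrow> dil t x \<in> V"
  and V_horizontal: "x \<in> V \<Longrightarrow> snd x = 0"
  and WV: "W \<inter> V = {0}" and hsetmul_WV: "hsetmul W V = UNIV"
  using semi unfolding semidirect_def vertical_subgroup_def horizontal_subgroup_def homogeneous_subgroup_def
  by (auto simp: H1_def)

lemma WV_cases: obtains a b where "a \<in> W" "b \<in> V" "x = a \<odot> b"
  using hsetmul_WV unfolding hsetmul_def by blast

lemma WV_unique:
  assumes "a \<in> W" "b \<in> V" "a' \<in> W" "b' \<in> V" "a \<odot> b = a' \<odot> b'"
  shows "a = a' \<and> b = b'"
proof -
  have "hinv a' \<odot> a = (hinv a' \<odot> (a \<odot> b)) \<odot> hinv b" by (simp add: hmul_assoc)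
  also have "\<dots> = b' \<odot> hinv b" unfolding assms(5) by simp
  finally have eq: "hinv a' \<odot> a = b' \<odot> hinv b" .
  moreover have "hinv a' \<odot> a \<in> W" "b' \<odot> hinv b \<in> V" using assms W_group V_group by auto
  ultimately have "hinv a' \<odot> a = 0" "b' \<odot> hinv b = 0" using WV by auto
  then have "a' \<odot> (hinv a' \<odot> a) = a'" "(b' \<odot> hinv b) \<odot> b = b" by simp_all
  then show ?thesis by (simp add: hmul_assoc)
qed

lemma projV_hmul [simp]: "a \<in> W \<Longrightarrow> b \<in> V \<Longrightarrow> projV W V (a \<odot> b) = b"
  unfolding projV_def using WV_unique by (intro the_equality) blast+

text \<open>The vertical part of a product of two horizontal points is half their symplectic
  product, and it vanishes because V is closed under products. So the group law on V is vector
  addition.\<close>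

lemma V_isotropic: "a \<in> V \<Longrightarrow> b \<in> V \<Longrightarrow> symp (fst a) (fst b) = 0"
  using V_horizontal[of "a \<odot> b"] V_horizontal[of a] V_horizontal[of b] V_group(3)[of a b] by simp

lemma V_hmul: "a \<in> V \<Longrightarrow> b \<in> V \<Longrightarrow> a \<odot> b = a + b"
  by (rule prod_eqI) (simp_all add: V_isotropic)

lemma V_dil: "a \<in> V \<Longrightarrow> dil t a = t *\<^sub>R a"
  by (rule prod_eqI) (simp_all add: V_horizontal)

lemma w_props: "snd (w i) = 0" "w i \<bullet> w j = (if i = j then 1 else 0)"
proof -
  have b: "case_option e_last w i \<bullet> case_option e_last w j = (if i = j then 1 else 0)" for i j
    using W_basis unfolding orthonormal_basis_def by blast
  show "snd (w i) = 0" using b[of "Some i" None] by (simp add: e_last_def inner_prod_def)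
  show "w i \<bullet> w j = (if i = j then 1 else 0)" using b[of "Some i" "Some j"] by simp
qed

definition hz :: "real ^ 'm \<Rightarrow> (real ^ 'n) \<times> (real ^ 'n)" where
  "hz y = (\<Sum>i\<in>UNIV. (y $ i) *\<^sub>R fst (w i))"

text \<open>Isometric linear coordinates on W, through which integrals over W become Lebesgue
  integrals.\<close>

definition \<iota> :: "(real ^ 'm) \<times> real \<Rightarrow> 'n heis" where
  "\<iota> p = (hz (fst p), snd p)"

lemma linear_hz: "linear hz"
  unfolding hz_def
  by (intro linearI) (simp_all add: scaleR_add_left sum.distrib scaleR_sum_right)

lemma hz_simps [simp]: "hz (x + y) = hz x + hz y" "hz (c *\<^sub>R x) = c *\<^sub>R hz x" "hz 0 = 0"
  using linear_hz by (simp_all add: linear_add linear_scale linear_0)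

lemma linear_\<iota>: "linear \<iota>"
  by (intro linearI) (simp_all add: \<iota>_def)

lemma fst_\<iota> [simp]: "fst (\<iota> p) = hz (fst p)" and snd_\<iota> [simp]: "snd (\<iota> p) = snd p"
  by (simp_all add: \<iota>_def)

lemma continuous_on_hz [continuous_intros]: "continuous_on A f \<Longrightarrow> continuous_on A (\<lambda>x. hz (f x))"
  unfolding hz_def by (intro continuous_intros)

lemma continuous_on_\<iota> [continuous_intros]: "continuous_on A f \<Longrightarrow> continuous_on A (\<lambda>x. \<iota> (f x))"
  unfolding \<iota>_def by (intro continuous_intros)

lemma hz_axis [simp]: "hz (axis i 1) = fst (w i)"
proof -
  have "(axis i 1 $ j) *\<^sub>R fst (w j) = (if j = i then fst (w j) else 0)" for j
    by (simp add: axis_def)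
  then show ?thesis by (simp add: hz_def sum.delta)
qed

lemma inner_hz: "hz x \<bullet> hz y = x \<bullet> y"
proof -
  have ww: "fst (w i) \<bullet> fst (w j) = (if i = j then 1 else 0)" for i j
    using w_props[of i] w_props[of j] by (simp add: inner_prod_def)
  have "fst (w i) \<bullet> hz y = y $ i" for i
    by (simp add: hz_def inner_sum_right ww if_distrib sum.delta cong: if_cong)
  then show ?thesis by (subst hz_def) (simp add: inner_sum_left inner_vec_def)
qed

lemma norm_\<iota>: "norm (\<iota> p) = norm p"
  by (cases p) (simp add: norm_eq_sqrt_inner \<iota>_def inner_hz)

lemma range_\<iota>: "range \<iota> = W"
proof
  have W: "W = span (range (case_option e_last w))"
    using W_basis unfolding orthonormal_basis_def by simp
  have sum: "\<iota> p = (\<Sum>i\<in>UNIV. (fst p $ i) *\<^sub>R w i) + snd p *\<^sub>R e_last" for p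
    by (rule prod_eqI) (simp_all add: hz_def fst_sum snd_sum e_last_def w_props)
  have "w i \<in> W" for i unfolding W by (intro span_base) (metis option.simps(5) rangeI)
  moreover have "e_last \<in> W" unfolding W by (intro span_base) (metis option.simps(4) rangeI)
  moreover have "subspace W" unfolding W by (rule subspace_span)
  ultimately have "\<iota> p \<in> W" for p
    unfolding sum by (intro subspace_add subspace_sum subspace_scale) auto
  then show "range \<iota> \<subseteq> W" by auto
  have "w i \<in> range \<iota>" for i
  proof
    show "w i = \<iota> (axis i 1, 0)"
      by (rule prod_eqI) (simp_all add: w_props)
  qed simp
  moreover have "e_last \<in> range \<iota>"
    by (rule image_eqI[of _ _ "(0, 1)"]) (simp_all add: \<iota>_def e_last_def)
  ultimately have "range (case_option e_last w) \<subseteq> range \<iota>"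
    by (auto split: option.split)
  then show "W \<subseteq> range \<iota>"
    unfolding W by (intro span_minimal linear_subspace_image linear_\<iota>) auto
qed

lemma \<iota>_in_W [simp]: "\<iota> p \<in> W"
  using range_\<iota> by blast

lemma inj_\<iota>: "inj \<iota>"
proof (rule injI)
  fix p q assume "\<iota> p = \<iota> q"
  then have "norm (\<iota> (p - q)) = 0" using linear_\<iota> by (simp add: linear_diff)
  then show "p = q" by (simp add: norm_\<iota>)
qed

text \<open>The inverse of \<open>\<iota>\<close>, extended by orthogonal projection so that it is
  continuous on the whole group.\<close>

definition \<kappa> :: "'n heis \<Rightarrow> (real ^ 'm) \<times> real" where
  "\<kappa> x = ((\<chi> i. fst x \<bullet> fst (w i)), snd x)"

lemma \<kappa>_\<iota> [simp]: "\<kappa> (\<iota> p) = p"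
proof (rule prod_eqI)
  have "hz (fst p) \<bullet> fst (w i) = fst p $ i" for i
    using inner_hz[of "fst p" "axis i 1"] by (simp add: inner_axis)
  then show "fst (\<kappa> (\<iota> p)) = fst p" by (simp add: \<kappa>_def vec_eq_iff)
qed (simp add: \<kappa>_def)

lemma \<iota>_\<kappa>: "x \<in> W \<Longrightarrow> \<iota> (\<kappa> x) = x"
  using range_\<iota> by (metis \<kappa>_\<iota> imageE)

lemma continuous_on_\<kappa> [continuous_intros]: "continuous_on A f \<Longrightarrow> continuous_on A (\<lambda>x. \<kappa> (f x))"
  unfolding \<kappa>_def by (intro continuous_intros)

lemma dil_\<iota>: "dil r (\<iota> p) = \<iota> (r *\<^sub>R fst p, r\<^sup>2 * snd p)"
  by (rule prod_eqI) simp_all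

text \<open>The translation \<open>\<sigma>\<^sub>x\<close> for \<open>x = u \<odot> a\<close>, with \<open>u \<in> W\<close> and \<open>a \<in> V\<close>.\<close>

definition tr :: "'n heis \<Rightarrow> 'n heis \<Rightarrow> 'n heis \<Rightarrow> 'n heis" where
  "tr u a z = u \<odot> a \<odot> z \<odot> hinv a"

text \<open>In these coordinates the translation is a Euclidean translation composed with a vertical
  shear, hence preserves Lebesgue measure.\<close>

lemma tr_\<iota>:
  "tr (\<iota> p0) a (\<iota> p) = \<iota> (fst p0 + fst p,
     snd p0 + snd p + symp (fst a) (hz (fst p)) + symp (hz (fst p0)) (hz (fst p)) / 2)"
  by (rule prod_eqI)
    (simp_all add: tr_def symp_commute[of _ "fst a"] field_simps)

lemma tr_in_W: "u \<in> W \<Longrightarrow> z \<in> W \<Longrightarrow> tr u a z \<in> W"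
  by (metis \<iota>_\<kappa> \<iota>_in_W tr_\<iota>)

lemma continuous_on_tr [continuous_intros]:
  "continuous_on A f \<Longrightarrow> continuous_on A (\<lambda>x. tr u a (f x))"
  unfolding tr_def by (intro continuous_intros)

lemma sigma_tr_eq: "u \<in> W \<Longrightarrow> a \<in> V \<Longrightarrow> sigma_tr W V (u \<odot> a) z = tr u a z"
  by (simp add: sigma_tr_def tr_def)

text \<open>Puts the inverse into the order W times V, from which \<open>projV\<close> is read off;
  the first factor is in W because W is normal.\<close>

lemma hinv_hmul_split: "hinv (u \<odot> a) = (hinv a \<odot> hinv u \<odot> a) \<odot> hinv a"
  by (simp add: hinv_hmul hmul_assoc)

lemma conj_in_W: "u \<in> W \<Longrightarrow> hinv a \<odot> u \<odot> a \<in> W"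
  using tr_in_W[of 0 u "hinv a"] W_group by (simp add: tr_def)

lemma projV_hinv: "u \<in> W \<Longrightarrow> a \<in> V \<Longrightarrow> projV W V (hinv (u \<odot> a)) = hinv a"
  unfolding hinv_hmul_split by (intro projV_hmul conj_in_W W_group V_group)

lemma sigma_tr_hinv: "u \<in> W \<Longrightarrow> a \<in> V \<Longrightarrow> sigma_tr W V (hinv (u \<odot> a)) z = hinv (u \<odot> a) \<odot> z \<odot> a"
  by (simp add: sigma_tr_def projV_hinv)

lemma tr_inverse [simp]: "hinv (u \<odot> a) \<odot> tr u a z \<odot> a = z"
  by (simp add: tr_def hmul_assoc hinv_hmul)

lemma tr_inverse': "tr u a (hinv (u \<odot> a) \<odot> z \<odot> a) = z"
  by (simp add: tr_def hmul_assoc hinv_hmul)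

lemma inverse_in_W: "u \<in> W \<Longrightarrow> z \<in> W \<Longrightarrow> hinv (u \<odot> a) \<odot> z \<odot> a \<in> W"
proof -
  assume "u \<in> W" "z \<in> W"
  then have "hinv a \<odot> (hinv u \<odot> z) \<odot> a \<in> W" by (intro conj_in_W W_group)
  then show ?thesis by (simp add: hinv_hmul hmul_assoc)
qed

text \<open>By dilation it suffices to bound N(a b) from below when N a = 1. For N b \<le> 2 this is
  compactness together with W and V meeting only in 0; for N b > 2 the triangle inequality gives
  more than 1.\<close>

lemma proj_bound: obtains C where "C > 0" "\<And>a b. a \<in> W \<Longrightarrow> b \<in> V \<Longrightarrow> N a \<le> C * N (a \<odot> b)"
proof -
  define K where "K = (W \<inter> {a. N a = 1}) \<times> (V \<inter> {b. N b \<le> 2})"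
  have "{a. N a = 1} = {a. N a \<le> 1} \<inter> {a. 1 \<le> N a}" by auto
  moreover have "closed {a. 1 \<le> N a}" by (intro closed_Collect_le continuous_intros)
  ultimately have "compact {a. N a = 1}" using compact_N compact_Int_closed by metis
  then have cK: "compact K"
    unfolding K_def using W_group V_group compact_N
    by (intro compact_Times) (auto simp: closed_Int_compact)
  obtain c where c: "c > 0" "\<And>a b. a \<in> W \<Longrightarrow> N a = 1 \<Longrightarrow> b \<in> V \<Longrightarrow> c \<le> N (a \<odot> b)"
  proof (cases "K = {}")
    case True
    have "False" if "a \<in> W" "N a = 1" for a
    proof -
      have "(a, 0) \<in> K" using that V_group by (auto simp: K_def)
      then show False using True by blast
    qed
    then show ?thesis using that[of 1] by auto
  next
    case False
    have "continuous_on K (\<lambda>z. N (fst z \<odot> snd z))" by (intro continuous_intros)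
    then obtain z where z: "z \<in> K" "\<And>y. y \<in> K \<Longrightarrow> N (fst z \<odot> snd z) \<le> N (fst y \<odot> snd y)"
      using continuous_attains_inf[OF cK False] by blast
    have "fst z \<odot> snd z \<noteq> 0"
    proof
      assume "fst z \<odot> snd z = 0"
      then have "fst z \<odot> snd z = 0 \<odot> 0" by simp
      then have "fst z = 0" using WV_unique[of "fst z" "snd z" 0 0] z(1) W_group V_group by (auto simp: K_def)
      then show False using z(1) by (auto simp: K_def)
    qed
    then have pos: "0 < N (fst z \<odot> snd z)" by simp
    have "min (N (fst z \<odot> snd z)) 1 \<le> N (a \<odot> b)" if ab: "a \<in> W" "N a = 1" "b \<in> V" for a b
    proof (cases "N b \<le> 2")
      case True
      then have "(a, b) \<in> K" using ab by (auto simp: K_def)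
      then show ?thesis using z(2)[of "(a, b)"] by simp
    next
      case False
      have "N b \<le> N (hinv a) + N (a \<odot> b)" using N_hmul[of "hinv a" "a \<odot> b"] by simp
      then show ?thesis using False ab by simp
    qed
    then show ?thesis using that[of "min (N (fst z \<odot> snd z)) 1"] pos by auto
  qed
  have "N a \<le> (1 / c) * N (a \<odot> b)" if ab: "a \<in> W" "b \<in> V" for a b
  proof (cases "a = 0")
    case False
    then have p: "1 / N a > 0" by simp
    have "c \<le> N (dil (1 / N a) a \<odot> dil (1 / N a) b)"
      using ab p False by (intro c(2) W_group(5) V_group(5)) (auto simp: N_dil)
    also have "\<dots> = N (a \<odot> b) / N a" using N_dil[OF p, of "a \<odot> b"] by (simp add: dil_hmul)
    finally show ?thesis using p c(1) by (simp add: field_simps)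
  qed (use c in simp)
  then show ?thesis using that[of "1 / c"] c(1) by simp
qed

text \<open>The product a b differs from a + b by a vertical vector, which belongs to W, so the
  group factorization is also a direct sum of linear subspaces.\<close>

lemma dim_W: "DIM((real ^ 'm) \<times> real) + dim V = 2 * CARD('n) + 1"
proof -
  have sV: "subspace V"
  proof (rule subspaceI)
    show "0 \<in> V" by (rule V_group)
    show "x + y \<in> V" if "x \<in> V" "y \<in> V" for x y using V_group(3) V_hmul that by metis
    show "c *\<^sub>R x \<in> V" if x: "x \<in> V" for c x
    proof -
      have p: "c *\<^sub>R x \<in> V" if "c > 0" "x \<in> V" for c x using V_group(5) V_dil that by metis
      consider "c > 0" | "c = 0" | "c < 0" by linarith
      then show ?thesis
      proof cases
        case 3
        have "(- c) *\<^sub>R hinv x \<in> V" using 3 x V_group(4) by (intro p) auto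
        then show ?thesis by (simp add: hinv_def)
      qed (use p x V_group in auto)
    qed
  qed
  have sW: "subspace W" unfolding range_\<iota>[symmetric] by (intro linear_subspace_image linear_\<iota>) simp
  have "{x + y |x y. x \<in> W \<and> y \<in> V} = UNIV"
  proof (intro equalityI subset_UNIV subsetI)
    fix x
    obtain a b where ab: "a \<in> W" "b \<in> V" "x = a \<odot> b" by (rule WV_cases)
    have "x = (a + \<iota> (0, symp (fst a) (fst b) / 2)) + b"
      unfolding ab(3) by (rule prod_eqI) simp_all
    moreover have "a + \<iota> (0, symp (fst a) (fst b) / 2) \<in> W"
      using sW ab by (intro subspace_add) auto
    ultimately show "x \<in> {x + y |x y. x \<in> W \<and> y \<in> V}" using ab by blast
  qed
  then have "dim (UNIV :: 'n heis set) + dim {0 :: 'n heis} = dim W + dim V"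
    using dim_sums_Int[OF sW sV] WV by simp
  moreover have "dim W = DIM((real ^ 'm) \<times> real)"
    unfolding range_\<iota>[symmetric] using dim_image_eq[OF linear_\<iota>, of UNIV] inj_\<iota> by (simp add: inj_on_subset)
  ultimately show ?thesis by simp
qed

section \<open>Homogeneous homomorphisms from W to V are linear\<close>

lemma hom_props:
  assumes L: "h_hom_sub W V L"
  shows hom_in_V: "x \<in> W \<Longrightarrow> L x \<in> V" and hom_dil: "t > 0 \<Longrightarrow> x \<in> W \<Longrightarrow> L (dil t x) = dil t (L x)"
    and hom_hmul: "x \<in> W \<Longrightarrow> y \<in> W \<Longrightarrow> L (x \<odot> y) = L x + L y"
  using L V_hmul unfolding h_hom_sub_def by (auto simp: image_subset_iff)

text \<open>Squaring (0, t) equals dilating it by sqrt 2, so its image a satisfies 2 a = sqrt 2 a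
  and vanishes. What remains is a map of the horizontal coordinates, on which products act as sums
  and dilations as scalars.\<close>

lemma hom_linear:
  assumes L: "h_hom_sub W V L"
  shows "linear (\<lambda>y. L (\<iota> (y, 0)))" and "L (\<iota> p) = L (\<iota> (fst p, 0))"
proof -
  note hmul = hom_hmul[OF L] and dl = hom_dil[OF L]
  have vert: "L (\<iota> (0, t)) = 0" for t
  proof -
    have "\<iota> (0, t) \<odot> \<iota> (0, t) = dil (sqrt 2) (\<iota> (0, t))" by (rule prod_eqI) simp_all
    then have "L (\<iota> (0, t)) + L (\<iota> (0, t)) = sqrt 2 *\<^sub>R L (\<iota> (0, t))"
      using hmul[of "\<iota> (0, t)" "\<iota> (0, t)"] dl[of "sqrt 2" "\<iota> (0, t)"] V_dil[OF hom_in_V[OF L]] by simp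
    then have "(2 - sqrt 2) *\<^sub>R L (\<iota> (0, t)) = 0" by (simp add: scaleR_diff_left scaleR_2)
    then show ?thesis using sqrt_2_neq_2 by auto
  qed
  have split: "L (\<iota> (y, t)) = L (\<iota> (y, 0))" for y t
  proof -
    have "\<iota> (y, t) = \<iota> (y, 0) \<odot> \<iota> (0, t)" by (rule prod_eqI) simp_all
    then show ?thesis using hmul[of "\<iota> (y, 0)" "\<iota> (0, t)"] vert by simp
  qed
  show "L (\<iota> p) = L (\<iota> (fst p, 0))" using split[of "fst p" "snd p"] by simp
  have add: "L (\<iota> (x + y, 0)) = L (\<iota> (x, 0)) + L (\<iota> (y, 0))" for x y
  proof -
    have "\<iota> (x, 0) \<odot> \<iota> (y, 0) = \<iota> (x + y, symp (hz x) (hz y) / 2)" by (rule prod_eqI) simp_all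
    then show ?thesis using hmul[of "\<iota> (x, 0)" "\<iota> (y, 0)"]
        split[of "x + y" "symp (hz x) (hz y) / 2"] by simp
  qed
  have pos: "L (\<iota> (c *\<^sub>R x, 0)) = c *\<^sub>R L (\<iota> (x, 0))" if "c > 0" for c x
    using dl[OF that, of "\<iota> (x, 0)"] V_dil[OF hom_in_V[OF L]] by (simp add: dil_\<iota>)
  have neg: "L (\<iota> (- x, 0)) = - L (\<iota> (x, 0))" for x
    using add[of x "-x"] vert[of 0] by (simp add: eq_neg_iff_add_eq_0 add.commute)
  show "linear (\<lambda>y. L (\<iota> (y, 0)))"
  proof (rule linearI)
    show "L (\<iota> (c *\<^sub>R x, 0)) = c *\<^sub>R L (\<iota> (x, 0))" for c x
    proof -
      consider "c > 0" | "c = 0" | "c < 0" by linarith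
      then show ?thesis
      proof cases
        case 3
        then have "L (\<iota> ((- c) *\<^sub>R (- x), 0)) = (- c) *\<^sub>R L (\<iota> (- x, 0))" by (intro pos) auto
        then show ?thesis by (simp add: neg)
      qed (use pos vert in auto)
    qed
  qed (rule add)
qed

lemma continuous_on_hom: "h_hom_sub W V L \<Longrightarrow> continuous_on W L"
proof -
  assume L: "h_hom_sub W V L"
  have "continuous_on UNIV (\<lambda>y. L (\<iota> (y, 0)))"
    using hom_linear(1)[OF L] by (simp add: linear_conv_bounded_linear linear_continuous_on)
  then have "continuous_on W (\<lambda>x. L (\<iota> (fst (\<kappa> x), 0)))"
    by (rule continuous_on_compose2) (auto intro!: continuous_intros)
  moreover have "L (\<iota> (fst (\<kappa> x), 0)) = L x" if "x \<in> W" for x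
    using hom_linear(2)[OF L, of "\<kappa> x"] \<iota>_\<kappa>[OF that] by simp
  ultimately show ?thesis by (metis (no_types, lifting) continuous_on_cong)
qed

lemma continuous_on_hom_\<iota>: "h_hom_sub W V L \<Longrightarrow> continuous_on A (\<lambda>p. L (\<iota> p))"
  by (rule continuous_on_compose2[OF continuous_on_hom]) (auto intro!: continuous_intros)

end

section \<open>Tangent groups and graph measures\<close>

context factorization begin

definition tangent :: "('n heis \<Rightarrow> 'n heis) \<Rightarrow> (real ^ 'm) \<times> real \<Rightarrow> 'n heis" where
  "tangent L p = \<iota> p \<odot> L (\<iota> p)"

text \<open>The area of the tangent group inside the unit ball, measured in the parameter space of
  W, where the surface measure is an integral too.\<close>

definition ball_area :: "('n heis \<Rightarrow> 'n heis) \<Rightarrow> real" where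
  "ball_area L = measure lborel {p. N (tangent L p) \<le> 1}"

lemma continuous_on_tangent:
  assumes "h_hom_sub W V L" shows "continuous_on A (tangent L)"
proof -
  have "tangent L = (\<lambda>p. \<iota> p \<odot> L (\<iota> p))" by (simp add: fun_eq_iff tangent_def)
  then show ?thesis
    by (simp only:) (intro continuous_on_hmul continuous_on_hom_\<iota> continuous_on_\<iota> assms continuous_on_id)
qed

lemma closed_tangent_le: "h_hom_sub W V L \<Longrightarrow> closed {p. d z (tangent L p) \<le> s}"
  by (intro closed_Collect_le continuous_intros continuous_on_tangent)

lemma closed_tangent_N: "h_hom_sub W V L \<Longrightarrow> closed {p. N (tangent L p) \<le> s}"
  by (intro closed_Collect_le continuous_intros continuous_on_tangent)

lemma tangent_dil:
  assumes "h_hom_sub W V L" "r > 0"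
  shows "tangent L (r *\<^sub>R fst p, r\<^sup>2 * snd p) = dil r (tangent L p)"
  using hom_dil[OF assms(1,2), of "\<iota> p"] by (simp add: tangent_def dil_hmul flip: dil_\<iota>)

lemma tangent_N_lower:
  assumes "\<And>a b. a \<in> W \<Longrightarrow> b \<in> V \<Longrightarrow> N a \<le> C * N (a \<odot> b)" "h_hom_sub W V L"
  shows "N (\<iota> p) \<le> C * N (tangent L p)"
  unfolding tangent_def using assms hom_in_V by auto

text \<open>Finite because \<open>proj_bound\<close> confines the parameters to a compact set,
  positive because they contain a Euclidean ball about 0. Positivity will allow dividing by
  it.\<close>

lemma ball_area:
  assumes L: "h_hom_sub W V L"
  shows "emeasure lborel {p. N (tangent L p) \<le> 1} = ennreal (ball_area L)" and "ball_area L > 0"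
proof -
  obtain C where C: "C > 0" "\<And>a b. a \<in> W \<Longrightarrow> b \<in> V \<Longrightarrow> N a \<le> C * N (a \<odot> b)" by (rule proj_bound) (rule that)
  let ?S = "{p. N (tangent L p) \<le> 1}"
  have "?S \<subseteq> \<kappa> ` {x. N x \<le> C}"
  proof
    fix p assume "p \<in> ?S"
    then have "N (\<iota> p) \<le> C"
      using tangent_N_lower[OF C(2) L, of p] C(1) by (simp add: mult_left_le order_trans[of _ "C * _" C])
    then show "p \<in> \<kappa> ` {x. N x \<le> C}" by (intro image_eqI[of _ _ "\<iota> p"]) auto
  qed
  moreover have "compact (\<kappa> ` {x. N x \<le> C})"
    by (intro compact_continuous_image compact_N continuous_intros)
  ultimately have bnd: "bounded ?S" using compact_imp_bounded bounded_subset by blast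
  then have fin: "emeasure lborel ?S < \<infinity>" by (rule emeasure_bounded_finite)
  then show eq: "emeasure lborel ?S = ennreal (ball_area L)"
    unfolding ball_area_def by (intro emeasure_eq_ennreal_measure) auto
  let ?O = "{p. N (tangent L p) < 1}"
  have "open ?O" by (intro open_Collect_less continuous_intros continuous_on_tangent L)
  moreover have "0 \<in> ?O"
  proof -
    have "\<iota> 0 = 0" using linear_\<iota> by (rule linear_0)
    moreover have "L 0 = 0" using hom_linear[OF L] linear_0[OF hom_linear(1)[OF L]] \<open>\<iota> 0 = 0\<close> by (simp add: zero_prod_def)
    ultimately show ?thesis by (simp add: tangent_def)
  qed
  ultimately obtain e where e: "e > 0" "ball 0 e \<subseteq> ?O" using openE by blast
  have "0 < emeasure lborel (ball (0 :: (real ^ 'm) \<times> real) e)"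
    using e(1) by (simp add: emeasure_ball)
  also have "\<dots> \<le> emeasure lborel ?S"
    using e(2) closed_tangent_N[OF L] by (intro emeasure_mono) auto
  finally show "ball_area L > 0" unfolding eq by simp
qed

lemma emeasure_tangent_scale:
  assumes L: "h_hom_sub W V L" and s: "s > 0"
  shows "emeasure lborel {p. N (tangent L p) \<le> s} = ennreal (s ^ (CARD('m) + 2) * ball_area L)"
proof -
  have m[measurable]: "{p. N (tangent L p) \<le> s} \<in> sets borel" for s using closed_tangent_N[OF L] by auto
  have "emeasure lborel {p. N (tangent L p) \<le> s} = (\<integral>\<^sup>+ p. indicator {p. N (tangent L p) \<le> s} p \<partial>lborel)"
    by simp
  also have "\<dots> = ennreal (s ^ (CARD('m) + 2)) * (\<integral>\<^sup>+ p. indicator {p. N (tangent L p) \<le> s} (0 + s *\<^sub>R fst p, 0 + s\<^sup>2 * snd p) \<partial>lborel)"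
    using s by (subst nn_integral_lborel_shear[where a = 0 and g = "\<lambda>_. 0" and r = s]) simp_all
  also have "(\<lambda>p. indicator {p. N (tangent L p) \<le> s} (0 + s *\<^sub>R fst p, 0 + s\<^sup>2 * snd p)) = (indicator {p. N (tangent L p) \<le> 1} :: _ \<Rightarrow> ennreal)"
    using s by (auto simp: fun_eq_iff indicator_def tangent_dil[OF L])
  finally show ?thesis
    using s ball_area[OF L] by (simp add: ennreal_mult)
qed

text \<open>
  Up to a shear and a dilation, the left side is a section of the unit ball parallel to the one
  defining \<^term>\<open>ball_area L\<close>; of all parallel sections of a symmetric convex body, the central
  one is the largest.
\<close>

lemma emeasure_tangent_ball:
  assumes L: "h_hom_sub W V L" and s: "s > 0"
  shows "emeasure lborel {p. d z (tangent L p) \<le> s} \<le> ennreal (s ^ (CARD('m) + 2) * ball_area L)"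
proof -
  \<comment> \<open>\<open>A\<close> is the linear horizontal part of the tangent group, and
    \<open>\<gamma>\<close> the vertical displacement produced by the group product; the
    parametrization thus differs from a linear one only by a shear.\<close>
  define A where "A y = hz y + fst (L (\<iota> (y, 0)))" for y
  define \<gamma> where "\<gamma> y = symp (hz y) (fst (L (\<iota> (y, 0)))) / 2" for y
  have lL: "linear (\<lambda>y. L (\<iota> (y, 0)))" by (rule hom_linear(1)[OF L])
  have cL: "continuous_on UNIV (\<lambda>y. L (\<iota> (y, 0)))"
    using lL by (simp add: linear_conv_bounded_linear linear_continuous_on)
  have linA: "linear A"
    unfolding A_def using lL by (intro linearI) (simp_all add: linear_add[of "\<lambda>y. L (\<iota> (y, 0))"] linear_scale[of "\<lambda>y. L (\<iota> (y, 0))"] scaleR_add_right)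
  have cA: "continuous_on S A" for S
    using linA by (simp add: linear_conv_bounded_linear linear_continuous_on)
  have c\<gamma>: "continuous_on UNIV \<gamma>" unfolding \<gamma>_def by (intro continuous_intros cL) auto
  have T: "tangent L p = (A (fst p), snd p + \<gamma> (fst p))" for p
    using V_horizontal[OF hom_in_V[OF L], of "\<iota> (fst p, 0)"] hom_linear(2)[OF L, of p]
    by (intro prod_eqI) (simp_all add: tangent_def A_def \<gamma>_def)
  define X where "X a = {p. N (A (fst p) - a, snd p) \<le> 1}" for a
  have X: "X a \<in> sets borel" for a
  proof -
    have "closed (X a)" unfolding X_def
      by (intro closed_Collect_le continuous_intros continuous_on_compose2[OF cA]) auto
    then show ?thesis by simp
  qed
  have shear: "emeasure lborel {p. d z (tangent L p) \<le> s} = ennreal (s ^ (CARD('m) + 2)) * emeasure lborel (X ((1 / s) *\<^sub>R fst z))"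
    if s: "s > 0" for s z
  proof -
    \<comment> \<open>The fibre translation that cancels the vertical part of z, the symplectic term
      of the left translation and \<open>\<gamma>\<close>. What is left of z is a horizontal
      Euclidean shift by its rescaled horizontal part.\<close>
    define g where "g y = snd z + symp (fst z) (s *\<^sub>R A y) / 2 - \<gamma> (s *\<^sub>R y)" for y
    have "continuous_on UNIV g"
      unfolding g_def by (intro continuous_intros cA continuous_on_compose2[OF c\<gamma>]) auto
    then have g: "g \<in> borel_measurable borel" by (rule borel_measurable_continuous_onI)
    have m: "{p. d z (tangent L p) \<le> s} \<in> sets borel" using closed_tangent_le[OF L] by auto
    have "hinv z \<odot> tangent L (0 + s *\<^sub>R fst p, g (fst p) + s\<^sup>2 * snd p)
        = dil s (A (fst p) - (1 / s) *\<^sub>R fst z, snd p)" for p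
      unfolding T using s linA
      by (intro prod_eqI) (simp_all add: linear_scale scaleR_diff_right g_def)
    then have "d z (tangent L (0 + s *\<^sub>R fst p, g (fst p) + s\<^sup>2 * snd p)) = s * N (A (fst p) - (1 / s) *\<^sub>R fst z, snd p)" for p
      using s by (simp add: d_eq_N[of z])
    then have iff: "d z (tangent L (0 + s *\<^sub>R fst p, g (fst p) + s\<^sup>2 * snd p)) \<le> s \<longleftrightarrow> p \<in> X ((1 / s) *\<^sub>R fst z)" for p
      using s by (simp add: X_def)
    have "emeasure lborel {p. d z (tangent L p) \<le> s} = (\<integral>\<^sup>+ p. indicator {p. d z (tangent L p) \<le> s} p \<partial>lborel)"
      using m by simp
    also have "\<dots> = ennreal (s ^ (CARD('m) + 2)) * (\<integral>\<^sup>+ p. indicator {p. d z (tangent L p) \<le> s} (0 + s *\<^sub>R fst p, g (fst p) + s\<^sup>2 * snd p) \<partial>lborel)"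
      using s m g by (subst nn_integral_lborel_shear[where a = 0 and g = g and r = s]) simp_all
    also have "(\<lambda>p. indicator {p. d z (tangent L p) \<le> s} (0 + s *\<^sub>R fst p, g (fst p) + s\<^sup>2 * snd p)) = (indicator (X ((1 / s) *\<^sub>R fst z)) :: _ \<Rightarrow> ennreal)"
      by (rule ext) (simp only: indicator_def mem_Collect_eq iff)
    finally show ?thesis using X by simp
  qed
  \<comment> \<open>For p, q in \<open>X a\<close> the shift by a cancels in the half difference,
    and the midpoint of a ball point and the inverse of another stays in the ball by symmetry and
    convexity.\<close>
  have central: "emeasure lborel (X a) \<le> emeasure lborel (X 0)" for a
  proof (rule emeasure_symmetrized_ge[OF X X])
    fix p q assume pq: "p \<in> X a" "q \<in> X a"
    let ?p = "(A (fst p) - a, snd p)" and ?q = "(A (fst q) - a, snd q)"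
    have "hinv ?q \<in> hball d 0 1" "?p \<in> hball d 0 1"
      using pq by (simp_all add: X_def mem_hball d_eq_N)
    then have "(1/2) *\<^sub>R ?p + (1/2) *\<^sub>R hinv ?q \<in> hball d 0 1"
      using convex_ball by (intro convexD) auto
    moreover have "(1/2) *\<^sub>R ?p + (1/2) *\<^sub>R hinv ?q = (A (fst ((1/2) *\<^sub>R (p - q))) - 0, snd ((1/2) *\<^sub>R (p - q)))"
      using linA by (simp add: hinv_def linear_scale linear_diff scaleR_diff_right algebra_simps)
    ultimately show "(1/2) *\<^sub>R (p - q) \<in> X 0"
      unfolding X_def mem_hball d_eq_N[of 0] by simp
  qed
  have "ennreal (ball_area L) = emeasure lborel {p. d 0 (tangent L p) \<le> 1}"
    by (simp add: ball_area[OF L] d_eq_N)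
  also have "\<dots> = emeasure lborel (X 0)" by (subst shear) (simp_all add: zero_prod_def)
  finally have X0: "emeasure lborel (X 0) = ennreal (ball_area L)" by simp
  have "emeasure lborel {p. d z (tangent L p) \<le> s} \<le> ennreal (s ^ (CARD('m) + 2)) * emeasure lborel (X 0)"
    unfolding shear[OF s] by (intro mult_left_mono central) simp
  also have "\<dots> = ennreal (s ^ (CARD('m) + 2) * ball_area L)"
    using s by (simp add: X0 ennreal_mult')
  finally show ?thesis .
qed

text \<open>Rescales a ball about y, seen from x, to unit size; the new centre is the z of
  \<open>emeasure_tangent_ball\<close>.\<close>

lemma dist_dil_tangent: "r > 0 \<Longrightarrow> d y (x \<odot> dil r g) = r * d (dil (1 / r) (hinv x \<odot> y)) g"
proof -
  assume r: "r > 0"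
  have "d y (x \<odot> dil r g) = d (x \<odot> (hinv x \<odot> y)) (x \<odot> dil r g)" by simp
  also have "\<dots> = d (hinv x \<odot> y) (dil r g)" by (rule d_left)
  also have "\<dots> = d (dil r (dil (1 / r) (hinv x \<odot> y))) (dil r g)" using r by simp
  also have "\<dots> = r * d (dil (1 / r) (hinv x \<odot> y)) g" using r by (rule d_dil)
  finally show ?thesis .
qed

lemma nn_integral_tr:
  assumes F: "(\<lambda>p. F (\<iota> p)) \<in> borel_measurable borel" and u: "u \<in> W" and r: "r > 0"
  shows "(\<integral>\<^sup>+ p. F (\<iota> p) \<partial>lborel) = ennreal (r ^ (CARD('m) + 2)) * (\<integral>\<^sup>+ p. F (tr u a (dil r (\<iota> p))) \<partial>lborel)"
proof -
  define p0 where "p0 = \<kappa> u"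
  have u0: "u = \<iota> p0" using u by (simp add: p0_def \<iota>_\<kappa>)
  define g where "g y = snd p0 + symp (fst a) (hz (r *\<^sub>R y)) + symp (hz (fst p0)) (hz (r *\<^sub>R y)) / 2" for y
  have "continuous_on UNIV g" unfolding g_def by (intro continuous_intros) auto
  then have g: "g \<in> borel_measurable borel" by (rule borel_measurable_continuous_onI)
  have "tr u a (dil r (\<iota> p)) = \<iota> (fst p0 + r *\<^sub>R fst p, g (fst p) + r\<^sup>2 * snd p)" for p
    unfolding u0 dil_\<iota> tr_\<iota> by (simp add: g_def algebra_simps)
  then show ?thesis
    using nn_integral_lborel_shear[OF F g r, of "fst p0"] by simp
qed

lemma tr_near:
  assumes "open D" "u \<in> D"
  obtains \<delta> where "\<delta> > 0" "\<And>z. N z < \<delta> \<Longrightarrow> tr u a z \<in> D"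
proof -
  have "open ((\<lambda>z. tr u a z) -` D)"
    using assms by (intro open_vimage continuous_intros)
  moreover have "0 \<in> (\<lambda>z. tr u a z) -` D" using assms by (simp add: tr_def hmul_assoc)
  ultimately obtain e where "e > 0" "\<And>p. d 0 p < e \<Longrightarrow> p \<in> (\<lambda>z. tr u a z) -` D"
    by (rule open_contains_N) (rule that)
  then show ?thesis using that[of e] by (simp add: d_eq_N)
qed

end

locale intrinsic_graph = factorization d W V w
  for d :: "'n::finite heis \<Rightarrow> 'n heis \<Rightarrow> real" and W V and w :: "'m::finite \<Rightarrow> 'n heis" +
  fixes U :: "'n heis set" and \<phi> :: "'n heis \<Rightarrow> 'n heis"
  assumes U_open: "openin (top_of_set W) U" and \<phi>_V: "\<phi> ` U \<subseteq> V"
    and unif: "unif_intrinsic_differentiable d W V U \<phi>"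
begin

abbreviation \<Phi> :: "'n heis \<Rightarrow> 'n heis" where "\<Phi> \<equiv> graph_map \<phi>"

text \<open>\<^term>\<open>rel u0 u\<close> is \<open>\<sigma>\<^sub>x(u)\<close> for \<open>x = \<Phi>(u0)\<^sup>-\<^sup>1\<close>, so that \<open>\<phi>\<^sub>x\<close> maps it to \<open>\<phi>(u0)\<^sup>-\<^sup>1\<phi>(u)\<close>.\<close>

definition rel :: "'n heis \<Rightarrow> 'n heis \<Rightarrow> 'n heis" where
  "rel u0 u = hinv (\<Phi> u0) \<odot> u \<odot> \<phi> u0"

lemma U_W: "u \<in> U \<Longrightarrow> u \<in> W"
  using U_open openin_subset by fastforce

lemma \<phi>_in_V: "u \<in> U \<Longrightarrow> \<phi> u \<in> V"
  using \<phi>_V by auto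

lemma rel_in_W: "u0 \<in> W \<Longrightarrow> u \<in> W \<Longrightarrow> rel u0 u \<in> W"
  unfolding rel_def graph_map_def by (rule inverse_in_W)

lemma tr_rel [simp]: "tr u0 (\<phi> u0) (rel u0 u) = u"
  unfolding rel_def graph_map_def by (rule tr_inverse')

lemma rel_tr [simp]: "rel u0 (tr u0 (\<phi> u0) z) = z"
  unfolding rel_def graph_map_def by (rule tr_inverse)

lemma graph_tr: "\<Phi> (tr u0 (\<phi> u0) z) = \<Phi> u0 \<odot> (z \<odot> (hinv (\<phi> u0) \<odot> \<phi> (tr u0 (\<phi> u0) z)))"
  by (simp add: graph_map_def tr_def hmul_assoc)

text \<open>Uniform intrinsic differentiability with the suprema unfolded: the differential is fixed
  at \<open>ub\<close>, while the base point \<open>u0\<close> of the increments moves near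
  \<open>ub\<close>.\<close>

definition udiff :: "'n heis \<Rightarrow> ('n heis \<Rightarrow> 'n heis) \<Rightarrow> bool" where
  "udiff ub L \<longleftrightarrow> h_hom_sub W V L \<and> (\<forall>\<epsilon>>0. \<exists>\<delta>>0. \<forall>u0\<in>U. N (hinv ub \<odot> u0) < \<delta> \<longrightarrow>
     (\<forall>u\<in>U. N (rel u0 u) < \<delta> \<longrightarrow> d (L (rel u0 u)) (hinv (\<phi> u0) \<odot> \<phi> u) \<le> \<epsilon> * N (rel u0 u)))"

definition der :: "'n heis \<Rightarrow> 'n heis \<Rightarrow> 'n heis" where
  "der ub = (SOME L. udiff ub L)"

lemma udiff_der:
  assumes ub: "ub \<in> U"
  shows "udiff ub (der ub)"
  unfolding der_def
proof (rule someI_ex[of "udiff ub"])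
  obtain L where L: "h_hom_sub W V L" and lim: "((\<lambda>\<delta>. SUP w' \<in> {w'\<in>U. N (hinv ub \<odot> w') < \<delta>}.
               SUP w \<in> {w \<in> sigma_tr W V (hinv (\<Phi> w')) ` U. 0 < N w \<and> N w < \<delta>}.
                 ennreal (d (L w) (phi_tr W V \<phi> (hinv (\<Phi> w')) w) / N w))
          \<longlongrightarrow> 0) (at_right 0)"
    using unif ub unfolding unif_intrinsic_differentiable_def by blast
  have L0: "L 0 = 0"
    using hom_hmul[OF L, of 0 0] W_group by simp
  have "\<exists>\<delta>>0. \<forall>u0\<in>U. N (hinv ub \<odot> u0) < \<delta> \<longrightarrow>
     (\<forall>u\<in>U. N (rel u0 u) < \<delta> \<longrightarrow> d (L (rel u0 u)) (hinv (\<phi> u0) \<odot> \<phi> u) \<le> \<epsilon> * N (rel u0 u))" if \<epsilon>: "\<epsilon> > 0" for \<epsilon>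
  proof -
    let ?I = "\<lambda>\<delta> w'. SUP w \<in> {w \<in> sigma_tr W V (hinv (\<Phi> w')) ` U. 0 < N w \<and> N w < \<delta>}.
      ennreal (d (L w) (phi_tr W V \<phi> (hinv (\<Phi> w')) w) / N w)"
    let ?E = "\<lambda>\<delta>. SUP w' \<in> {w'\<in>U. N (hinv ub \<odot> w') < \<delta>}. ?I \<delta> w'"
    have "\<forall>\<^sub>F \<delta> in at_right 0. ?E \<delta> < ennreal \<epsilon>"
      using \<epsilon> by (intro order_tendstoD(2)[OF lim]) simp
    then obtain b where b: "b > 0" "\<And>\<delta>. 0 < \<delta> \<Longrightarrow> \<delta> < b \<Longrightarrow> ?E \<delta> < ennreal \<epsilon>"
      unfolding eventually_at_right_field by auto
    show ?thesis
    proof (intro exI[of _ "b / 2"] conjI ballI impI)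
      fix u0 u assume u0: "u0 \<in> U" "N (hinv ub \<odot> u0) < b / 2" and u: "u \<in> U" "N (rel u0 u) < b / 2"
      note W = U_W[OF u0(1)] U_W[OF u(1)] and V = \<phi>_in_V[OF u0(1)]
      show "d (L (rel u0 u)) (hinv (\<phi> u0) \<odot> \<phi> u) \<le> \<epsilon> * N (rel u0 u)"
      \<comment> \<open>The suprema omit the increment 0; there u = u0 and both sides
        vanish.\<close>
      proof (cases "rel u0 u = 0")
        case True
        then have "tr u0 (\<phi> u0) 0 = u" using tr_rel[of u0 u] by simp
        then have "u = u0" by (simp add: tr_def hmul_assoc)
        then show ?thesis using True L0 by simp
      next
        case False
        have sig: "rel u0 u = sigma_tr W V (hinv (\<Phi> u0)) u"
          unfolding rel_def graph_map_def using sigma_tr_hinv[OF W(1) V] by simp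
        have "phi_tr W V \<phi> (hinv (\<Phi> u0)) (rel u0 u) = hinv (\<phi> u0) \<odot> \<phi> (tr u0 (\<phi> u0) (rel u0 u))"
          using W V unfolding phi_tr_def graph_map_def by (simp add: projV_hinv sigma_tr_eq)
        then have phi: "phi_tr W V \<phi> (hinv (\<Phi> u0)) (rel u0 u) = hinv (\<phi> u0) \<odot> \<phi> u" by simp
        have "ennreal (d (L (rel u0 u)) (phi_tr W V \<phi> (hinv (\<Phi> u0)) (rel u0 u)) / N (rel u0 u))
          \<le> ?I (b / 2) u0"
          using False u sig by (intro SUP_upper) auto
        also have "\<dots> \<le> ?E (b / 2)" using u0 by (intro SUP_upper[of u0]) auto
        also have "\<dots> < ennreal \<epsilon>" using b(1) by (intro b(2)) auto
        finally have "d (L (rel u0 u)) (hinv (\<phi> u0) \<odot> \<phi> u) / N (rel u0 u) < \<epsilon>"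
          unfolding phi using \<epsilon> by (simp add: ennreal_less_iff)
        moreover have "N (rel u0 u) > 0" using False by simp
        ultimately show ?thesis by (simp add: field_simps)
      qed
    qed (use b in simp)
  qed
  then show "\<exists>L. udiff ub L" unfolding udiff_def using L by blast
qed

lemma der_hom: "u \<in> U \<Longrightarrow> h_hom_sub W V (der u)"
  using udiff_der unfolding udiff_def by blast

lemma der_approx:
  assumes "u0 \<in> U" "\<epsilon> > 0"
  obtains \<delta> where "\<delta> > 0" "\<And>u. u \<in> U \<Longrightarrow> N (rel u0 u) < \<delta> \<Longrightarrow>
    d (der u0 (rel u0 u)) (hinv (\<phi> u0) \<odot> \<phi> u) \<le> \<epsilon> * N (rel u0 u)"
proof -
  obtain \<delta> where "\<delta> > 0" "\<forall>u1\<in>U. N (hinv u0 \<odot> u1) < \<delta> \<longrightarrow>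
     (\<forall>u\<in>U. N (rel u1 u) < \<delta> \<longrightarrow> d (der u0 (rel u1 u)) (hinv (\<phi> u1) \<odot> \<phi> u) \<le> \<epsilon> * N (rel u1 u))"
    using udiff_der[OF assms(1)] assms(2) unfolding udiff_def by blast
  then show ?thesis using assms(1) that[of \<delta>] by simp
qed

lemma open_\<iota>_U: "open {p. \<iota> p \<in> U}"
proof -
  obtain D where D: "open D" "U = W \<inter> D" using U_open by (auto simp: openin_open)
  then have "{p. \<iota> p \<in> U} = \<iota> -` D" by auto
  moreover have "open (\<iota> -` D)" using D by (intro open_vimage continuous_intros)
  ultimately show ?thesis by simp
qed

lemma rel_tendsto:
  assumes "u0 \<in> U"
  shows "(rel u0 \<longlongrightarrow> 0) (at u0 within S)"
proof -
  have "continuous_on UNIV (\<lambda>u. rel u0 u)" unfolding rel_def by (intro continuous_intros)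
  then have "((\<lambda>u. rel u0 u) \<longlongrightarrow> rel u0 u0) (at u0 within S)"
    by (metis UNIV_I continuous_on_def subset_UNIV tendsto_within_subset)
  moreover have "rel u0 u0 = 0" by (simp add: rel_def graph_map_def hinv_hmul hmul_assoc)
  ultimately show ?thesis by simp
qed

lemma continuous_on_\<phi>: "continuous_on U \<phi>"
  unfolding continuous_on_def
proof
  fix u0 assume u0: "u0 \<in> U"
  let ?F = "at u0 within U" and ?q = "\<lambda>u. hinv (\<phi> u0) \<odot> \<phi> u"
  have L: "h_hom_sub W V (der u0)" by (rule der_hom[OF u0])
  have inU: "\<forall>\<^sub>F u in ?F. u \<in> U" by (simp add: eventually_at_topological) (use open_UNIV in blast)
  have r: "(rel u0 \<longlongrightarrow> 0) ?F" by (rule rel_tendsto[OF u0])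
  then have Nr: "((\<lambda>u. N (rel u0 u)) \<longlongrightarrow> 0) ?F" by (simp add: tendsto_0_iff_N)
  have L0: "der u0 0 = 0" using hom_hmul[OF L, of 0 0] W_group by simp
  have "((\<lambda>u. der u0 (rel u0 u)) \<longlongrightarrow> der u0 0) ?F"
    using inU by (intro continuous_on_tendsto_compose[OF continuous_on_hom[OF L] r] W_group)
      (auto elim!: eventually_mono intro: rel_in_W U_W u0)
  then have NL: "((\<lambda>u. N (der u0 (rel u0 u))) \<longlongrightarrow> 0) ?F" unfolding L0 by (simp add: tendsto_0_iff_N)
  obtain \<delta> where \<delta>: "\<delta> > 0" "\<And>u. u \<in> U \<Longrightarrow> N (rel u0 u) < \<delta> \<Longrightarrow>
    d (der u0 (rel u0 u)) (?q u) \<le> 1 * N (rel u0 u)" by (rule der_approx[OF u0, of 1]) auto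
  have "\<forall>\<^sub>F u in ?F. N (rel u0 u) < \<delta>" using Nr \<delta>(1) by (intro order_tendstoD(2))
  with inU have ev: "\<forall>\<^sub>F u in ?F. norm (N (?q u)) \<le> N (der u0 (rel u0 u)) + N (rel u0 u)"
  proof eventually_elim
    fix u assume "u \<in> U" "N (rel u0 u) < \<delta>"
    then have "d (der u0 (rel u0 u)) (?q u) \<le> N (rel u0 u)" using \<delta>(2) by simp
    then show "norm (N (?q u)) \<le> N (der u0 (rel u0 u)) + N (rel u0 u)"
      using d_triangle[of "?q u" 0 "der u0 (rel u0 u)"] by (simp add: hnorm_def d_commute)
  qed
  have "((\<lambda>u. N (?q u)) \<longlongrightarrow> 0) ?F"
    by (rule Lim_null_comparison[OF ev]) (use tendsto_add[OF NL Nr] in simp)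
  then have "(?q \<longlongrightarrow> 0) ?F" by (simp add: tendsto_0_iff_N)
  moreover have "continuous_on UNIV (\<lambda>z. \<phi> u0 \<odot> z)" by (intro continuous_intros)
  ultimately have "((\<lambda>u. \<phi> u0 \<odot> ?q u) \<longlongrightarrow> \<phi> u0 \<odot> 0) ?F"
    by (intro continuous_on_tendsto_compose[where f = "\<lambda>z. \<phi> u0 \<odot> z" and s = UNIV]) auto
  then show "(\<phi> \<longlongrightarrow> \<phi> u0) ?F" by simp
qed

lemma continuous_on_\<Phi>: "continuous_on U \<Phi>"
proof -
  have "continuous_on U (\<lambda>u. u \<odot> \<phi> u)" by (intro continuous_intros continuous_on_\<phi>)
  then show ?thesis by (simp add: graph_map_def[abs_def])
qed

text \<open>A weighted Lebesgue measure on the parameters, pushed to the surface. The density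
  vanishes outside U, so the default value 0 of the map carries no mass.\<close>

definition graph_measure :: "('n heis \<Rightarrow> real) \<Rightarrow> 'n heis measure" where
  "graph_measure g = distr (density lborel (\<lambda>p. indicator {p. \<iota> p \<in> U} p * ennreal (g (\<iota> p)))) borel
     (\<lambda>p. if \<iota> p \<in> U then \<Phi> (\<iota> p) else 0)"

lemma sets_graph_measure [simp]: "sets (graph_measure g) = sets borel"
  by (simp add: graph_measure_def)

lemma measurable_on_U:
  fixes g :: "'n heis \<Rightarrow> 'z::real_normed_vector"
  assumes "continuous_on U g"
  shows "(\<lambda>p. if \<iota> p \<in> U then g (\<iota> p) else 0) \<in> borel_measurable borel"
proof -
  have "(\<lambda>p. if p \<in> {p. \<iota> p \<in> U} then g (\<iota> p) else 0) \<in> borel_measurable borel"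
    using open_\<iota>_U by (intro borel_measurable_continuous_on_if continuous_intros continuous_on_compose2[OF assms]) auto
  then show ?thesis by simp
qed

lemma measurable_graph_integrand:
  assumes g: "continuous_on U g" and B: "B \<in> sets borel"
  shows "(\<lambda>p. indicator {p. \<iota> p \<in> U \<and> \<Phi> (\<iota> p) \<in> B} p * ennreal (g (\<iota> p))) \<in> borel_measurable borel"
proof -
  have [measurable]: "(\<lambda>p. if \<iota> p \<in> U then \<Phi> (\<iota> p) else 0) \<in> borel_measurable borel"
    "(\<lambda>p. if \<iota> p \<in> U then g (\<iota> p) else 0) \<in> borel_measurable borel"
    using measurable_on_U continuous_on_\<Phi> g by auto
  have [measurable]: "{p. \<iota> p \<in> U} \<in> sets borel" using open_\<iota>_U by simp
  note B[measurable]
  have "(\<lambda>p. indicator {p. \<iota> p \<in> U} p * indicator B (if \<iota> p \<in> U then \<Phi> (\<iota> p) else 0) *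
      ennreal (if \<iota> p \<in> U then g (\<iota> p) else 0)) \<in> borel_measurable borel"
    by measurable
  also have "(\<lambda>p. indicator {p. \<iota> p \<in> U} p * indicator B (if \<iota> p \<in> U then \<Phi> (\<iota> p) else 0) *
      ennreal (if \<iota> p \<in> U then g (\<iota> p) else 0)) =
      (\<lambda>p. indicator {p. \<iota> p \<in> U \<and> \<Phi> (\<iota> p) \<in> B} p * ennreal (g (\<iota> p)))"
    by (auto simp: fun_eq_iff indicator_def)
  finally show ?thesis .
qed

lemma emeasure_graph_measure:
  assumes g: "continuous_on U g" and B: "B \<in> sets borel"
  shows "emeasure (graph_measure g) B =
    (\<integral>\<^sup>+ p. indicator {p. \<iota> p \<in> U \<and> \<Phi> (\<iota> p) \<in> B} p * ennreal (g (\<iota> p)) \<partial>lborel)"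
proof -
  have m1: "(\<lambda>p. if \<iota> p \<in> U then \<Phi> (\<iota> p) else 0) \<in> borel_measurable borel"
    using measurable_on_U continuous_on_\<Phi> by auto
  have m2: "(\<lambda>p. indicator {p. \<iota> p \<in> U} p * ennreal (g (\<iota> p))) \<in> borel_measurable borel"
    using measurable_graph_integrand[OF g, of UNIV] by simp
  have B': "(\<lambda>p. if \<iota> p \<in> U then \<Phi> (\<iota> p) else 0) -` B \<in> sets borel"
    using measurable_sets_borel[OF m1 B] .
  show ?thesis
    unfolding graph_measure_def using m1 m2 B B'
    by (subst emeasure_distr) (auto simp: emeasure_density indicator_def intro!: nn_integral_cong)
qed

end

section \<open>Densities of graph measures\<close>

context intrinsic_graph begin

lemma continuous_near:
  assumes g: "continuous_on U g" and u0: "u0 \<in> U" and \<eta>: "\<eta> > (0::real)"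
  obtains \<delta> where "\<delta> > 0" "\<And>u. u \<in> U \<Longrightarrow> N (rel u0 u) < \<delta> \<Longrightarrow> \<bar>g u - g u0\<bar> < \<eta>"
proof -
  obtain D where D: "open D" "g -` ball (g u0) \<eta> \<inter> U = D \<inter> U"
    using g unfolding continuous_on_open_invariant by (metis open_ball)
  have uD: "u0 \<in> D" using D u0 \<eta> by auto
  obtain \<delta> where \<delta>: "\<delta> > 0" "\<And>z. N z < \<delta> \<Longrightarrow> tr u0 (\<phi> u0) z \<in> D"
    by (rule tr_near[OF D(1) uD, of "\<phi> u0"]) (rule that)
  have "\<bar>g u - g u0\<bar> < \<eta>" if "u \<in> U" "N (rel u0 u) < \<delta>" for u
  proof -
    have "u \<in> D \<inter> U" using \<delta>(2)[OF that(2)] that(1) by simp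
    then have "u \<in> g -` ball (g u0) \<eta>" using D(2) by blast
    then show ?thesis by (simp add: dist_real_def abs_minus_commute)
  qed
  then show ?thesis using that \<delta>(1) by blast
qed

lemma U_near:
  assumes u0: "u0 \<in> U"
  obtains \<delta> where "\<delta> > 0" "\<And>z. z \<in> W \<Longrightarrow> N z < \<delta> \<Longrightarrow> tr u0 (\<phi> u0) z \<in> U"
proof -
  obtain D where D: "open D" "U = W \<inter> D" using U_open by (auto simp: openin_open)
  then have uD: "u0 \<in> D" using u0 by simp
  obtain \<delta> where \<delta>: "\<delta> > 0" "\<And>z. N z < \<delta> \<Longrightarrow> tr u0 (\<phi> u0) z \<in> D"
    by (rule tr_near[OF D(1) uD, of "\<phi> u0"]) (rule that)
  then show ?thesis using that[of \<delta>] D(2) tr_in_W U_W[OF u0] by blast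
qed

text \<open>Left invariance cancels the base point and the common factor in W, which leaves exactly
  the estimate that defines the differential at u0.\<close>

lemma graph_blowup:
  assumes u0: "u0 \<in> U" and \<epsilon>: "\<epsilon> > 0"
  obtains \<delta> where "\<delta> > 0"
    "\<And>p r. r > 0 \<Longrightarrow> N (dil r (\<iota> p)) < \<delta> \<Longrightarrow> tr u0 (\<phi> u0) (dil r (\<iota> p)) \<in> U"
    "\<And>p r. r > 0 \<Longrightarrow> N (dil r (\<iota> p)) < \<delta> \<Longrightarrow>
      d (\<Phi> u0 \<odot> dil r (tangent (der u0) p)) (\<Phi> (tr u0 (\<phi> u0) (dil r (\<iota> p)))) \<le> \<epsilon> * N (dil r (\<iota> p))"
proof -
  obtain \<delta>1 where \<delta>1: "\<delta>1 > 0" "\<And>u. u \<in> U \<Longrightarrow> N (rel u0 u) < \<delta>1 \<Longrightarrow>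
    d (der u0 (rel u0 u)) (hinv (\<phi> u0) \<odot> \<phi> u) \<le> \<epsilon> * N (rel u0 u)" by (rule der_approx[OF u0 \<epsilon>]) (rule that)
  obtain \<delta>2 where \<delta>2: "\<delta>2 > 0" "\<And>z. z \<in> W \<Longrightarrow> N z < \<delta>2 \<Longrightarrow> tr u0 (\<phi> u0) z \<in> U"
    by (rule U_near[OF u0]) (rule that)
  show ?thesis
  proof (rule that[of "min \<delta>1 \<delta>2"])
    fix p and r :: real assume r: "r > 0" "N (dil r (\<iota> p)) < min \<delta>1 \<delta>2"
    let ?z = "dil r (\<iota> p)" and ?u = "tr u0 (\<phi> u0) (dil r (\<iota> p))"
    show u: "?u \<in> U" using r by (intro \<delta>2(2) W_group) auto
    have "dil r (tangent (der u0) p) = ?z \<odot> der u0 ?z"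
      using r hom_dil[OF der_hom[OF u0], of r "\<iota> p"] by (simp add: tangent_def dil_hmul)
    then show "d (\<Phi> u0 \<odot> dil r (tangent (der u0) p)) (\<Phi> ?u) \<le> \<epsilon> * N ?z"
      using \<delta>1(2)[OF u] r unfolding graph_tr by simp
  qed (use \<delta>1 \<delta>2 in simp)
qed

lemma emeasure_graph_measure_blowup:
  assumes g: "continuous_on U g" and B: "B \<in> sets borel" and u0: "u0 \<in> U" and r: "r > 0"
  shows "emeasure (graph_measure g) B = ennreal (r ^ (CARD('m) + 2)) *
    (\<integral>\<^sup>+ p. indicator {u \<in> U. \<Phi> u \<in> B} (tr u0 (\<phi> u0) (dil r (\<iota> p))) *
      ennreal (g (tr u0 (\<phi> u0) (dil r (\<iota> p)))) \<partial>lborel)"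
proof -
  let ?F = "\<lambda>u. indicator {u \<in> U. \<Phi> u \<in> B} u * ennreal (g u)"
  have eq: "(\<lambda>p. indicator {p. \<iota> p \<in> U \<and> \<Phi> (\<iota> p) \<in> B} p * ennreal (g (\<iota> p))) = (\<lambda>p. ?F (\<iota> p))"
    by (auto simp: fun_eq_iff indicator_def)
  have "(\<lambda>p. ?F (\<iota> p)) \<in> borel_measurable borel"
    using measurable_graph_integrand[OF g B] unfolding eq .
  then show ?thesis
    using nn_integral_tr[of ?F u0 r "\<phi> u0"] U_W[OF u0] r
    unfolding emeasure_graph_measure[OF g B] eq by simp
qed

text \<open>A graph point in B(y, r) is within 2 r of the base point, so \<open>proj_bound\<close>
  limits its parameter to 2 C r. The corresponding tangent point is then \<eta> r close and lies in
  the ball of radius (1 + \<eta>) r about y, where \<open>emeasure_tangent_ball\<close> gives a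
  bound independent of y.\<close>

lemma density_upper_aux:
  assumes g: "continuous_on U g" and u0: "u0 \<in> U" and g0: "g u0 \<ge> 0" and \<eta>: "\<eta> > 0"
  obtains \<rho> where "\<rho> > 0" "\<And>y r. \<Phi> u0 \<in> hball d y r \<Longrightarrow> 0 < r \<Longrightarrow> r < \<rho> \<Longrightarrow>
    emeasure (graph_measure g) (hball d y r) \<le>
      ennreal (r ^ (CARD('m) + 2) * ((g u0 + \<eta>) * ((1 + \<eta>) ^ (CARD('m) + 2) * ball_area (der u0))))"
proof -
  obtain C where C: "C > 0" "\<And>a b. a \<in> W \<Longrightarrow> b \<in> V \<Longrightarrow> N a \<le> C * N (a \<odot> b)" by (rule proj_bound) (rule that)
  have L: "h_hom_sub W V (der u0)" by (rule der_hom[OF u0])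
  \<comment> \<open>Makes the linearization error \<epsilon> * 2 C r equal to \<eta> r.\<close>
  define \<epsilon> where "\<epsilon> = \<eta> / (2 * C)"
  have \<epsilon>: "\<epsilon> > 0" using \<eta> C by (simp add: \<epsilon>_def)
  obtain \<delta>1 where \<delta>1: "\<delta>1 > 0"
    "\<And>p r. r > 0 \<Longrightarrow> N (dil r (\<iota> p)) < \<delta>1 \<Longrightarrow> tr u0 (\<phi> u0) (dil r (\<iota> p)) \<in> U"
    "\<And>p r. r > 0 \<Longrightarrow> N (dil r (\<iota> p)) < \<delta>1 \<Longrightarrow>
      d (\<Phi> u0 \<odot> dil r (tangent (der u0) p)) (\<Phi> (tr u0 (\<phi> u0) (dil r (\<iota> p)))) \<le> \<epsilon> * N (dil r (\<iota> p))"
    by (rule graph_blowup[OF u0 \<epsilon>]) (rule that)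
  obtain \<delta>2 where \<delta>2: "\<delta>2 > 0" "\<And>u. u \<in> U \<Longrightarrow> N (rel u0 u) < \<delta>2 \<Longrightarrow> \<bar>g u - g u0\<bar> < \<eta>"
    by (rule continuous_near[OF g u0 \<eta>]) (rule that)
  define \<rho> where "\<rho> = min \<delta>1 \<delta>2 / (2 * C)"
  have \<rho>: "\<rho> > 0" using \<delta>1 \<delta>2 C by (simp add: \<rho>_def)
  show ?thesis
  proof (rule that[OF \<rho>])
    fix y r assume xy: "\<Phi> u0 \<in> hball d y r" and r: "0 < r" "r < \<rho>"
    let ?x = "\<Phi> u0" and ?T = "tangent (der u0)"
    let ?A = "{p. d y (?x \<odot> dil r (?T p)) \<le> r * (1 + \<eta>)}"
    have A: "?A = {p. d (dil (1 / r) (hinv ?x \<odot> y)) (?T p) \<le> 1 + \<eta>}"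
      using r by (simp add: dist_dil_tangent)
    have mA: "?A \<in> sets borel" unfolding A using closed_tangent_le[OF L] by auto
    have pt: "indicator {u \<in> U. \<Phi> u \<in> hball d y r} (tr u0 (\<phi> u0) (dil r (\<iota> p))) *
        ennreal (g (tr u0 (\<phi> u0) (dil r (\<iota> p)))) \<le> ennreal (g u0 + \<eta>) * indicator ?A p" for p
    proof -
      define u where "u = tr u0 (\<phi> u0) (dil r (\<iota> p))"
      show ?thesis
      proof (cases "u \<in> U \<and> \<Phi> u \<in> hball d y r")
        case True
        define q where "q = hinv (\<phi> u0) \<odot> \<phi> u"
        have q: "q \<in> V" unfolding q_def using True u0 by (intro V_group \<phi>_in_V) auto
        have \<Phi>u: "\<Phi> u = ?x \<odot> (dil r (\<iota> p) \<odot> q)" unfolding q_def u_def by (rule graph_tr)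
        have "N (dil r (\<iota> p) \<odot> q) = d ?x (\<Phi> u)" unfolding \<Phi>u by (simp add: d_eq_N[of ?x])
        also have "\<dots> \<le> 2 * r" using True xy d_triangle[of ?x "\<Phi> u" y] by (simp add: mem_hball d_commute)
        finally have "C * N (dil r (\<iota> p) \<odot> q) \<le> C * (2 * r)" using C by (intro mult_left_mono) auto
        moreover have "N (dil r (\<iota> p)) \<le> C * N (dil r (\<iota> p) \<odot> q)"
          using q r by (intro C(2) W_group) auto
        ultimately have Nr: "N (dil r (\<iota> p)) \<le> 2 * C * r" by linarith
        also have "\<dots> < min \<delta>1 \<delta>2" using r C by (simp add: \<rho>_def field_simps)
        finally have small: "N (dil r (\<iota> p)) < \<delta>1" "N (rel u0 u) < \<delta>2" by (simp_all add: u_def)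
        have "d (?x \<odot> dil r (?T p)) (\<Phi> u) \<le> \<epsilon> * N (dil r (\<iota> p))"
          unfolding u_def by (rule \<delta>1(3)[OF r(1) small(1)])
        also have "\<dots> \<le> \<epsilon> * (2 * C * r)" using Nr \<epsilon> by (intro mult_left_mono) auto
        also have "\<dots> = \<eta> * r" using C by (simp add: \<epsilon>_def)
        finally have "d (\<Phi> u) (?x \<odot> dil r (?T p)) \<le> \<eta> * r" by (simp add: d_commute)
        then have "p \<in> ?A"
          using d_triangle[of y "?x \<odot> dil r (?T p)" "\<Phi> u"] True by (simp add: mem_hball algebra_simps)
        moreover have "ennreal (g u) \<le> ennreal (g u0 + \<eta>)"
          using \<delta>2(2)[OF _ small(2)] True by (intro ennreal_leI) auto
        ultimately show ?thesis using True by (simp add: u_def[symmetric])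
      qed (auto simp: u_def[symmetric] indicator_def)
    qed
    have "emeasure (graph_measure g) (hball d y r) \<le> ennreal (r ^ (CARD('m) + 2)) *
      (\<integral>\<^sup>+ p. ennreal (g u0 + \<eta>) * indicator ?A p \<partial>lborel)"
      unfolding emeasure_graph_measure_blowup[OF g borel_closed[OF closed_hball] u0 r(1)]
      by (intro mult_left_mono nn_integral_mono pt) auto
    also have "(\<integral>\<^sup>+ p. ennreal (g u0 + \<eta>) * indicator ?A p \<partial>lborel) = ennreal (g u0 + \<eta>) * emeasure lborel ?A"
      using mA by (simp add: nn_integral_cmult_indicator)
    also have "ennreal (r ^ (CARD('m) + 2)) * \<dots> \<le> ennreal (r ^ (CARD('m) + 2)) *
      (ennreal (g u0 + \<eta>) * ennreal ((1 + \<eta>) ^ (CARD('m) + 2) * ball_area (der u0)))"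
      unfolding A using \<eta> by (intro mult_left_mono emeasure_tangent_ball L) auto
    also have "\<dots> = ennreal (r ^ (CARD('m) + 2) * ((g u0 + \<eta>) * ((1 + \<eta>) ^ (CARD('m) + 2) * ball_area (der u0))))"
      using r \<eta> g0 ball_area(2)[OF L] by (simp add: ennreal_mult)
    finally show "emeasure (graph_measure g) (hball d y r) \<le> \<dots>" .
  qed
qed

text \<open>Conversely, every parameter whose tangent point lies in the ball of radius 1 - \<eta>
  produces, at scale r, a graph point in the ball of radius r: the error is at most \<eta> r. The
  bound \<eta> \<le> g u0 keeps the weight g u0 - \<eta> nonnegative.\<close>

lemma density_lower_aux:
  assumes g: "continuous_on U g" and u0: "u0 \<in> U" and \<eta>: "\<eta> > 0" "\<eta> < 1" "\<eta> \<le> g u0"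
  obtains \<rho> where "\<rho> > 0" "\<And>r. 0 < r \<Longrightarrow> r < \<rho> \<Longrightarrow>
    ennreal (r ^ (CARD('m) + 2) * ((g u0 - \<eta>) * ((1 - \<eta>) ^ (CARD('m) + 2) * ball_area (der u0))))
    \<le> emeasure (graph_measure g) (hball d (\<Phi> u0) r)"
proof -
  obtain C where C: "C > 0" "\<And>a b. a \<in> W \<Longrightarrow> b \<in> V \<Longrightarrow> N a \<le> C * N (a \<odot> b)" by (rule proj_bound) (rule that)
  have L: "h_hom_sub W V (der u0)" by (rule der_hom[OF u0])
  define \<epsilon> where "\<epsilon> = \<eta> / C"
  have \<epsilon>: "\<epsilon> > 0" using \<eta> C by (simp add: \<epsilon>_def)
  obtain \<delta>1 where \<delta>1: "\<delta>1 > 0"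
    "\<And>p r. r > 0 \<Longrightarrow> N (dil r (\<iota> p)) < \<delta>1 \<Longrightarrow> tr u0 (\<phi> u0) (dil r (\<iota> p)) \<in> U"
    "\<And>p r. r > 0 \<Longrightarrow> N (dil r (\<iota> p)) < \<delta>1 \<Longrightarrow>
      d (\<Phi> u0 \<odot> dil r (tangent (der u0) p)) (\<Phi> (tr u0 (\<phi> u0) (dil r (\<iota> p)))) \<le> \<epsilon> * N (dil r (\<iota> p))"
    by (rule graph_blowup[OF u0 \<epsilon>]) (rule that)
  obtain \<delta>2 where \<delta>2: "\<delta>2 > 0" "\<And>u. u \<in> U \<Longrightarrow> N (rel u0 u) < \<delta>2 \<Longrightarrow> \<bar>g u - g u0\<bar> < \<eta>"
    by (rule continuous_near[OF g u0 \<eta>(1)]) (rule that)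
  define \<rho> where "\<rho> = min \<delta>1 \<delta>2 / C"
  have \<rho>: "\<rho> > 0" using \<delta>1 \<delta>2 C by (simp add: \<rho>_def)
  show ?thesis
  proof (rule that[OF \<rho>])
    fix r assume r: "0 < r" "r < \<rho>"
    let ?x = "\<Phi> u0" and ?T = "tangent (der u0)"
    let ?A = "{p. N (?T p) \<le> 1 - \<eta>}"
    have mA: "?A \<in> sets borel" using closed_tangent_N[OF L] by auto
    have pt: "ennreal (g u0 - \<eta>) * indicator ?A p \<le>
        indicator {u \<in> U. \<Phi> u \<in> hball d ?x r} (tr u0 (\<phi> u0) (dil r (\<iota> p))) *
        ennreal (g (tr u0 (\<phi> u0) (dil r (\<iota> p))))" for p
    proof (cases "p \<in> ?A")
      case True
      define u where "u = tr u0 (\<phi> u0) (dil r (\<iota> p))"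
      have "C * N (?T p) \<le> C * 1" using True C \<eta> by (intro mult_left_mono) auto
      then have "N (\<iota> p) \<le> C" using tangent_N_lower[OF C(2) L, of p] by simp
      then have "r * N (\<iota> p) \<le> r * C" using r by (intro mult_left_mono) auto
      then have Nr: "N (dil r (\<iota> p)) \<le> C * r" using r by (simp add: mult.commute)
      also have "\<dots> < min \<delta>1 \<delta>2" using r C by (simp add: \<rho>_def field_simps)
      finally have small: "N (dil r (\<iota> p)) < \<delta>1" "N (rel u0 u) < \<delta>2" by (simp_all add: u_def)
      have uU: "u \<in> U" unfolding u_def by (rule \<delta>1(2)[OF r(1) small(1)])
      have "d ?x (\<Phi> u) \<le> d ?x (?x \<odot> dil r (?T p)) + d (?x \<odot> dil r (?T p)) (\<Phi> u)" by (rule d_triangle)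
      also have "d ?x (?x \<odot> dil r (?T p)) \<le> r * (1 - \<eta>)" using True r by (simp add: d_eq_N[of ?x])
      also have "d (?x \<odot> dil r (?T p)) (\<Phi> u) \<le> \<epsilon> * N (dil r (\<iota> p))"
        unfolding u_def by (rule \<delta>1(3)[OF r(1) small(1)])
      also have "\<dots> \<le> \<epsilon> * (C * r)" using Nr \<epsilon> by (intro mult_left_mono) auto
      also have "\<dots> = \<eta> * r" using C by (simp add: \<epsilon>_def)
      finally have "\<Phi> u \<in> hball d ?x r" by (simp add: mem_hball algebra_simps)
      moreover have "ennreal (g u0 - \<eta>) \<le> ennreal (g u)"
        using \<delta>2(2)[OF uU small(2)] by (intro ennreal_leI) auto
      ultimately show ?thesis using True uU by (simp add: u_def[symmetric])
    qed simp
    have "ennreal (r ^ (CARD('m) + 2) * ((g u0 - \<eta>) * ((1 - \<eta>) ^ (CARD('m) + 2) * ball_area (der u0)))) =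
      ennreal (r ^ (CARD('m) + 2)) * (ennreal (g u0 - \<eta>) * emeasure lborel ?A)"
      using r \<eta> ball_area(2)[OF L] by (simp add: emeasure_tangent_scale[OF L] ennreal_mult)
    also have "ennreal (g u0 - \<eta>) * emeasure lborel ?A = (\<integral>\<^sup>+ p. ennreal (g u0 - \<eta>) * indicator ?A p \<partial>lborel)"
      using mA by (simp add: nn_integral_cmult_indicator)
    also have "ennreal (r ^ (CARD('m) + 2)) * \<dots> \<le> emeasure (graph_measure g) (hball d ?x r)"
      unfolding emeasure_graph_measure_blowup[OF g borel_closed[OF closed_hball] u0 r(1)]
      by (intro mult_left_mono nn_integral_mono pt) auto
    finally show "ennreal (r ^ (CARD('m) + 2) * ((g u0 - \<eta>) * ((1 - \<eta>) ^ (CARD('m) + 2) * ball_area (der u0))))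
      \<le> emeasure (graph_measure g) (hball d ?x r)" .
  qed
qed

lemma density_upper:
  assumes g: "continuous_on U g" and u0: "u0 \<in> U" and g0: "g u0 \<ge> 0" and t: "g u0 * ball_area (der u0) < t"
  obtains \<rho> where "\<rho> > 0" "\<And>y r. \<Phi> u0 \<in> hball d y r \<Longrightarrow> 0 < r \<Longrightarrow> r < \<rho> \<Longrightarrow>
    emeasure (graph_measure g) (hball d y r) \<le> ennreal (t * r powr real (CARD('m) + 2))"
proof -
  let ?h = "\<lambda>\<eta>. (g u0 + \<eta>) * ((1 + \<eta>) ^ (CARD('m) + 2) * ball_area (der u0))"
  have "(?h \<longlongrightarrow> ?h 0) (at_right 0)" by (intro tendsto_intros)
  then have "\<forall>\<^sub>F \<eta> in at_right 0. ?h \<eta> < t" using t by (intro order_tendstoD(2)[where y = "?h 0"]) auto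
  then obtain b where b: "b > 0" "\<And>\<eta>. 0 < \<eta> \<Longrightarrow> \<eta> < b \<Longrightarrow> ?h \<eta> < t"
    unfolding eventually_at_right_field by auto
  define \<eta> where "\<eta> = b / 2"
  have \<eta>: "\<eta> > 0" "?h \<eta> < t" using b by (auto simp: \<eta>_def)
  obtain \<rho> where \<rho>: "\<rho> > 0" "\<And>y r. \<Phi> u0 \<in> hball d y r \<Longrightarrow> 0 < r \<Longrightarrow> r < \<rho> \<Longrightarrow>
    emeasure (graph_measure g) (hball d y r) \<le> ennreal (r ^ (CARD('m) + 2) * ?h \<eta>)"
    by (rule density_upper_aux[OF g u0 g0 \<eta>(1)]) (rule that)
  show ?thesis
  proof (rule that[OF \<rho>(1)])
    fix y r assume r: "\<Phi> u0 \<in> hball d y r" "0 < r" "r < \<rho>"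
    have "r ^ (CARD('m) + 2) * ?h \<eta> \<le> r ^ (CARD('m) + 2) * t" using \<eta> r by (intro mult_left_mono) auto
    also have "\<dots> = t * r powr real (CARD('m) + 2)" using r by (subst powr_realpow) auto
    finally show "emeasure (graph_measure g) (hball d y r) \<le> ennreal (t * r powr real (CARD('m) + 2))"
      using \<rho>(2)[OF r] by (meson ennreal_leI order_trans)
  qed
qed

lemma density_lower:
  assumes g: "continuous_on U g" and u0: "u0 \<in> U" and t: "0 \<le> t" "t < g u0 * ball_area (der u0)"
  obtains \<rho> where "\<rho> > 0" "\<And>r. 0 < r \<Longrightarrow> r < \<rho> \<Longrightarrow>
    ennreal (t * r powr real (CARD('m) + 2)) < emeasure (graph_measure g) (hball d (\<Phi> u0) r)"
proof -
  have ba: "ball_area (der u0) > 0" by (intro ball_area der_hom u0)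
  have "0 < g u0 * ball_area (der u0)" using t by simp
  then have g0: "g u0 > 0" using ba by (simp add: zero_less_mult_iff)
  let ?h = "\<lambda>\<eta>. (g u0 - \<eta>) * ((1 - \<eta>) ^ (CARD('m) + 2) * ball_area (der u0))"
  have "(?h \<longlongrightarrow> ?h 0) (at_right 0)" by (intro tendsto_intros)
  then have "\<forall>\<^sub>F \<eta> in at_right 0. t < ?h \<eta>" using t by (intro order_tendstoD(1)[where y = "?h 0"]) auto
  then obtain b where b: "b > 0" "\<And>\<eta>. 0 < \<eta> \<Longrightarrow> \<eta> < b \<Longrightarrow> t < ?h \<eta>"
    unfolding eventually_at_right_field by auto
  define \<eta> where "\<eta> = min (b / 2) (min (1 / 2) (g u0))"
  have \<eta>: "\<eta> > 0" "t < ?h \<eta>" "\<eta> < 1" "\<eta> \<le> g u0"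
    using b(1) g0 b(2)[of \<eta>] by (auto simp: \<eta>_def)
  obtain \<rho> where \<rho>: "\<rho> > 0" "\<And>r. 0 < r \<Longrightarrow> r < \<rho> \<Longrightarrow>
    ennreal (r ^ (CARD('m) + 2) * ?h \<eta>) \<le> emeasure (graph_measure g) (hball d (\<Phi> u0) r)"
    by (rule density_lower_aux[OF g u0 \<eta>(1,3,4)]) (rule that)
  show ?thesis
  proof (rule that[OF \<rho>(1)])
    fix r assume r: "0 < r" "r < \<rho>"
    have "t * r powr real (CARD('m) + 2) = r ^ (CARD('m) + 2) * t" using r by (subst powr_realpow) auto
    also have "\<dots> < r ^ (CARD('m) + 2) * ?h \<eta>" using \<eta> r by (intro mult_strict_left_mono) auto
    finally have "ennreal (t * r powr real (CARD('m) + 2)) < ennreal (r ^ (CARD('m) + 2) * ?h \<eta>)"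
      using t r by (intro ennreal_lessI) (auto intro: le_less_trans[rotated])
    then show "ennreal (t * r powr real (CARD('m) + 2)) < emeasure (graph_measure g) (hball d (\<Phi> u0) r)"
      using \<rho>(2)[OF r] by (rule less_le_trans)
  qed
qed

text \<open>Here the uniformity is used: for u0 near ub, the increments of \<open>\<phi>\<close>
  based at u0 are approximated both by \<open>der ub\<close> and by \<open>der u0\<close>. So the
  two maps are close on small elements of W, and by homogeneity on all of them.\<close>

lemma der_close:
  assumes ub: "ub \<in> U" and \<epsilon>: "\<epsilon> > 0"
  obtains \<delta> where "\<delta> > 0" "\<And>u0 z. u0 \<in> U \<Longrightarrow> d ub u0 < \<delta> \<Longrightarrow> z \<in> W \<Longrightarrow> d (der ub z) (der u0 z) \<le> \<epsilon> * N z"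
proof -
  define e where "e = \<epsilon> / 2"
  have e: "e > 0" using \<epsilon> by (simp add: e_def)
  obtain \<delta> where \<delta>: "\<delta> > 0" "\<And>u0 u. u0 \<in> U \<Longrightarrow> N (hinv ub \<odot> u0) < \<delta> \<Longrightarrow> u \<in> U \<Longrightarrow> N (rel u0 u) < \<delta> \<Longrightarrow>
       d (der ub (rel u0 u)) (hinv (\<phi> u0) \<odot> \<phi> u) \<le> e * N (rel u0 u)"
    using udiff_der[OF ub] e unfolding udiff_def by blast
  show ?thesis
  proof (rule that[OF \<delta>(1)])
    fix u0 z assume u0: "u0 \<in> U" "d ub u0 < \<delta>" and z: "z \<in> W"
    obtain \<delta>1 where \<delta>1: "\<delta>1 > 0" "\<And>u. u \<in> U \<Longrightarrow> N (rel u0 u) < \<delta>1 \<Longrightarrow>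
      d (der u0 (rel u0 u)) (hinv (\<phi> u0) \<odot> \<phi> u) \<le> e * N (rel u0 u)" by (rule der_approx[OF u0(1) e]) (rule that)
    obtain \<delta>2 where \<delta>2: "\<delta>2 > 0" "\<And>z. z \<in> W \<Longrightarrow> N z < \<delta>2 \<Longrightarrow> tr u0 (\<phi> u0) z \<in> U"
      by (rule U_near[OF u0(1)]) (rule that)
    \<comment> \<open>Dilates z below all three thresholds; the summand 1 covers z = 0.\<close>
    define s where "s = min \<delta> (min \<delta>1 \<delta>2) / (N z + 1)"
    have N1: "N z + 1 > 0" using N_nonneg[of z] by linarith
    have s: "s > 0" using \<delta>(1) \<delta>1(1) \<delta>2(1) N1 by (simp add: s_def)
    have "s * N z < s * (N z + 1)" using s by simp
    also have "\<dots> = min \<delta> (min \<delta>1 \<delta>2)" using N1 by (simp add: s_def)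
    finally have small: "N (dil s z) < \<delta>" "N (dil s z) < \<delta>1" "N (dil s z) < \<delta>2" using s by simp_all
    define u where "u = tr u0 (\<phi> u0) (dil s z)"
    have u: "u \<in> U" unfolding u_def using small(3) z s by (intro \<delta>2(2) W_group) auto
    have ru: "rel u0 u = dil s z" by (simp add: u_def)
    have "d (der ub (dil s z)) (der u0 (dil s z)) \<le> d (der ub (dil s z)) (hinv (\<phi> u0) \<odot> \<phi> u) + d (der u0 (dil s z)) (hinv (\<phi> u0) \<odot> \<phi> u)"
      using d_triangle d_commute by metis
    also have "\<dots> \<le> e * N (dil s z) + e * N (dil s z)"
      using \<delta>(2)[OF u0(1) _ u] \<delta>1(2)[OF u] small u0(2) unfolding ru d_eq_N[of ub] by (intro add_mono) auto
    also have "\<dots> = s * (\<epsilon> * N z)" using s by (simp add: e_def)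
    finally have "s * d (der ub z) (der u0 z) \<le> s * (\<epsilon> * N z)"
      using s z by (simp add: hom_dil[OF der_hom[OF ub]] hom_dil[OF der_hom[OF u0(1)]])
    then show "d (der ub z) (der u0 z) \<le> \<epsilon> * N z" using s by simp
  qed
qed

text \<open>Replacing L by L' moves a tangent point of the unit ball by at most \<epsilon> C, hence
  into the ball of radius 1 + \<epsilon> C, whose section scales with the homogeneous
  dimension.\<close>

lemma ball_area_le:
  assumes C: "\<And>a b. a \<in> W \<Longrightarrow> b \<in> V \<Longrightarrow> N a \<le> C * N (a \<odot> b)" "C > 0" and L: "h_hom_sub W V L" "h_hom_sub W V L'"
    and close: "\<And>z. z \<in> W \<Longrightarrow> d (L z) (L' z) \<le> \<epsilon> * N z" and \<epsilon>: "\<epsilon> \<ge> 0"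
  shows "ball_area L \<le> (1 + \<epsilon> * C) ^ (CARD('m) + 2) * ball_area L'"
proof -
  have sub: "{p. N (tangent L p) \<le> 1} \<subseteq> {p. N (tangent L' p) \<le> 1 + \<epsilon> * C}"
  proof safe
    fix p assume p: "N (tangent L p) \<le> 1"
    have "N (\<iota> p) \<le> C * N (tangent L p)" by (rule tangent_N_lower[OF C(1) L(1)])
    also have "\<dots> \<le> C * 1" using p C(2) by (intro mult_left_mono) auto
    finally have "N (\<iota> p) \<le> C" by simp
    then have le: "\<epsilon> * N (\<iota> p) \<le> \<epsilon> * C" using \<epsilon> by (rule mult_left_mono)
    have "N (tangent L' p) \<le> N (tangent L p) + d (tangent L p) (tangent L' p)"
      using d_triangle[of "tangent L' p" 0 "tangent L p"] by (simp add: hnorm_def d_commute)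
    also have "d (tangent L p) (tangent L' p) \<le> \<epsilon> * N (\<iota> p)"
      unfolding tangent_def using close[of "\<iota> p"] by simp
    finally show "N (tangent L' p) \<le> 1 + \<epsilon> * C" using p le by linarith
  qed
  have "ennreal (ball_area L) = emeasure lborel {p. N (tangent L p) \<le> 1}" using ball_area[OF L(1)] by simp
  also have "\<dots> \<le> emeasure lborel {p. N (tangent L' p) \<le> 1 + \<epsilon> * C}"
    using closed_tangent_N[OF L(2)] by (intro emeasure_mono[OF sub]) auto
  also have "\<dots> = ennreal ((1 + \<epsilon> * C) ^ (CARD('m) + 2) * ball_area L')"
    using C(2) \<epsilon> by (intro emeasure_tangent_scale L add_pos_nonneg) auto
  finally show ?thesis
    using C(2) \<epsilon> ball_area(2)[OF L(2)] by (subst (asm) ennreal_le_iff) auto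
qed

text \<open>\<open>ball_area_le\<close> in both directions squeezes the ratio of nearby areas
  towards 1. Continuity makes the reciprocal an admissible weight.\<close>

lemma continuous_on_ball_area: "continuous_on U (\<lambda>u. ball_area (der u))"
  unfolding continuous_on_def
proof
  fix ub assume ub: "ub \<in> U"
  obtain C where C: "C > 0" "\<And>a b. a \<in> W \<Longrightarrow> b \<in> V \<Longrightarrow> N a \<le> C * N (a \<odot> b)" by (rule proj_bound) (rule that)
  let ?m = "\<lambda>u. ball_area (der u)" and ?F = "at ub within U"
  let ?k = "\<lambda>\<epsilon>. (1 + \<epsilon> * C) ^ (CARD('m) + 2)"
  have ev: "\<forall>\<^sub>F u in ?F. ?m ub \<le> ?k \<epsilon> * ?m u \<and> ?m u \<le> ?k \<epsilon> * ?m ub" if \<epsilon>: "\<epsilon> > 0" for \<epsilon>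
  proof -
    obtain \<delta> where \<delta>: "\<delta> > 0" "\<And>u0 z. u0 \<in> U \<Longrightarrow> d ub u0 < \<delta> \<Longrightarrow> z \<in> W \<Longrightarrow> d (der ub z) (der u0 z) \<le> \<epsilon> * N z"
      by (rule der_close[OF ub \<epsilon>]) (rule that)
    have "open {u. d ub u < \<delta>}" by (intro open_Collect_less continuous_intros)
    then have "\<forall>\<^sub>F u in ?F. u \<in> U \<and> d ub u < \<delta>"
      unfolding eventually_at_topological using \<delta>(1) by (intro exI[of _ "{u. d ub u < \<delta>}"]) auto
    then show ?thesis
    proof eventually_elim
      fix u assume u: "u \<in> U \<and> d ub u < \<delta>"
      then show "?m ub \<le> ?k \<epsilon> * ?m u \<and> ?m u \<le> ?k \<epsilon> * ?m ub"
        using \<delta>(2)[of u] \<epsilon> by (intro conjI ball_area_le C der_hom ub) (auto simp: d_commute)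
    qed
  qed
  have m0: "?m ub > 0" by (intro ball_area der_hom ub)
  have k0: "?k \<epsilon> > 0" if "\<epsilon> > 0" for \<epsilon> using that C(1) by (intro zero_less_power add_pos_pos) auto
  show "(?m \<longlongrightarrow> ?m ub) ?F"
  proof (rule order_tendstoI)
    fix a assume a: "a < ?m ub"
    have "((\<lambda>\<epsilon>. ?m ub / ?k \<epsilon>) \<longlongrightarrow> ?m ub / ?k 0) (at_right 0)" by (intro tendsto_intros) auto
    then have "\<forall>\<^sub>F \<epsilon> in at_right 0. a < ?m ub / ?k \<epsilon>" using a by (intro order_tendstoD(1)[where y = "?m ub / ?k 0"]) auto
    then obtain \<epsilon> where \<epsilon>: "\<epsilon> > 0" "a < ?m ub / ?k \<epsilon>"
      unfolding eventually_at_right_field by (metis field_lbound_gt_zero)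
    show "\<forall>\<^sub>F u in ?F. a < ?m u"
      using ev[OF \<epsilon>(1)]
    proof eventually_elim
      fix u assume "?m ub \<le> ?k \<epsilon> * ?m u \<and> ?m u \<le> ?k \<epsilon> * ?m ub"
      then have "?m ub / ?k \<epsilon> \<le> ?m u" using k0[OF \<epsilon>(1)] by (simp add: divide_le_eq mult.commute)
      then show "a < ?m u" using \<epsilon>(2) by linarith
    qed
  next
    fix a assume a: "?m ub < a"
    have "((\<lambda>\<epsilon>. ?k \<epsilon> * ?m ub) \<longlongrightarrow> ?k 0 * ?m ub) (at_right 0)" by (intro tendsto_intros)
    then have "\<forall>\<^sub>F \<epsilon> in at_right 0. ?k \<epsilon> * ?m ub < a" using a by (intro order_tendstoD(2)[where y = "?k 0 * ?m ub"]) auto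
    then obtain \<epsilon> where \<epsilon>: "\<epsilon> > 0" "?k \<epsilon> * ?m ub < a"
      unfolding eventually_at_right_field by (metis field_lbound_gt_zero)
    show "\<forall>\<^sub>F u in ?F. ?m u < a"
      using ev[OF \<epsilon>(1)] by eventually_elim (use \<epsilon>(2) in linarith)
  qed
qed

text \<open>Weighting the graph measure by the inverse of the density makes both densities equal to 1.\<close>

lemma centered_eq_spherical_graph:
  assumes "A \<subseteq> \<Phi> ` U"
  shows "centered_measure d (real (CARD('m) + 2)) A = spherical_measure d (real (CARD('m) + 2)) A"
proof (rule centered_eq_spherical[OF sets_graph_measure _ _ _ assms])
  let ?g = "\<lambda>u. 1 / ball_area (der u)"
  have pos: "ball_area (der u) > 0" if "u \<in> U" for u by (intro ball_area der_hom that)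
  have g: "continuous_on U ?g"
    using pos by (intro continuous_intros continuous_on_ball_area) (auto simp: less_imp_neq[symmetric])
  have one: "?g u * ball_area (der u) = 1" if "u \<in> U" for u using pos[OF that] by simp
  show "\<exists>r>0. r < r0 \<and> ennreal (t * r powr real (CARD('m) + 2)) < emeasure (graph_measure ?g) (hball d x r)"
    if x: "x \<in> \<Phi> ` U" and t: "0 < t" "t < 1" and r0: "0 < r0" for x t r0
  proof -
    obtain u where u: "u \<in> U" "x = \<Phi> u" using x by blast
    obtain \<rho> where \<rho>: "\<rho> > 0" "\<And>r. 0 < r \<Longrightarrow> r < \<rho> \<Longrightarrow>
      ennreal (t * r powr real (CARD('m) + 2)) < emeasure (graph_measure ?g) (hball d (\<Phi> u) r)"
      by (rule density_lower[OF g u(1), of t]) (use t one[OF u(1)] in auto)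
    then show ?thesis using r0 u by (intro exI[of _ "min \<rho> r0 / 2"]) auto
  qed
  show "\<exists>\<epsilon>>0. \<forall>y r. x \<in> hball d y r \<longrightarrow> 0 < r \<longrightarrow> r < \<epsilon> \<longrightarrow>
      emeasure (graph_measure ?g) (hball d y r) \<le> ennreal (t * r powr real (CARD('m) + 2))"
    if x: "x \<in> \<Phi> ` U" and t: "1 < t" for x t
  proof -
    obtain u where u: "u \<in> U" "x = \<Phi> u" using x by blast
    obtain \<rho> where "\<rho> > 0" "\<And>y r. \<Phi> u \<in> hball d y r \<Longrightarrow> 0 < r \<Longrightarrow> r < \<rho> \<Longrightarrow>
      emeasure (graph_measure ?g) (hball d y r) \<le> ennreal (t * r powr real (CARD('m) + 2))"
      by (rule density_upper[OF g u(1), of t]) (use t one[OF u(1)] pos[OF u(1)] in auto)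
    then show ?thesis using u(2) by blast
  qed
qed simp

end

section \<open>Both densities from bounds on balls\<close>

context hdist begin

lemma upper_le_federer:
  assumes \<alpha>: "\<alpha> > 0"
  shows "upper_density d \<alpha> \<mu> x \<le> federer_density d \<alpha> \<mu> x"
  unfolding federer_density_def
proof (rule INF_greatest)
  fix \<epsilon> :: real assume "\<epsilon> \<in> {0<..}"
  let ?S = "{ennreal (2 powr \<alpha>) * \<mu> (hball d y r) / ennreal (hdiam d (hball d y r) powr \<alpha>) | y r.
        x \<in> hball d y r \<and> 0 < r \<and> r < \<epsilon>}"
  have "\<forall>\<^sub>F r in at_right 0. \<mu> (hball d x r) / ennreal (r powr \<alpha>) \<le> Sup ?S"
    unfolding eventually_at_right_field
  proof (intro exI[of _ \<epsilon>] conjI allI impI)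
    fix r :: real assume r: "0 < r" "r < \<epsilon>"
    have "\<mu> (hball d x r) / ennreal (r powr \<alpha>) = ennreal (2 powr \<alpha>) * \<mu> (hball d x r) / ennreal (hdiam d (hball d x r) powr \<alpha>)"
    proof -
      have "hdiam d (hball d x r) powr \<alpha> = 2 powr \<alpha> * r powr \<alpha>" using r by (simp add: powr_mult)
      then have "ennreal (2 powr \<alpha>) * \<mu> (hball d x r) / ennreal (hdiam d (hball d x r) powr \<alpha>) =
        (ennreal (2 powr \<alpha>) * inverse (ennreal (2 powr \<alpha>))) * (\<mu> (hball d x r) * inverse (ennreal (r powr \<alpha>)))"
        using r by (simp add: divide_ennreal_def ennreal_mult ennreal_inverse_mult mult_ac)
      also have "ennreal (2 powr \<alpha>) * inverse (ennreal (2 powr \<alpha>)) = 1"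
        by (simp add: inverse_ennreal ennreal_mult[symmetric])
      finally show ?thesis by (simp add: divide_ennreal_def)
    qed
    then show "\<mu> (hball d x r) / ennreal (r powr \<alpha>) \<le> Sup ?S"
      using r by (intro Sup_upper CollectI exI[of _ x] exI[of _ r]) (auto simp: mem_hball)
  qed (use \<open>\<epsilon> \<in> {0<..}\<close> in simp)
  then show "upper_density d \<alpha> \<mu> x \<le> Sup ?S"
    unfolding upper_density_def by (rule Limsup_bounded)
qed

text \<open>Both densities equal \<theta>: the bound on all balls through x gives Federer density
  \<le> \<theta>, the bound on centred balls gives \<theta> \<le> upper density.\<close>

lemma densities_eq:
  assumes \<theta>: "\<theta> \<ge> 0" and \<alpha>: "\<alpha> > 0"
    and up: "\<And>t. \<theta> < t \<Longrightarrow> \<exists>\<rho>>0. \<forall>y r. x \<in> hball d y r \<longrightarrow> 0 < r \<longrightarrow> r < \<rho> \<longrightarrow> \<mu> (hball d y r) \<le> ennreal (t * r powr \<alpha>)"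
    and low: "\<And>t. 0 \<le> t \<Longrightarrow> t < \<theta> \<Longrightarrow> \<exists>\<rho>>0. \<forall>r. 0 < r \<longrightarrow> r < \<rho> \<longrightarrow> ennreal (t * r powr \<alpha>) < \<mu> (hball d x r)"
  shows "upper_density d \<alpha> \<mu> x = federer_density d \<alpha> \<mu> x"
proof (rule antisym[OF upper_le_federer[OF \<alpha>]])
  have fedt: "federer_density d \<alpha> \<mu> x \<le> ennreal t" if t: "\<theta> < t" for t
  proof -
    obtain \<rho> where \<rho>: "\<rho> > 0" "\<And>y r. x \<in> hball d y r \<Longrightarrow> 0 < r \<Longrightarrow> r < \<rho> \<Longrightarrow> \<mu> (hball d y r) \<le> ennreal (t * r powr \<alpha>)"
      using up[OF t] by blast
    have "federer_density d \<alpha> \<mu> x \<le> Sup {ennreal (2 powr \<alpha>) * \<mu> (hball d y r) / ennreal (hdiam d (hball d y r) powr \<alpha>) | y r.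
        x \<in> hball d y r \<and> 0 < r \<and> r < \<rho>}"
      unfolding federer_density_def using \<rho>(1) by (intro INF_lower) auto
    also have "\<dots> \<le> ennreal t"
    proof (rule Sup_least, elim CollectE exE conjE)
      fix s y r assume s: "s = ennreal (2 powr \<alpha>) * \<mu> (hball d y r) / ennreal (hdiam d (hball d y r) powr \<alpha>)"
        and r: "x \<in> hball d y r" "0 < r" "r < \<rho>"
      have "s \<le> ennreal (2 powr \<alpha>) * ennreal (t * r powr \<alpha>) / ennreal (hdiam d (hball d y r) powr \<alpha>)"
        unfolding s by (intro divide_right_mono_ennreal mult_left_mono \<rho>(2) r) simp
      also have "\<dots> = ennreal t"
        using r t \<theta> by (simp add: ennreal_mult[symmetric] divide_ennreal powr_mult)
      finally show "s \<le> ennreal t" .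
    qed
    finally show ?thesis .
  qed
  have fed: "federer_density d \<alpha> \<mu> x \<le> ennreal \<theta>"
  proof (rule ennreal_le_epsilon)
    fix e :: real assume "0 < e"
    then show "federer_density d \<alpha> \<mu> x \<le> ennreal \<theta> + ennreal e"
      using fedt[of "\<theta> + e"] \<theta> by (simp add: ennreal_plus)
  qed
  have upt: "ennreal t \<le> upper_density d \<alpha> \<mu> x" if t: "0 \<le> t" "t < \<theta>" for t
  proof -
    obtain \<rho> where \<rho>: "\<rho> > 0" "\<And>r. 0 < r \<Longrightarrow> r < \<rho> \<Longrightarrow> ennreal (t * r powr \<alpha>) < \<mu> (hball d x r)"
      using low[OF t] by blast
    have "\<forall>\<^sub>F r in at_right 0. ennreal t \<le> \<mu> (hball d x r) / ennreal (r powr \<alpha>)"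
      unfolding eventually_at_right_field
    proof (intro exI[of _ \<rho>] conjI allI impI)
      fix r :: real assume r: "0 < r" "r < \<rho>"
      have "ennreal t = ennreal (t * r powr \<alpha>) / ennreal (r powr \<alpha>)"
        using r t by (simp add: divide_ennreal)
      also have "\<dots> \<le> \<mu> (hball d x r) / ennreal (r powr \<alpha>)"
        using \<rho>(2)[OF r] by (intro divide_right_mono_ennreal) auto
      finally show "ennreal t \<le> \<mu> (hball d x r) / ennreal (r powr \<alpha>)" .
    qed (rule \<rho>(1))
    then show ?thesis unfolding upper_density_def by (intro le_Limsup) auto
  qed
  have "ennreal \<theta> \<le> upper_density d \<alpha> \<mu> x"
  proof (rule dense_le)
    fix a assume a: "a < ennreal \<theta>"
    then obtain t where "a = ennreal t" "t \<ge> 0" by (cases a) auto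
    then show "a \<le> upper_density d \<alpha> \<mu> x" using upt[of t] a by (simp add: ennreal_less_iff)
  qed
  then show "federer_density d \<alpha> \<mu> x \<le> upper_density d \<alpha> \<mu> x" using fed by (rule order_trans[rotated])
qed

end

section \<open>The Jacobian ratio\<close>

text \<open>The mechanism of \<open>hom_linear\<close>: the centre is sent to 0, after which
  products act as sums and dilations as scalars.\<close>

lemma h_hom_vec_linear:
  fixes L :: "'n::finite heis \<Rightarrow> 'b::real_normed_vector"
  assumes L: "h_hom_vec L"
  shows "linear L" and "L (0, t) = 0"
proof -
  have hmul: "L (x \<odot> y) = L x + L y" for x y using L by (simp add: h_hom_vec_def)
  have dl: "L (dil t x) = t *\<^sub>R L x" if "t > 0" for t x using L that by (simp add: h_hom_vec_def)
  have vert: "L (0, t) = 0" for t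
  proof -
    have "(0, t) \<odot> (0, t) = dil (sqrt 2) ((0, t) :: 'n heis)" by (rule prod_eqI) simp_all
    then have "L (0, t) + L (0, t) = sqrt 2 *\<^sub>R L (0, t)"
      using hmul[of "(0, t)" "(0, t)"] dl[of "sqrt 2" "(0, t)"] by simp
    then have "(2 - sqrt 2) *\<^sub>R L (0, t) = 0" by (simp add: scaleR_diff_left scaleR_2)
    then show ?thesis using sqrt_2_neq_2 by auto
  qed
  then show "L (0, t) = 0" .
  have split: "L x = L (fst x, 0)" for x
  proof -
    have "x = (fst x, 0) \<odot> (0, snd x)" by (rule prod_eqI) simp_all
    then show ?thesis using hmul[of "(fst x, 0)" "(0, snd x)"] vert by simp
  qed
  have add: "L (x + y) = L x + L y" for x y
  proof -
    have "L (x \<odot> y) = L (x + y)" using split[of "x \<odot> y"] split[of "x + y"] by simp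
    then show ?thesis by (simp add: hmul)
  qed
  have pos: "L (c *\<^sub>R x) = c *\<^sub>R L x" if "c > 0" for c x
    using dl[OF that, of x] split[of "dil c x"] split[of "c *\<^sub>R x"] by simp
  have "L 0 = 0" using add[of 0 0] by simp
  then have neg: "L (- x) = - L x" for x
    using add[of x "- x"] by (simp add: eq_neg_iff_add_eq_0 add.commute)
  show "linear L"
  proof (rule linearI[OF add])
    show "L (c *\<^sub>R x) = c *\<^sub>R L x" for c x
    proof -
      consider "c > 0" | "c = 0" | "c < 0" by linarith
      then show ?thesis
      proof cases
        case 3
        then have "L ((- c) *\<^sub>R (- x)) = (- c) *\<^sub>R L (- x)" by (intro pos) auto
        then show ?thesis by (simp add: neg)
      qed (use pos \<open>L 0 = 0\<close> in auto)
    qed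
  qed
qed

lemma continuous_on_wedge_norm:
  fixes u :: "'a::topological_space \<Rightarrow> 'i::finite \<Rightarrow> 'b::real_inner"
  assumes "\<And>i. continuous_on A (\<lambda>x. u x i)"
  shows "continuous_on A (\<lambda>x. wedge_norm (u x))"
proof -
  have "continuous_on A (\<lambda>x. det ((\<chi> i j. u x i \<bullet> u x j) :: real ^ 'i ^ 'i))"
    unfolding det_def by (simp, intro continuous_intros assms)
  then show ?thesis
    unfolding wedge_norm_def wedge_inner_def by (intro continuous_intros)
qed

section \<open>Horizontal differentials and gradients\<close>

context hdist begin

lemma has_hderiv_eps:
  assumes "has_hderiv d f x L" "\<epsilon> > 0"
  obtains e where "e > 0" "\<And>z. N z < e \<Longrightarrow> norm (f (x \<odot> z) - f x - L z) \<le> \<epsilon> * N z"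
proof -
  have L: "h_hom_vec L" and lim: "((\<lambda>z. norm (f (x \<odot> z) - f x - L z) / N z) \<longlongrightarrow> 0) (at 0)"
    using assms(1) by (auto simp: has_hderiv_def)
  have "\<forall>\<^sub>F z in at 0. norm (f (x \<odot> z) - f x - L z) / N z < \<epsilon>"
    using assms(2) by (intro order_tendstoD(2)[OF lim])
  then obtain D where D: "open D" "0 \<in> D" "\<And>z. z \<in> D \<Longrightarrow> z \<noteq> 0 \<Longrightarrow> norm (f (x \<odot> z) - f x - L z) / N z < \<epsilon>"
    unfolding eventually_at_topological by auto
  obtain e where e: "e > 0" "\<And>z. d 0 z < e \<Longrightarrow> z \<in> D"
    by (rule open_contains_N[OF D(1,2)]) (rule that)
  show ?thesis
  proof (rule that[OF e(1)])
    fix z assume z: "N z < e"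
    show "norm (f (x \<odot> z) - f x - L z) \<le> \<epsilon> * N z"
    proof (cases "z = 0")
      case True
      then show ?thesis using linear_0[OF h_hom_vec_linear(1)[OF L]] by simp
    next
      case False
      have "z \<in> D" using z by (intro e(2)) (simp add: d_eq_N[of 0])
      then have "norm (f (x \<odot> z) - f x - L z) / N z < \<epsilon>" using D(3) False by blast
      moreover have "N z > 0" using False by simp
      ultimately show ?thesis by (simp add: divide_less_eq)
    qed
  qed
qed

text \<open>The two maps differ by o(N z) near 0, and homogeneity carries this estimate to every z.
  Uniqueness makes the definite description \<open>hderiv\<close> meaningful.\<close>

lemma has_hderiv_unique:
  assumes "has_hderiv d f x L" "has_hderiv d f x L'"
  shows "L = L'"
proof
  fix z
  have L: "h_hom_vec L" "h_hom_vec L'" using assms by (auto simp: has_hderiv_def)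
  have le: "norm (L z - L' z) \<le> \<epsilon> * (2 * N z)" if \<epsilon>: "\<epsilon> > 0" for \<epsilon>
  proof -
    obtain e where e: "e > 0" "\<And>z. N z < e \<Longrightarrow> norm (f (x \<odot> z) - f x - L z) \<le> \<epsilon> * N z"
      by (rule has_hderiv_eps[OF assms(1) \<epsilon>]) (rule that)
    obtain e' where e': "e' > 0" "\<And>z. N z < e' \<Longrightarrow> norm (f (x \<odot> z) - f x - L' z) \<le> \<epsilon> * N z"
      by (rule has_hderiv_eps[OF assms(2) \<epsilon>]) (rule that)
    define s where "s = min e e' / (N z + 1)"
    have N1: "N z + 1 > 0" using N_nonneg[of z] by linarith
    have s: "s > 0" using e(1) e'(1) N1 by (simp add: s_def)
    have "s * N z < s * (N z + 1)" using s by simp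
    also have "\<dots> = min e e'" using N1 by (simp add: s_def)
    finally have small: "N (dil s z) < e" "N (dil s z) < e'" using s by simp_all
    have "norm (L (dil s z) - L' (dil s z)) = norm ((f (x \<odot> dil s z) - f x - L' (dil s z)) - (f (x \<odot> dil s z) - f x - L (dil s z)))"
      by simp
    also have "\<dots> \<le> \<epsilon> * N (dil s z) + \<epsilon> * N (dil s z)"
      by (rule order_trans[OF norm_triangle_ineq4]) (intro add_mono e(2) e'(2) small)
    finally have "s * norm (L z - L' z) \<le> s * (\<epsilon> * (2 * N z))"
      using s L by (simp add: h_hom_vec_def flip: scaleR_diff_right)
    then show ?thesis using s by simp
  qed
  have "norm (L z - L' z) \<le> 0"
  proof (rule field_le_epsilon)
    fix e :: real assume e: "e > 0"
    have "N z + 1 > 0" using N_nonneg[of z] by linarith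
    then have "norm (L z - L' z) \<le> e / (2 * (N z + 1)) * (2 * N z)" using e by (intro le) simp
    also have "\<dots> = e * (N z / (N z + 1))" using \<open>N z + 1 > 0\<close> by (simp add: field_simps)
    also have "\<dots> \<le> e * 1" using e \<open>N z + 1 > 0\<close> by (intro mult_left_mono) (auto simp: divide_le_eq)
    finally show "norm (L z - L' z) \<le> 0 + e" by simp
  qed
  then show "L z = L' z" by simp
qed

lemma hderiv_eq: "has_hderiv d f x L \<Longrightarrow> hderiv d f x = L"
  unfolding hderiv_def using has_hderiv_unique by (intro the_equality)

lemma has_hderiv_component:
  fixes f :: "'n heis \<Rightarrow> real ^ 'k::finite"
  assumes "has_hderiv d f x L"
  shows "has_hderiv d (\<lambda>y. f y $ i) x (\<lambda>z. L z $ i)"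
proof -
  have "h_hom_vec (\<lambda>z. L z $ i)" using assms by (simp add: has_hderiv_def h_hom_vec_def)
  moreover have "((\<lambda>z. norm (f (x \<odot> z) $ i - f x $ i - L z $ i) / N z) \<longlongrightarrow> 0) (at 0)"
  proof (rule Lim_null_comparison)
    show "((\<lambda>z. norm (f (x \<odot> z) - f x - L z) / N z) \<longlongrightarrow> 0) (at 0)"
      using assms by (simp add: has_hderiv_def)
    show "\<forall>\<^sub>F z in at 0. norm (norm (f (x \<odot> z) $ i - f x $ i - L z $ i) / N z) \<le> norm (f (x \<odot> z) - f x - L z) / N z"
    proof (intro always_eventually allI)
      fix z
      have "norm (f (x \<odot> z) $ i - f x $ i - L z $ i) \<le> norm (f (x \<odot> z) - f x - L z)"
        using component_le_norm_cart[of "f (x \<odot> z) - f x - L z" i] by simp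
      then show "norm (norm (f (x \<odot> z) $ i - f x $ i - L z $ i) / N z) \<le> norm (f (x \<odot> z) - f x - L z) / N z"
        by (simp add: divide_right_mono)
    qed
  qed
  ultimately show ?thesis by (simp add: has_hderiv_def)
qed

lemma hderiv_props:
  fixes f :: "'n heis \<Rightarrow> real ^ 'k::finite"
  assumes f: "C1h d \<Omega> f" and x: "x \<in> \<Omega>"
  shows "has_hderiv d f x (hderiv d f x)" and "h_hom_vec (hderiv d f x)"
    and "hderiv d (\<lambda>y. f y $ i) x z = hderiv d f x z $ i"
    and "continuous_on \<Omega> (\<lambda>x. hderiv d f x z)"
proof -
  obtain L where L: "has_hderiv d f x L" using f x by (auto simp: C1h_def)
  then show D: "has_hderiv d f x (hderiv d f x)" using hderiv_eq[OF L] by simp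
  then show "h_hom_vec (hderiv d f x)" by (simp add: has_hderiv_def)
  show "hderiv d (\<lambda>y. f y $ i) x z = hderiv d f x z $ i"
    using hderiv_eq[OF has_hderiv_component[OF D]] by simp
  have "continuous_on \<Omega> (hderiv d f)" using f by (simp add: C1h_def)
  then show "continuous_on \<Omega> (\<lambda>x. hderiv d f x z)"
    by (rule continuous_on_product_then_coordinatewise)
qed

text \<open>Turns the definite description into a finite sum that is visibly continuous in the
  differential; the sum is horizontal because the differential kills the centre.\<close>

lemma hgrad_eq:
  fixes f :: "'n heis \<Rightarrow> real ^ 'k::finite"
  assumes f: "C1h d \<Omega> f" and x: "x \<in> \<Omega>"
  shows "hgrad d (\<lambda>y. f y $ i) x = (\<Sum>b\<in>Basis. (hderiv d f x b $ i) *\<^sub>R b)"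
  unfolding hgrad_def
proof (rule the_equality)
  let ?L = "hderiv d f x" and ?u = "\<Sum>b\<in>Basis. (hderiv d f x b $ i) *\<^sub>R b"
  have lin: "linear (\<lambda>z. ?L z $ i)"
    using h_hom_vec_linear(1)[OF hderiv_props(2)[OF f x]] by (intro linearI) (simp_all add: linear_add linear_scale)
  have "?u \<bullet> z = ?L z $ i" for z
  proof -
    have "?L z $ i = ?L (\<Sum>b\<in>Basis. (z \<bullet> b) *\<^sub>R b) $ i" by (simp add: euclidean_representation)
    also have "\<dots> = (\<Sum>b\<in>Basis. (z \<bullet> b) * ?L b $ i)"
      using linear_sum[OF lin, of "\<lambda>b. (z \<bullet> b) *\<^sub>R b" Basis] by (simp add: linear_scale[OF lin])
    also have "\<dots> = ?u \<bullet> z" by (simp add: inner_sum_left inner_commute[of z] mult.commute)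
    finally show ?thesis by simp
  qed
  note u = this
  have "snd ?u = ?u \<bullet> (0, 1)" by (simp add: inner_prod_def)
  also have "\<dots> = 0" unfolding u using h_hom_vec_linear(2)[OF hderiv_props(2)[OF f x], of 1] by simp
  finally show "?u \<in> H1 \<and> (\<forall>z. hderiv d (\<lambda>y. f y $ i) x z = ?u \<bullet> z)"
    using u hderiv_props(3)[OF f x] by (simp add: H1_def)
  fix u' assume "u' \<in> H1 \<and> (\<forall>z. hderiv d (\<lambda>y. f y $ i) x z = u' \<bullet> z)"
  then have "\<forall>z. u' \<bullet> z = ?u \<bullet> z" using u hderiv_props(3)[OF f x] by simp
  then show "u' = ?u" by (simp only: vector_eq_rdot)
qed

lemma vgrad_eq:
  fixes f :: "'n heis \<Rightarrow> real ^ 'k::finite" and v :: "'j::finite \<Rightarrow> 'n heis"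
  assumes f: "C1h d \<Omega> f" and x: "x \<in> \<Omega>" and v: "orthonormal_basis v V"
  shows "vgrad d V (\<lambda>y. f y $ i) x = (\<Sum>l\<in>UNIV. (hderiv d f x (v l) $ i) *\<^sub>R v l)"
  unfolding vgrad_def
proof (rule the_equality)
  let ?L = "hderiv d f x" and ?u = "\<Sum>l\<in>UNIV. (hderiv d f x (v l) $ i) *\<^sub>R v l"
  have vv: "v l \<bullet> v j = (if l = j then 1 else 0)" for l j
    using v by (auto simp: orthonormal_basis_def)
  have V: "V = span (range v)" using v by (simp add: orthonormal_basis_def)
  have lin: "linear (\<lambda>z. ?L z $ i)"
    using h_hom_vec_linear(1)[OF hderiv_props(2)[OF f x]] by (intro linearI) (simp_all add: linear_add linear_scale)
  have "linear (\<lambda>z. ?u \<bullet> z)" by (intro linearI) (simp_all add: inner_add_right)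
  moreover have "?L z $ i = ?u \<bullet> z" if "z \<in> range v" for z
  proof -
    obtain j where "z = v j" using \<open>z \<in> range v\<close> by blast
    have "?u \<bullet> v j = (\<Sum>l\<in>UNIV. ?L (v l) $ i * (if l = j then 1 else 0))"
      by (simp add: inner_sum_left vv)
    also have "\<dots> = (\<Sum>l\<in>UNIV. if l = j then ?L (v l) $ i else 0)" by (rule sum.cong) auto
    also have "\<dots> = ?L (v j) $ i" by simp
    finally show ?thesis using \<open>z = v j\<close> by simp
  qed
  ultimately have u: "?L z $ i = ?u \<bullet> z" if "z \<in> V" for z
    using linear_eq_on_span[OF lin, of "\<lambda>z. ?u \<bullet> z" "range v" z] that unfolding V by blast
  have uV: "?u \<in> V" unfolding V by (intro span_sum span_scale span_base) auto
  then show "?u \<in> V \<and> (\<forall>z\<in>V. hderiv d (\<lambda>y. f y $ i) x z = ?u \<bullet> z)"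
    using u hderiv_props(3)[OF f x] by simp
  fix u' assume u': "u' \<in> V \<and> (\<forall>z\<in>V. hderiv d (\<lambda>y. f y $ i) x z = u' \<bullet> z)"
  then have eq: "u' \<bullet> z = ?u \<bullet> z" if "z \<in> V" for z using u hderiv_props(3)[OF f x] that by simp
  have "u' - ?u \<in> V" using u' uV unfolding V by (intro span_diff) auto
  then have "(u' - ?u) \<bullet> (u' - ?u) = 0" using eq[of "u' - ?u"] by (simp add: inner_diff_left)
  then show "u' = ?u" by simp
qed

text \<open>With A the square matrix of the differential on the orthonormal basis of V, the Gram
  matrix is A times its transpose. So the Jacobian is |det A|, and A is invertible because the
  differential maps V onto.\<close>

lemma JV_nonzero:
  fixes f :: "'n heis \<Rightarrow> real ^ 'k::finite" and v :: "'k \<Rightarrow> 'n heis"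
  assumes f: "C1h d \<Omega> f" and x: "x \<in> \<Omega>" and v: "orthonormal_basis v V"
    and onto: "\<And>y. \<exists>z\<in>V. hderiv d f x z = y"
  shows "JV d V f x \<noteq> 0"
proof -
  let ?L = "hderiv d f x"
  have vv: "v l \<bullet> v j = (if l = j then 1 else 0)" for l j
    using v by (auto simp: orthonormal_basis_def)
  have V: "V = span (range v)" using v by (simp add: orthonormal_basis_def)
  have lin: "linear ?L" by (rule h_hom_vec_linear(1)[OF hderiv_props(2)[OF f x]])
  define A :: "real ^ 'k ^ 'k" where "A = (\<chi> i l. ?L (v l) $ i)"
  have "(\<chi> i j. vgrad d V (\<lambda>y. f y $ i) x \<bullet> vgrad d V (\<lambda>y. f y $ j) x) = A ** transpose A"
    unfolding vgrad_eq[OF f x v] A_def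
    by (simp add: vec_eq_iff matrix_matrix_mult_def transpose_def inner_sum_left inner_sum_right vv
        if_distrib sum.delta cong: if_cong) (simp add: mult.commute)
  then have J: "JV d V f x = \<bar>det A\<bar>"
    unfolding JV_def wedge_norm_def wedge_inner_def by (simp add: det_mul)
  have "surj ((*v) A)"
    unfolding surj_def
  proof
    fix y
    obtain z where z: "z \<in> V" "?L z = y" using onto by blast
    have "linear (\<lambda>z. z)" "linear (\<lambda>z. \<Sum>l\<in>UNIV. (z \<bullet> v l) *\<^sub>R v l)"
      by (intro linearI; simp add: inner_add_left scaleR_add_left sum.distrib scaleR_sum_right)+
    moreover have "x = (\<Sum>l\<in>UNIV. (x \<bullet> v l) *\<^sub>R v l)" if xv: "x \<in> range v" for x
    proof -
      obtain j where "x = v j" using xv by blast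
      moreover have "(v j \<bullet> v l) *\<^sub>R v l = (if l = j then v l else 0)" for l by (simp add: vv)
      ultimately show ?thesis by (simp add: sum.delta)
    qed
    ultimately have "z = (\<Sum>l\<in>UNIV. (z \<bullet> v l) *\<^sub>R v l)"
      using linear_eq_on_span[of "\<lambda>z. z" "\<lambda>z. \<Sum>l\<in>UNIV. (z \<bullet> v l) *\<^sub>R v l" "range v" z] z(1) unfolding V by blast
    then have "y = (\<Sum>l\<in>UNIV. (z \<bullet> v l) *\<^sub>R ?L (v l))"
      using z(2) linear_sum[OF lin, of "\<lambda>l. (z \<bullet> v l) *\<^sub>R v l" UNIV] by (simp add: linear_scale[OF lin])
    then have "A *v (\<chi> l. z \<bullet> v l) = y"
      by (simp add: A_def matrix_vector_mult_def vec_eq_iff mult.commute)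
    then show "\<exists>x. y = A *v x" by blast
  qed
  then have "det A \<noteq> 0"
    by (simp add: matrix_right_invertible_surjective[symmetric] invertible_right_inverse[symmetric] invertible_det_nz)
  then show ?thesis by (simp add: J)
qed

end

section \<open>The defining function along the surface\<close>

context intrinsic_graph begin

text \<open>The tangent group lies in the kernel of the differential. At scale r the dilated tangent
  point is within o(r) of a displacement z along the surface; f does not change along z, so L z =
  o(r), and L is bounded by a multiple of \<open>N\<close>. Dividing by r gives the claim.\<close>

lemma hderiv_tangent:
  fixes f :: "'n heis \<Rightarrow> 'b::real_normed_vector"
  assumes u0: "u0 \<in> U" and D: "has_hderiv d f (\<Phi> u0) L" and const: "\<And>u. u \<in> U \<Longrightarrow> f (\<Phi> u) = c"
  shows "L (tangent (der u0) p) = 0"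
proof -
  let ?T = "tangent (der u0) p"
  have L: "h_hom_vec L" using D by (simp add: has_hderiv_def)
  have H: "h_hom_sub W V (der u0)" by (rule der_hom[OF u0])
  have lin: "linear L" by (rule h_hom_vec_linear(1)[OF L])
  have hmul: "L (x \<odot> y) = L x + L y" for x y using L by (simp add: h_hom_vec_def)
  have dl: "L (dil t x) = t *\<^sub>R L x" if "t > 0" for t x using L that by (simp add: h_hom_vec_def)
  have cont: "continuous_on {x. N x \<le> 1} L"
    using lin by (simp add: linear_conv_bounded_linear linear_continuous_on)
  then have "bounded (L ` {x. N x \<le> 1})"
    by (intro compact_imp_bounded compact_continuous_image compact_N)
  then obtain K where K: "K > 0" "\<And>x. N x \<le> 1 \<Longrightarrow> norm (L x) \<le> K"
    unfolding bounded_pos by auto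
  have LK: "norm (L x) \<le> K * N x" for x
  proof (cases "x = 0")
    case True
    then show ?thesis using linear_0[OF lin] by simp
  next
    case False
    then have n: "1 / N x > 0" by simp
    have "norm (L (dil (1 / N x) x)) \<le> K" using False N_dil[OF n, of x] by (intro K(2)) simp
    then show ?thesis using dl[OF n, of x] False by (simp add: field_simps)
  qed
  have est: "norm (L ?T) \<le> \<epsilon> * (N ?T + N (\<iota> p) + K * N (\<iota> p))" if \<epsilon>: "0 < \<epsilon>" "\<epsilon> \<le> 1" for \<epsilon>
  proof -
    obtain e where e: "e > 0" "\<And>z. N z < e \<Longrightarrow> norm (f (\<Phi> u0 \<odot> z) - f (\<Phi> u0) - L z) \<le> \<epsilon> * N z"
      by (rule has_hderiv_eps[OF D \<epsilon>(1)]) (rule that)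
    obtain \<delta> where \<delta>: "\<delta> > 0"
      "\<And>p r. r > 0 \<Longrightarrow> N (dil r (\<iota> p)) < \<delta> \<Longrightarrow> tr u0 (\<phi> u0) (dil r (\<iota> p)) \<in> U"
      "\<And>p r. r > 0 \<Longrightarrow> N (dil r (\<iota> p)) < \<delta> \<Longrightarrow>
        d (\<Phi> u0 \<odot> dil r (tangent (der u0) p)) (\<Phi> (tr u0 (\<phi> u0) (dil r (\<iota> p)))) \<le> \<epsilon> * N (dil r (\<iota> p))"
      by (rule graph_blowup[OF u0 \<epsilon>(1)]) (rule that)
    define M where "M = N ?T + N (\<iota> p) + 1"
    have M: "M > 0" "N (\<iota> p) < M" "N ?T + N (\<iota> p) < M"
      using N_nonneg[of ?T] N_nonneg[of "\<iota> p"] unfolding M_def by linarith+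
    \<comment> \<open>Small enough that both the parameter and the displacement z stay below their
      thresholds.\<close>
    define r where "r = min e \<delta> / M"
    have r: "r > 0" using e(1) \<delta>(1) M by (simp add: r_def)
    have rM: "r * M = min e \<delta>" using M by (simp add: r_def)
    have "r * N (\<iota> p) < r * M" using r M by simp
    then have small: "N (dil r (\<iota> p)) < \<delta>" using r rM by simp
    define u where "u = tr u0 (\<phi> u0) (dil r (\<iota> p))"
    have uU: "u \<in> U" unfolding u_def by (rule \<delta>(2)[OF r small])
    define z where "z = hinv (\<Phi> u0) \<odot> \<Phi> u"
    have \<Phi>u: "\<Phi> u = \<Phi> u0 \<odot> z" by (simp add: z_def)
    have close: "d (dil r ?T) z \<le> r * (\<epsilon> * N (\<iota> p))"
      using \<delta>(3)[OF r small] r unfolding u_def[symmetric] \<Phi>u by (simp add: mult_ac)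
    have "N z \<le> N (dil r ?T) + d (dil r ?T) z"
      using d_triangle[of z 0 "dil r ?T"] by (simp add: hnorm_def d_commute)
    also have "\<dots> \<le> r * N ?T + r * (\<epsilon> * N (\<iota> p))" using close r by simp
    finally have Nz1: "N z \<le> r * (N ?T + \<epsilon> * N (\<iota> p))" by (simp add: algebra_simps)
    have "\<epsilon> * N (\<iota> p) \<le> N (\<iota> p)" using \<epsilon> by (simp add: mult_left_le_one_le)
    then have "r * (N ?T + \<epsilon> * N (\<iota> p)) \<le> r * (N ?T + N (\<iota> p))" using r by (intro mult_left_mono) auto
    then have Nz: "N z \<le> r * (N ?T + N (\<iota> p))" using Nz1 by simp
    also have "\<dots> < r * M" using r M by (intro mult_strict_left_mono) auto
    finally have "N z < e" using rM by simp
    then have "norm (f (\<Phi> u0 \<odot> z) - f (\<Phi> u0) - L z) \<le> \<epsilon> * N z" by (rule e(2))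
    moreover have "f (\<Phi> u0 \<odot> z) = f (\<Phi> u0)" using const[OF uU] const[OF u0] unfolding \<Phi>u by simp
    ultimately have "norm (L z) \<le> \<epsilon> * N z" by simp
    also have "\<dots> \<le> \<epsilon> * (r * (N ?T + N (\<iota> p)))" using Nz \<epsilon> by (intro mult_left_mono) auto
    finally have Lz: "norm (L z) \<le> \<epsilon> * (r * (N ?T + N (\<iota> p)))" .
    have "dil r ?T = z \<odot> (hinv z \<odot> dil r ?T)" by simp
    then have "L (dil r ?T) = L z + L (hinv z \<odot> dil r ?T)" by (metis hmul)
    then have "norm (L (dil r ?T)) \<le> norm (L z) + norm (L (hinv z \<odot> dil r ?T))" by (simp add: norm_triangle_ineq)
    also have "norm (L (hinv z \<odot> dil r ?T)) \<le> K * N (hinv z \<odot> dil r ?T)" by (rule LK)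
    also have "N (hinv z \<odot> dil r ?T) = d (dil r ?T) z" by (simp add: d_eq_N[of z] d_commute[of "dil r ?T"])
    also have "K * d (dil r ?T) z \<le> K * (r * (\<epsilon> * N (\<iota> p)))" using close K by (intro mult_left_mono) auto
    finally have "r * norm (L ?T) \<le> \<epsilon> * (r * (N ?T + N (\<iota> p))) + K * (r * (\<epsilon> * N (\<iota> p)))"
      using Lz r by (simp add: dl)
    also have "\<dots> = r * (\<epsilon> * (N ?T + N (\<iota> p) + K * N (\<iota> p)))" by (simp add: algebra_simps)
    finally show ?thesis using r by simp
  qed
  let ?C = "N ?T + N (\<iota> p) + K * N (\<iota> p)"
  have C0: "?C \<ge> 0" using K(1) by (intro add_nonneg_nonneg mult_nonneg_nonneg) auto
  have "norm (L ?T) \<le> 0"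
  proof (rule ccontr)
    assume "\<not> norm (L ?T) \<le> 0"
    then have n: "norm (L ?T) > 0" by simp
    define \<epsilon> where "\<epsilon> = min 1 (norm (L ?T) / (2 * (?C + 1)))"
    have "\<epsilon> > 0" "\<epsilon> \<le> 1" using n C0 by (auto simp: \<epsilon>_def)
    then have "norm (L ?T) \<le> \<epsilon> * ?C" by (rule est)
    also have "\<dots> \<le> norm (L ?T) / (2 * (?C + 1)) * (?C + 1)"
      using C0 n by (intro mult_mono) (auto simp: \<epsilon>_def)
    also have "\<dots> = norm (L ?T) / 2"
    proof -
      have half: "x / (2 * y) * y = x / 2" if "y > 0" for x y :: real using that by simp
      show ?thesis by (rule half) (use C0 in linarith)
    qed
    finally show False using n by simp
  qed
  then show ?thesis by simp
qed

text \<open>Write x = a b with a in W and b in V. The differential vanishes on a times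
  \<open>der u0 a\<close>, so a may be replaced by the inverse of \<open>der u0 a\<close>, which
  lies in V.\<close>

lemma hderiv_onto_V:
  fixes f :: "'n heis \<Rightarrow> real ^ 'k::finite"
  assumes u0: "u0 \<in> U" and D: "has_hderiv d f (\<Phi> u0) L" and const: "\<And>u. u \<in> U \<Longrightarrow> f (\<Phi> u) = c"
    and onto: "surj L"
  shows "\<exists>z\<in>V. L z = y"
proof -
  have H: "h_hom_sub W V (der u0)" by (rule der_hom[OF u0])
  have hmul: "L (x \<odot> y) = L x + L y" for x y using D by (simp add: has_hderiv_def h_hom_vec_def)
  obtain x where x: "L x = y" using onto by (metis surjD)
  obtain a b where ab: "a \<in> W" "b \<in> V" "x = a \<odot> b" by (rule WV_cases)
  obtain p where p: "a = \<iota> p" using ab(1) range_\<iota> by blast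
  have "L (a \<odot> der u0 a) = 0" using hderiv_tangent[OF u0 D const, of p] by (simp add: tangent_def p)
  then have "L a = L (hinv (der u0 a))"
    using hmul[of a "der u0 a"] hmul[of "hinv (der u0 a)" "der u0 a"] hmul[of 0 0] by (simp add: add_eq_0_iff2)
  then have "L (hinv (der u0 a) \<odot> b) = y" using x ab(3) by (simp add: hmul)
  moreover have "hinv (der u0 a) \<odot> b \<in> V" using hom_in_V[OF H ab(1)] ab(2) by (intro V_group)
  ultimately show ?thesis by blast
qed

text \<open>The density estimates require a continuous weight. The denominator does not vanish
  because f is constant on the surface and its differential is surjective there.\<close>

lemma continuous_on_jacobian_ratio:
  fixes f :: "'n heis \<Rightarrow> real ^ 'k::finite" and v :: "'k \<Rightarrow> 'n heis"
  assumes f: "defining_function d V U (\<Phi> ` U) \<Omega> f" and v: "orthonormal_basis v V"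
  shows "continuous_on U (\<lambda>u. JH d f (\<Phi> u) / JV d V f (\<Phi> u))"
proof -
  have f1: "C1h d \<Omega> f" and sub: "\<Phi> ` U \<subseteq> \<Omega>" and surj: "\<And>u. u \<in> U \<Longrightarrow> surj (hderiv d f (\<Phi> u))"
    using f by (auto simp: defining_function_def)
  obtain c where c: "\<And>u. u \<in> U \<Longrightarrow> f (\<Phi> u) = c"
  proof -
    obtain x0 where "{y\<in>\<Omega>. f y = f x0} \<inter> hsetmul U V = \<Phi> ` U"
      using f unfolding defining_function_def by blast
    then have "f (\<Phi> u) = f x0" if "u \<in> U" for u using that by blast
    then show ?thesis using that by blast
  qed
  have JV0: "JV d V f (\<Phi> u) \<noteq> 0" if u: "u \<in> U" for u
  proof (rule JV_nonzero[OF f1 _ v])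
    show x: "\<Phi> u \<in> \<Omega>" using sub u by blast
    show "\<exists>z\<in>V. hderiv d f (\<Phi> u) z = y" for y
      by (rule hderiv_onto_V[OF u hderiv_props(1)[OF f1 x] c surj[OF u]])
  qed
  have comp: "continuous_on U (\<lambda>u. hderiv d f (\<Phi> u) z $ i)" for z i
  proof (cases "U = {}")
    case False
    then obtain u where "u \<in> U" by blast
    then have "\<Phi> u \<in> \<Omega>" using sub by blast
    from hderiv_props(4)[OF f1 this, of z]
    have "continuous_on U (\<lambda>u. hderiv d f (\<Phi> u) z)"
      by (rule continuous_on_compose2[OF _ continuous_on_\<Phi> sub])
    then show ?thesis by (rule continuous_on_component)
  qed simp
  have "continuous_on U (\<lambda>u. JH d f (\<Phi> u))"
    unfolding JH_def
  proof (rule continuous_on_wedge_norm)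
    fix i :: 'k
    have "continuous_on U (\<lambda>u. \<Sum>b\<in>Basis. (hderiv d f (\<Phi> u) b $ i) *\<^sub>R b)"
      by (intro continuous_intros comp)
    then show "continuous_on U (\<lambda>u. hgrad d (\<lambda>y. f y $ i) (\<Phi> u))"
      by (rule continuous_on_eq) (use sub in \<open>simp add: hgrad_eq[OF f1] image_subset_iff\<close>)
  qed
  moreover have "continuous_on U (\<lambda>u. JV d V f (\<Phi> u))"
    unfolding JV_def
  proof (rule continuous_on_wedge_norm)
    fix i :: 'k
    have "continuous_on U (\<lambda>u. \<Sum>l\<in>UNIV. (hderiv d f (\<Phi> u) (v l) $ i) *\<^sub>R v l)"
      by (intro continuous_intros comp)
    then show "continuous_on U (\<lambda>u. vgrad d V (\<lambda>y. f y $ i) (\<Phi> u))"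
      by (rule continuous_on_eq) (use sub in \<open>simp add: vgrad_eq[OF f1 _ v] image_subset_iff\<close>)
  qed
  ultimately show ?thesis using JV0 by (intro continuous_on_divide) auto
qed

text \<open>
  Only the translation invariance of the Hausdorff measure enters, so it is identified with
  Lebesgue measure on \<open>W\<close> up to a constant whose value is immaterial.
\<close>

lemma surface_measure_eq_graph_measure:
  fixes f :: "'n heis \<Rightarrow> real ^ 'k::finite" and v :: "'k \<Rightarrow> 'n heis"
  assumes f: "defining_function d V U (\<Phi> ` U) \<Omega> f" and v: "orthonormal_basis v V"
    and p: "2 * CARD('n) + 1 - CARD('k) = DIM((real ^ 'm) \<times> real)"
  obtains g where "continuous_on U g" "\<And>u. g u \<ge> 0"
    "\<And>B. B \<in> sets borel \<Longrightarrow>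
      surface_measure d V U \<phi> f v (case_option e_last w) B = emeasure (graph_measure g) B"
proof -
  obtain c where c: "c \<ge> 0" "\<And>F. F \<in> borel_measurable borel \<Longrightarrow> (\<And>x. x \<notin> range \<iota> \<Longrightarrow> F x = 0) \<Longrightarrow>
      (\<integral>\<^sup>+ x. F x \<partial>hausdorff_measure DIM((real ^ 'm) \<times> real)) = ennreal c * (\<integral>\<^sup>+ y. F (\<iota> y) \<partial>lborel)"
    by (rule nn_integral_hausdorff_subspace[OF linear_\<iota> norm_\<iota>]) (rule that, assumption, blast)
  let ?J = "\<lambda>u. JH d f (\<Phi> u) / JV d V f (\<Phi> u)" and ?a = "wedge_norm (case_sum v (case_option e_last w))"
  \<comment> \<open>Negative reals become 0 under \<open>ennreal\<close>, so passing to positive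
    parts here and in g yields a nonnegative real weight without discussing the signs of the Gram
    determinants.\<close>
  define K where "K = max 0 ?a * c"
  have K: "K \<ge> 0" "ennreal K = ennreal ?a * ennreal c"
    using c(1) by (auto simp: K_def max_def ennreal_mult' ennreal_neg)
  define g where "g u = K * max 0 (?J u)" for u
  have J: "continuous_on U ?J" by (rule continuous_on_jacobian_ratio[OF f v])
  have g: "continuous_on U g" unfolding g_def by (intro continuous_intros J)
  have eg: "ennreal (g u) = ennreal K * ennreal (?J u)" for u
  proof -
    have "ennreal (max 0 x) = ennreal x" for x :: real
      by (cases "x \<ge> 0") (auto simp: ennreal_neg max_def)
    then show ?thesis unfolding g_def using K(1) by (subst ennreal_mult) auto
  qed
  show ?thesis
  proof (rule that[OF g])
    show "g u \<ge> 0" for u using K(1) by (simp add: g_def)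
    fix B :: "'n heis set" assume B: "B \<in> sets borel"
    let ?F = "\<lambda>u. ennreal (?J u) * indicator {u\<in>U. \<Phi> u \<in> B} u"
    let ?G = "\<lambda>p. indicator {p. \<iota> p \<in> U \<and> \<Phi> (\<iota> p) \<in> B} p * ennreal (?J (\<iota> p))"
    have G: "?G \<in> borel_measurable borel" by (rule measurable_graph_integrand[OF J B])
    have FG: "?F (\<iota> p) = ?G p" for p by (simp add: indicator_def)
    have W: "W \<in> sets borel" using W_group by simp
    \<comment> \<open>The integrand is known to be Borel only in coordinates on W; composing with
      \<open>\<kappa>\<close> and cutting off outside W gives a Borel function on the whole
      group.\<close>
    have "(\<lambda>x. \<kappa> x) \<in> borel_measurable borel" by (intro borel_measurable_continuous_onI continuous_intros)
    then have "(\<lambda>x. ?G (\<kappa> x)) \<in> borel_measurable borel" by (rule measurable_compose[OF _ G])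
    moreover have "(\<lambda>x. H x * indicator W x) \<in> borel_measurable borel"
      if [measurable]: "H \<in> borel_measurable borel" for H :: "'n heis \<Rightarrow> ennreal"
      using W by measurable
    ultimately have "(\<lambda>x. ?G (\<kappa> x) * indicator W x) \<in> borel_measurable borel" by blast
    also have "(\<lambda>x. ?G (\<kappa> x) * indicator W x) = ?F"
    proof
      fix x show "?G (\<kappa> x) * indicator W x = ?F x"
        using U_W[of x] by (cases "x \<in> W") (auto simp: \<iota>_\<kappa> indicator_def)
    qed
    finally have F: "?F \<in> borel_measurable borel" .
    have F0: "?F x = 0" if "x \<notin> range \<iota>" for x
      using that U_W[of x] unfolding range_\<iota> by (auto simp: indicator_def)
    have "surface_measure d V U \<phi> f v (case_option e_last w) B = ennreal ?a * (ennreal c * (\<integral>\<^sup>+ p. ?F (\<iota> p) \<partial>lborel))"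
      unfolding surface_measure_def p using c(2)[OF F F0] by simp
    also have "\<dots> = ennreal K * (\<integral>\<^sup>+ p. ?G p \<partial>lborel)" unfolding FG K(2) by (simp add: mult.assoc)
    also have "\<dots> = (\<integral>\<^sup>+ p. ennreal K * ?G p \<partial>lborel)" using G by (simp add: nn_integral_cmult)
    also have "\<dots> = emeasure (graph_measure g) B"
      unfolding emeasure_graph_measure[OF g B] eg by (simp add: mult_ac)
    finally show "surface_measure d V U \<phi> f v (case_option e_last w) B = emeasure (graph_measure g) B" .
  qed
qed

end

theorem theorem4p2:
  fixes d :: "'n::finite heis \<Rightarrow> 'n heis \<Rightarrow> real"
    and W V U S \<Omega> :: "'n heis set"
    and \<phi> :: "'n heis \<Rightarrow> 'n heis"
    and f :: "'n heis \<Rightarrow> real ^ 'k::finite"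
    and v :: "'k \<Rightarrow> 'n heis"
    and w :: "'m::finite \<Rightarrow> 'n heis"
    and \<alpha> :: real
    and \<mu> :: "'n heis set \<Rightarrow> ennreal"
  assumes "CARD('k) \<le> CARD('n)"
    and "\<alpha> = 2 * real CARD('n) + 2 - real CARD('k)"
    and "homogeneous_distance d"
    and "convex (hball d 0 1)"
    and "semidirect W V"
    and "dim V = CARD('k)"
    and "parametrized_H_regular_surface TYPE('k) d W V U \<phi> S"
    and "defining_function d V U S \<Omega> f"
    and "orthonormal_basis v V"
    and "orthonormal_basis (case_option e_last w) W"
    and "\<mu> = surface_measure d V U \<phi> f v (case_option e_last w)"
  shows "(\<forall>x\<in>S. upper_density d \<alpha> \<mu> x = federer_density d \<alpha> \<mu> x) \<and>
         (\<forall>B\<in>sets borel. centered_measure d \<alpha> (B \<inter> S) = spherical_measure d \<alpha> (B \<inter> S))"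
proof -
  have S: "S = graph_map \<phi> ` U"
    using assms(7) by (simp add: parametrized_H_regular_surface_def)
  interpret intrinsic_graph d W V w U \<phi>
    using assms by unfold_locales (auto simp: parametrized_H_regular_surface_def)
  \<comment> \<open>Counting dimensions gives \<open>CARD('m)\<close> = 2n - k. So the Hausdorff
    measure in the integral has the dimension of W, and \<alpha> is the homogeneous dimension of
    W.\<close>
  have "DIM((real ^ 'm) \<times> real) + CARD('k) = 2 * CARD('n) + 1"
    using dim_W assms(6) by simp
  then have p: "2 * CARD('n) + 1 - CARD('k) = DIM((real ^ 'm) \<times> real)" and m: "CARD('m) + 1 + CARD('k) = 2 * CARD('n) + 1"
    by simp_all
  have \<alpha>: "\<alpha> = real (CARD('m) + 2)" using m assms(2) by linarith
  obtain g where g: "continuous_on U g" "\<And>u. g u \<ge> 0"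
    "\<And>B. B \<in> sets borel \<Longrightarrow> \<mu> B = emeasure (graph_measure g) B"
    using surface_measure_eq_graph_measure[OF assms(8)[unfolded S] assms(9) p] assms(11) by metis
  have \<mu>: "\<mu> (hball d y r) = emeasure (graph_measure g) (hball d y r)" for y r
    by (intro g borel_closed closed_hball)
  have "upper_density d \<alpha> \<mu> x = federer_density d \<alpha> \<mu> x" if x: "x \<in> S" for x
  proof -
    obtain u where u: "u \<in> U" "x = graph_map \<phi> u" using x S by blast
    show ?thesis
    proof (rule densities_eq)
      \<comment> \<open>The common value of the two densities: the weight times the area of the
        central tangent section.\<close>
      show "0 \<le> g u * ball_area (der u)" using g(2)[of u] ball_area(2)[OF der_hom[OF u(1)]] by simp
      show "\<alpha> > 0" by (simp add: \<alpha>)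
    next
      fix t assume "g u * ball_area (der u) < t"
      then obtain \<rho> where "\<rho> > 0" "\<And>y r. \<Phi> u \<in> hball d y r \<Longrightarrow> 0 < r \<Longrightarrow> r < \<rho> \<Longrightarrow>
          emeasure (graph_measure g) (hball d y r) \<le> ennreal (t * r powr real (CARD('m) + 2))"
        using density_upper[OF g(1) u(1) g(2)] by metis
      then show "\<exists>\<rho>>0. \<forall>y r. x \<in> hball d y r \<longrightarrow> 0 < r \<longrightarrow> r < \<rho> \<longrightarrow> \<mu> (hball d y r) \<le> ennreal (t * r powr \<alpha>)"
        unfolding \<mu> \<alpha> u(2) by blast
    next
      fix t assume "0 \<le> t" "t < g u * ball_area (der u)"
      then obtain \<rho> where "\<rho> > 0" "\<And>r. 0 < r \<Longrightarrow> r < \<rho> \<Longrightarrow>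
          ennreal (t * r powr real (CARD('m) + 2)) < emeasure (graph_measure g) (hball d (\<Phi> u) r)"
        using density_lower[OF g(1) u(1)] by metis
      then show "\<exists>\<rho>>0. \<forall>r. 0 < r \<longrightarrow> r < \<rho> \<longrightarrow> ennreal (t * r powr \<alpha>) < \<mu> (hball d x r)"
        unfolding \<mu> \<alpha> u(2) by blast
    qed
  qed
  moreover have "centered_measure d \<alpha> (B \<inter> S) = spherical_measure d \<alpha> (B \<inter> S)" for B
    unfolding \<alpha> S by (rule centered_eq_spherical_graph) blast
  ultimately show ?thesis by blast
qed

end
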